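(* Assume Hypothesis (H): there is a constant $d\ge1$ such that every language in $\mathsf{P}$ is decided by circuits of size $O(n^d)$. Then there are a polynomial-time generator $g$ (stretching every input of length $n$ to some length $m(n)>n$) and a model $\mathbf{M}$ of $T_{PV}$ such that for every $\mathsf{NP}$ set $A$ (represented as below), $$\mathbf M\models\ \mathrm{rng}(g)\cap A=\emptyset\ \to\ \neg\mathrm{Inf}_A.$$
   Context: $T_{PV}$ is the theory whose language has a $k$-ary function symbol $f_M$ for every polynomial-time clocked machine $M$ with $k$ inputs ($k\ge1$), interpreted on $\mathbb N$ as the function $M$ computes, and whose axioms are all universal sentences of this language true in $\mathbb N$. An $\mathsf{NP}$ set $A$ is represented by a formula $y\in A:\equiv\exists z(|z|\le|y|^c)A_0(y,z)$ with $c\ge1$ a constant and $A_0$ an open formula defining a polynomial-time relation; $\mathrm{Inf}_A$ is the sentence $\forall x\exists y(y>x\wedge y\in A)$, and $\mathrm{rng}(g)\cap A=\emptyset$ is the universal sentence $\forall x\forall z\,\neg(|z|\le|g(x)|^c\wedge A_0(g(x),z))$ with $g$ denoted by its function symbol. *)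

theory Defs
  imports Complex_Main "HOL-Library.Log_Nat" "HOL-Library.Landau_Symbols"
begin

section \<open>Numbers and bit strings\<close>

text \<open>
  The length \<open>|x|\<close> of a number is the length of its binary expansion (\<open>|0| = 0\<close>).  Bit strings
  list the least significant bit first.  Decoding accepts strings with superfluous leading zeros.
\<close>

definition len :: "nat \<Rightarrow> nat"
  where "len x = floorlog 2 x"

definition bits_of :: "nat \<Rightarrow> bool list"
  where "bits_of x = map (bit x) [0..<len x]"

definition num_of :: "bool list \<Rightarrow> nat"
  where "num_of w = horner_sum of_bool 2 w"


section \<open>Polynomial-time clocked Turing machines\<close>

text \<open>
  Deterministic multitape machines with two-way infinite tapes over a finite alphabet of natural
  numbers, where 0 is the blank and 1, 2 stand for the bits 0, 1.  The transition function is the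
  finite partial function \<open>map_of\<close> of the table; a machine halts when no entry applies.  The start
  state is 0.  Tapes \<open>0, \<dots>, k - 1\<close> initially hold the \<open>k\<close> inputs, written from cell 0 on with the
  head on cell 0; tape \<open>k\<close> is the output tape.  The clock stops the computation after
  \<open>n ^ e + e\<close> steps, \<open>n\<close> being the total length of the inputs.
\<close>

datatype move = Left | Stay | Right

record machine =
  inputs :: nat
  tapes :: nat
  table :: "((nat \<times> nat list) \<times> (nat \<times> (nat \<times> move) list)) list"
  clock_exp :: nat

definition clocked_machine :: "machine \<Rightarrow> bool"
  where "clocked_machine M \<longleftrightarrow>
    1 \<le> inputs M \<and> inputs M < tapes M \<and>
    (\<forall>((q, ss), (q', acts)) \<in> set (table M). length ss = tapes M \<and> length acts = tapes M)"

type_synonym tape = "(int \<Rightarrow> nat) \<times> int"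
type_synonym config = "nat \<times> tape list"

fun read :: "tape \<Rightarrow> nat"
  where "read (t, h) = t h"

fun shift :: "move \<Rightarrow> int \<Rightarrow> int"
  where
    "shift Left h = h - 1"
  | "shift Stay h = h"
  | "shift Right h = h + 1"

fun act :: "nat \<times> move \<Rightarrow> tape \<Rightarrow> tape"
  where "act (s, d) (t, h) = (t(h := s), shift d h)"

fun step :: "machine \<Rightarrow> config \<Rightarrow> config"
  where "step M (q, ts) =
    (case map_of (table M) (q, map read ts) of
       None \<Rightarrow> (q, ts)
     | Some (q', acts) \<Rightarrow> (q', map2 act acts ts))"

definition tape_of :: "bool list \<Rightarrow> tape"
  where "tape_of w =
    ((\<lambda>i. if 0 \<le> i \<and> i < int (length w) then (if w ! nat i then 2 else 1) else 0), 0)"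

definition start :: "machine \<Rightarrow> bool list list \<Rightarrow> config"
  where "start M ws = (0, map tape_of ws @ replicate (tapes M - inputs M) (tape_of []))"

definition clock :: "machine \<Rightarrow> bool list list \<Rightarrow> nat"
  where "clock M ws = (let n = sum_list (map length ws) in n ^ clock_exp M + clock_exp M)"

text \<open>The output is the maximal block of bits that starts in cell 0 of the output tape.\<close>

fun contents :: "tape \<Rightarrow> bool list"
  where "contents (t, h) = map (\<lambda>i. t (int i) = 2) [0..<(LEAST i. t (int i) \<notin> {1, 2})]"

definition out_of :: "machine \<Rightarrow> bool list list \<Rightarrow> bool list"
  where "out_of M ws = contents (snd ((step M ^^ clock M ws) (start M ws)) ! inputs M)"

definition fun_of :: "machine \<Rightarrow> nat list \<Rightarrow> nat"
  where "fun_of M xs = num_of (out_of M (map bits_of xs))"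

definition class_P :: "bool list set set"
  where "class_P =
    {L. \<exists>M. clocked_machine M \<and> inputs M = 1 \<and> (\<forall>w. w \<in> L \<longleftrightarrow> out_of M [w] = [True])}"


section \<open>Boolean circuits\<close>

text \<open>
  A circuit is a straight-line program over the basis \<open>\<not>, \<and>, \<or>\<close> with constants; the arguments of
  a gate are positions of earlier gates, and the last gate is the output.  The size is the number
  of gates, input gates included.
\<close>

datatype gate = In_gate nat | Const_gate bool | Not_gate nat | And_gate nat nat | Or_gate nat nat

type_synonym circuit = "gate list"

fun gate_ok :: "nat \<Rightarrow> nat \<Rightarrow> gate \<Rightarrow> bool"
  where
    "gate_ok n i (In_gate a) \<longleftrightarrow> a < n"
  | "gate_ok n i (Const_gate b) \<longleftrightarrow> True"
  | "gate_ok n i (Not_gate a) \<longleftrightarrow> a < i"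
  | "gate_ok n i (And_gate a b) \<longleftrightarrow> a < i \<and> b < i"
  | "gate_ok n i (Or_gate a b) \<longleftrightarrow> a < i \<and> b < i"

definition circuit :: "nat \<Rightarrow> circuit \<Rightarrow> bool"
  where "circuit n C \<longleftrightarrow> C \<noteq> [] \<and> (\<forall>i<length C. gate_ok n i (C ! i))"

fun gate_val :: "bool list \<Rightarrow> bool list \<Rightarrow> gate \<Rightarrow> bool"
  where
    "gate_val w vs (In_gate a) = w ! a"
  | "gate_val w vs (Const_gate b) = b"
  | "gate_val w vs (Not_gate a) = (\<not> vs ! a)"
  | "gate_val w vs (And_gate a b) = (vs ! a \<and> vs ! b)"
  | "gate_val w vs (Or_gate a b) = (vs ! a \<or> vs ! b)"

definition circuit_val :: "circuit \<Rightarrow> bool list \<Rightarrow> bool"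
  where "circuit_val C w = last (foldl (\<lambda>vs g. vs @ [gate_val w vs g]) [] C)"

definition SIZE_O :: "nat \<Rightarrow> bool list set set"
  where "SIZE_O d =
    {L. \<exists>C :: nat \<Rightarrow> circuit.
       (\<forall>n. circuit n (C n) \<and> (\<forall>w. length w = n \<longrightarrow> (circuit_val (C n) w \<longleftrightarrow> w \<in> L))) \<and>
       (\<lambda>n. real (length (C n))) \<in> O(\<lambda>n. real n ^ d)}"

definition hypothesis_H :: bool
  where "hypothesis_H \<longleftrightarrow> (\<exists>d\<ge>1. class_P \<subseteq> SIZE_O d)"


section \<open>First-order logic with equality\<close>

datatype 'f trm = Var nat | Fn 'f "'f trm list"

datatype 'f fm =
    Eq "'f trm" "'f trm"
  | Neg "'f fm"
  | Conj "'f fm" "'f fm"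
  | Disj "'f fm" "'f fm"
  | Imp "'f fm" "'f fm"
  | All nat "'f fm"
  | Ex nat "'f fm"

record ('f, 'u) struct =
  univ :: "'u set"
  interp :: "'f \<Rightarrow> 'u list \<Rightarrow> 'u"

fun tval :: "('f, 'u) struct \<Rightarrow> (nat \<Rightarrow> 'u) \<Rightarrow> 'f trm \<Rightarrow> 'u"
  where
    "tval S e (Var x) = e x"
  | "tval S e (Fn f ts) = interp S f (map (tval S e) ts)"

fun sat :: "('f, 'u) struct \<Rightarrow> (nat \<Rightarrow> 'u) \<Rightarrow> 'f fm \<Rightarrow> bool"
  where
    "sat S e (Eq t u) \<longleftrightarrow> tval S e t = tval S e u"
  | "sat S e (Neg \<phi>) \<longleftrightarrow> \<not> sat S e \<phi>"
  | "sat S e (Conj \<phi> \<psi>) \<longleftrightarrow> sat S e \<phi> \<and> sat S e \<psi>"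
  | "sat S e (Disj \<phi> \<psi>) \<longleftrightarrow> sat S e \<phi> \<or> sat S e \<psi>"
  | "sat S e (Imp \<phi> \<psi>) \<longleftrightarrow> (sat S e \<phi> \<longrightarrow> sat S e \<psi>)"
  | "sat S e (All x \<phi>) \<longleftrightarrow> (\<forall>a\<in>univ S. sat S (e(x := a)) \<phi>)"
  | "sat S e (Ex x \<phi>) \<longleftrightarrow> (\<exists>a\<in>univ S. sat S (e(x := a)) \<phi>)"

definition models :: "('f, 'u) struct \<Rightarrow> 'f fm \<Rightarrow> bool"  (infix \<open>\<Turnstile>\<close> 50)
  where "S \<Turnstile> \<phi> \<longleftrightarrow> (\<forall>e. range e \<subseteq> univ S \<longrightarrow> sat S e \<phi>)"

fun tvars :: "'f trm \<Rightarrow> nat set"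
  where
    "tvars (Var x) = {x}"
  | "tvars (Fn f ts) = (\<Union>t\<in>set ts. tvars t)"

fun fvars :: "'f fm \<Rightarrow> nat set"
  where
    "fvars (Eq t u) = tvars t \<union> tvars u"
  | "fvars (Neg \<phi>) = fvars \<phi>"
  | "fvars (Conj \<phi> \<psi>) = fvars \<phi> \<union> fvars \<psi>"
  | "fvars (Disj \<phi> \<psi>) = fvars \<phi> \<union> fvars \<psi>"
  | "fvars (Imp \<phi> \<psi>) = fvars \<phi> \<union> fvars \<psi>"
  | "fvars (All x \<phi>) = fvars \<phi> - {x}"
  | "fvars (Ex x \<phi>) = fvars \<phi> - {x}"

fun open_fm :: "'f fm \<Rightarrow> bool"
  where
    "open_fm (Eq t u) \<longleftrightarrow> True"
  | "open_fm (Neg \<phi>) \<longleftrightarrow> open_fm \<phi>"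
  | "open_fm (Conj \<phi> \<psi>) \<longleftrightarrow> open_fm \<phi> \<and> open_fm \<psi>"
  | "open_fm (Disj \<phi> \<psi>) \<longleftrightarrow> open_fm \<phi> \<and> open_fm \<psi>"
  | "open_fm (Imp \<phi> \<psi>) \<longleftrightarrow> open_fm \<phi> \<and> open_fm \<psi>"
  | "open_fm (All x \<phi>) \<longleftrightarrow> False"
  | "open_fm (Ex x \<phi>) \<longleftrightarrow> False"

definition universal_sentence :: "'f fm \<Rightarrow> bool"
  where "universal_sentence \<phi> \<longleftrightarrow>
    fvars \<phi> = {} \<and> (\<exists>xs \<psi>. open_fm \<psi> \<and> \<phi> = foldr All xs \<psi>)"

fun tsubst :: "(nat \<Rightarrow> 'f trm) \<Rightarrow> 'f trm \<Rightarrow> 'f trm"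
  where
    "tsubst \<sigma> (Var x) = \<sigma> x"
  | "tsubst \<sigma> (Fn f ts) = Fn f (map (tsubst \<sigma>) ts)"

text \<open>Substitution does not rename bound variables; it is only applied to open formulas.\<close>

fun subst :: "(nat \<Rightarrow> 'f trm) \<Rightarrow> 'f fm \<Rightarrow> 'f fm"
  where
    "subst \<sigma> (Eq t u) = Eq (tsubst \<sigma> t) (tsubst \<sigma> u)"
  | "subst \<sigma> (Neg \<phi>) = Neg (subst \<sigma> \<phi>)"
  | "subst \<sigma> (Conj \<phi> \<psi>) = Conj (subst \<sigma> \<phi>) (subst \<sigma> \<psi>)"
  | "subst \<sigma> (Disj \<phi> \<psi>) = Disj (subst \<sigma> \<phi>) (subst \<sigma> \<psi>)"
  | "subst \<sigma> (Imp \<phi> \<psi>) = Imp (subst \<sigma> \<phi>) (subst \<sigma> \<psi>)"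
  | "subst \<sigma> (All x \<phi>) = All x (subst (\<sigma>(x := Var x)) \<phi>)"
  | "subst \<sigma> (Ex x \<phi>) = Ex x (subst (\<sigma>(x := Var x)) \<phi>)"


section \<open>The theory \<open>T\<^sub>P\<^sub>V\<close>\<close>

text \<open>
  The function symbol \<open>f\<^sub>M\<close> is the clocked machine \<open>M\<close> itself, of arity \<open>inputs M\<close>.  The language
  is countable, so models with universe a set of natural numbers lose no generality
  (Loewenheim-Skolem).
\<close>

fun PV_trm :: "machine trm \<Rightarrow> bool"
  where
    "PV_trm (Var x) \<longleftrightarrow> True"
  | "PV_trm (Fn M ts) \<longleftrightarrow> clocked_machine M \<and> length ts = inputs M \<and> (\<forall>t\<in>set ts. PV_trm t)"

fun PV_fm :: "machine fm \<Rightarrow> bool"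
  where
    "PV_fm (Eq t u) \<longleftrightarrow> PV_trm t \<and> PV_trm u"
  | "PV_fm (Neg \<phi>) \<longleftrightarrow> PV_fm \<phi>"
  | "PV_fm (Conj \<phi> \<psi>) \<longleftrightarrow> PV_fm \<phi> \<and> PV_fm \<psi>"
  | "PV_fm (Disj \<phi> \<psi>) \<longleftrightarrow> PV_fm \<phi> \<and> PV_fm \<psi>"
  | "PV_fm (Imp \<phi> \<psi>) \<longleftrightarrow> PV_fm \<phi> \<and> PV_fm \<psi>"
  | "PV_fm (All x \<phi>) \<longleftrightarrow> PV_fm \<phi>"
  | "PV_fm (Ex x \<phi>) \<longleftrightarrow> PV_fm \<phi>"

definition PV_structure :: "(machine, 'u) struct \<Rightarrow> bool"
  where "PV_structure S \<longleftrightarrow>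
    univ S \<noteq> {} \<and>
    (\<forall>M as. clocked_machine M \<longrightarrow> length as = inputs M \<longrightarrow> set as \<subseteq> univ S \<longrightarrow>
       interp S M as \<in> univ S)"

definition standard_model :: "(machine, nat) struct"
  where "standard_model = \<lparr>univ = UNIV, interp = fun_of\<rparr>"

definition T_PV :: "machine fm set"
  where "T_PV = {\<phi>. PV_fm \<phi> \<and> universal_sentence \<phi> \<and> standard_model \<Turnstile> \<phi>}"

definition T_PV_model :: "(machine, 'u) struct \<Rightarrow> bool"
  where "T_PV_model S \<longleftrightarrow> PV_structure S \<and> (\<forall>\<phi>\<in>T_PV. S \<Turnstile> \<phi>)"

text \<open>
  The language has no relation symbols besides equality.  A polynomial-time relation \<open>R\<close> is
  expressed by \<open>\<chi>\<^sub>R(ts) = 1(ts)\<close>, with symbols for its characteristic function and for the constant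
  function 1.  The choice of the machines computing them is immaterial: the equality of any two
  such choices is a universal sentence true in \<open>\<nat>\<close>.
\<close>

definition char_sym :: "nat \<Rightarrow> (nat list \<Rightarrow> bool) \<Rightarrow> machine"
  where "char_sym k R = (SOME M. clocked_machine M \<and> inputs M = k \<and>
    (\<forall>xs. length xs = k \<longrightarrow> fun_of M xs = of_bool (R xs)))"

definition Rel :: "(nat list \<Rightarrow> bool) \<Rightarrow> machine trm list \<Rightarrow> machine fm"
  where "Rel R ts =
    Eq (Fn (char_sym (length ts) R) ts) (Fn (char_sym (length ts) (\<lambda>_. True)) ts)"

definition Less :: "machine trm \<Rightarrow> machine trm \<Rightarrow> machine fm"
  where "Less t u = Rel (\<lambda>xs. xs ! 0 < xs ! 1) [t, u]"

text \<open>\<open>Len_le_pow c t u\<close> is the formula \<open>|t| \<le> |u| ^ c\<close>.\<close>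

definition Len_le_pow :: "nat \<Rightarrow> machine trm \<Rightarrow> machine trm \<Rightarrow> machine fm"
  where "Len_le_pow c t u = Rel (\<lambda>xs. len (xs ! 0) \<le> len (xs ! 1) ^ c) [t, u]"


section \<open>\<open>NP\<close> sets and generators\<close>

text \<open>
  The variables \<open>x, y, z\<close> are \<open>Var 0\<close>, \<open>Var 1\<close>, \<open>Var 2\<close>.  A representation of an \<open>NP\<close> set is a
  pair \<open>(c, A\<^sub>0)\<close>; every open formula of the language defines a polynomial-time relation.
\<close>

type_synonym np_set = "nat \<times> machine fm"

fun NP_set :: "np_set \<Rightarrow> bool"
  where "NP_set (c, A0) \<longleftrightarrow> 1 \<le> c \<and> PV_fm A0 \<and> open_fm A0 \<and> fvars A0 \<subseteq> {1, 2}"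

fun Mem :: "np_set \<Rightarrow> machine fm"
  where "Mem (c, A0) = Ex 2 (Conj (Len_le_pow c (Var 2) (Var 1)) A0)"

definition Inf_fm :: "np_set \<Rightarrow> machine fm"
  where "Inf_fm A = All 0 (Ex 1 (Conj (Less (Var 0) (Var 1)) (Mem A)))"

fun Rng_disjoint :: "machine \<Rightarrow> np_set \<Rightarrow> machine fm"
  where "Rng_disjoint g (c, A0) =
    (let gx = Fn g [Var 0] in
       All 0 (All 2 (Neg (Conj (Len_le_pow c (Var 2) gx) (subst (Var(1 := gx)) A0)))))"

definition generator :: "machine \<Rightarrow> bool"
  where "generator g \<longleftrightarrow> clocked_machine g \<and> inputs g = 1 \<and>
    (\<exists>m :: nat \<Rightarrow> nat. (\<forall>n. n < m n) \<and> (\<forall>x. len (fun_of g [x]) = m (len x)))"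

end

theory Submission
  imports Defs "HOL-Library.Countable_Set" "HOL-Library.Diagonal_Subsequence"
begin

text \<open>
  The generator \<open>g\<close> reads its input \<open>x\<close> of length \<open>N\<close> as a straight-line program on a bit memory,
  runs it \<open>N\<close> times in a row on the same memory, outputs one bit per round and finally a \<open>1\<close>.  A
  program that keeps a counter \<open>i\<close> in the memory and evaluates a circuit at \<open>i\<close> thus makes \<open>g\<close>
  output the truth table of the circuit.  If \<open>y = t(2 ^ n)\<close> for a term \<open>t\<close>, then the bits of \<open>y\<close> are
  decided, given \<open>i\<close> in \<open>n\<close> bits, by a polynomial-time machine, hence under (H) by circuits of size
  \<open>O(n ^ d)\<close>; so \<open>y\<close> lies in the range of \<open>g\<close> as soon as \<open>|y| > n ^ (2 d + 1)\<close> and \<open>n\<close> is large.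

  The universe of the model consists of the functions \<open>n \<mapsto> t(2 ^ n)\<close> given by terms \<open>t\<close>, modulo
  eventual equality along a subsequence \<open>r\<close> that decides all equations between such functions (a
  diagonal argument; no ultrafilter is needed since there are only countably many terms).  An open
  formula holds in it iff it eventually holds in \<open>\<nat>\<close> along \<open>r\<close>.  If \<open>Inf\<^sub>A\<close> held in the model, some
  \<open>t(2 ^ n)\<close> longer than \<open>n ^ (2 d + 1)\<close> would be in \<open>A\<close> for almost all \<open>n\<close> in \<open>r\<close>, so the range of \<open>g\<close>
  would meet \<open>A\<close> in \<open>\<nat>\<close>, and then also in the model because every number is the value of a term.

  All machines are compiled from programs over stacks.  A stack occupies a tape on which everything
  beyond the head is blank, so programs compose without rewinding tapes.
\<close>


section \<open>Stack programs and their compilation to Turing machines\<close>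

type_synonym stacks = "nat \<Rightarrow> nat list"

datatype prog =
    Skip
  | Push nat nat
  | Pop nat
  | Emit bool
  | Seq prog prog  (infixr \<open>;;\<close> 60)
  | Switch nat "nat \<Rightarrow> prog"
  | While nat "nat \<Rightarrow> bool" prog

fun peek :: "nat list \<Rightarrow> nat"
  where
    "peek [] = 0"
  | "peek (a # w) = a"

text \<open>
  A stack occupies a tape that is blank elsewhere, with the head on the top element; hence an empty
  stack shows the blank 0 and only nonzero symbols may be pushed.  In \<open>run p s t s' os\<close>, the number
  \<open>t\<close> is only an upper bound for the running time of the compiled program, and \<open>os\<close> is the word
  appended to the output tape.
\<close>

inductive run :: "prog \<Rightarrow> stacks \<Rightarrow> nat \<Rightarrow> stacks \<Rightarrow> bool list \<Rightarrow> bool"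
  where
    Skip: "run Skip s t s []"
  | Push: "2 \<le> t \<Longrightarrow> run (Push i a) s t (s(i := a # s i)) []"
  | Pop: "1 \<le> t \<Longrightarrow> run (Pop i) s t (s(i := tl (s i))) []"
  | Emit: "1 \<le> t \<Longrightarrow> run (Emit b) s t s [b]"
  | Seq: "run p s t1 s1 o1 \<Longrightarrow> run q s1 t2 s2 o2 \<Longrightarrow> t1 + t2 \<le> t \<Longrightarrow> run (p ;; q) s t s2 (o1 @ o2)"
  | Switch: "run (f (peek (s i))) s t1 s1 o1 \<Longrightarrow> t1 + 2 \<le> t \<Longrightarrow> run (Switch i f) s t s1 o1"
  | While_False: "\<not> P (peek (s i)) \<Longrightarrow> 1 \<le> t \<Longrightarrow> run (While i P p) s t s []"
  | While_True: "P (peek (s i)) \<Longrightarrow> run p s t1 s1 o1 \<Longrightarrow> run (While i P p) s1 t2 s2 o2 \<Longrightarrow>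
      t1 + t2 + 2 \<le> t \<Longrightarrow> run (While i P p) s t s2 (o1 @ o2)"

text \<open>Tape \<open>k\<close> is reserved for the output; \<open>N\<close> bounds both the stacks and the symbols.\<close>

primrec wf_prog :: "nat \<Rightarrow> nat \<Rightarrow> prog \<Rightarrow> bool"
  where
    "wf_prog k N Skip \<longleftrightarrow> True"
  | "wf_prog k N (Push i a) \<longleftrightarrow> i < N \<and> i \<noteq> k \<and> 0 < a \<and> a < N"
  | "wf_prog k N (Pop i) \<longleftrightarrow> i < N \<and> i \<noteq> k"
  | "wf_prog k N (Emit b) \<longleftrightarrow> True"
  | "wf_prog k N (p ;; q) \<longleftrightarrow> wf_prog k N p \<and> wf_prog k N q"
  | "wf_prog k N (Switch i f) \<longleftrightarrow> i < N \<and> i \<noteq> k \<and> (\<forall>a<N. wf_prog k N (f a))"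
  | "wf_prog k N (While i P p) \<longleftrightarrow> i < N \<and> i \<noteq> k \<and> wf_prog k N p"

text \<open>
  An instruction \<open>(i, \<delta>)\<close> reads tape \<open>i\<close> and maps the symbol found there to an action on this tape
  and the next state.  States are positions in the list of instructions.
\<close>

type_synonym instr = "nat \<times> (nat \<Rightarrow> (nat \<times> move) \<times> nat)"

definition goto :: "nat \<Rightarrow> (nat \<Rightarrow> nat) \<Rightarrow> instr"
  where "goto i f = (i, \<lambda>a. ((a, Stay), f a))"

definition bit_sym :: "bool \<Rightarrow> nat"
  where "bit_sym b = (if b then 2 else 1)"

definition branch_offset :: "(nat \<Rightarrow> nat) \<Rightarrow> nat \<Rightarrow> nat"
  where "branch_offset c a = (\<Sum>r<a. c r + 1)"

primrec code_size :: "nat \<Rightarrow> prog \<Rightarrow> nat"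
  where
    "code_size N Skip = 0"
  | "code_size N (Push i a) = 2"
  | "code_size N (Pop i) = 1"
  | "code_size N (Emit b) = 1"
  | "code_size N (p ;; q) = code_size N p + code_size N q"
  | "code_size N (Switch i f) = 1 + branch_offset (\<lambda>a. code_size N (f a)) N"
  | "code_size N (While i P p) = code_size N p + 2"

primrec compile :: "nat \<Rightarrow> nat \<Rightarrow> prog \<Rightarrow> nat \<Rightarrow> instr list"
  where
    "compile k N Skip = (\<lambda>q. [])"
  | "compile k N (Push i a) = (\<lambda>q. [(i, \<lambda>r. ((r, Left), q + 1)), (i, \<lambda>r. ((a, Stay), q + 2))])"
  | "compile k N (Pop i) = (\<lambda>q. [(i, \<lambda>r. ((0, Right), q + 1))])"
  | "compile k N (Emit b) = (\<lambda>q. [(k, \<lambda>r. ((bit_sym b, Right), q + 1))])"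
  | "compile k N (p ;; p') = (\<lambda>q. compile k N p q @ compile k N p' (q + code_size N p))"
  | "compile k N (Switch i f) = (\<lambda>q.
       goto i (\<lambda>a. q + 1 + branch_offset (\<lambda>a. code_size N (f a)) a) #
       concat (map (\<lambda>a. compile k N (f a) (q + 1 + branch_offset (\<lambda>a. code_size N (f a)) a) @
         [goto i (\<lambda>_. q + code_size N (Switch i f))]) [0..<N]))"
  | "compile k N (While i P p) = (\<lambda>q.
       goto i (\<lambda>a. if P a then q + 1 else q + code_size N p + 2) #
       compile k N p (q + 1) @ [goto i (\<lambda>_. q)])"

lemma length_compile: "length (compile k N p q) = code_size N p"
proof (induction p arbitrary: q)
  case (Switch i f)
  then show ?case
    by (simp add: length_concat o_def branch_offset_def interv_sum_list_conv_sum_set_nat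
        atLeast0LessThan)
qed auto


subsection \<open>Machines given by instructions\<close>

definition instr_entry :: "nat \<Rightarrow> instr \<Rightarrow> nat list \<Rightarrow> nat \<times> (nat \<times> move) list"
  where "instr_entry N = (\<lambda>(i, \<delta>) ss.
    (snd (\<delta> (ss ! i)), map (\<lambda>j. if j = i then fst (\<delta> (ss ! i)) else (ss ! j, Stay)) [0..<N]))"

definition machine_of :: "nat \<Rightarrow> nat \<Rightarrow> nat \<Rightarrow> instr list \<Rightarrow> machine"
  where "machine_of k N e code = \<lparr>inputs = k, tapes = N,
    table = map (\<lambda>(q, ss). ((q, ss), instr_entry N (code ! q) ss))
      (List.product [0..<length code] (List.n_lists N [0..<N])),
    clock_exp = e\<rparr>"

lemma clocked_machine_of: "1 \<le> k \<Longrightarrow> k < N \<Longrightarrow> clocked_machine (machine_of k N e code)"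
  by (auto simp: clocked_machine_def machine_of_def instr_entry_def set_n_lists
      split: prod.splits)

lemma map_of_table_machine_of:
  "map_of (table (machine_of k N e code)) (q, ss) =
    (if q < length code \<and> length ss = N \<and> set ss \<subseteq> {..<N}
     then Some (instr_entry N (code ! q) ss) else None)"
proof -
  have "table (machine_of k N e code) =
      map (\<lambda>x. (x, instr_entry N (code ! fst x) (snd x)))
        (List.product [0..<length code] (List.n_lists N [0..<N]))"
    by (simp add: machine_of_def case_prod_unfold)
  then show ?thesis
    by (auto simp: map_of_map_restrict restrict_map_def set_n_lists)
qed

definition code_at :: "instr list \<Rightarrow> nat \<Rightarrow> instr list \<Rightarrow> bool"
  where "code_at code q c \<longleftrightarrow> (\<forall>i<length c. q + i < length code \<and> code ! (q + i) = c ! i)"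

lemma code_at_Nil [simp]: "code_at code q []"
  by (simp add: code_at_def)

lemma code_at_Cons [simp]:
  "code_at code q (x # c) \<longleftrightarrow> q < length code \<and> code ! q = x \<and> code_at code (Suc q) c"
  by (auto simp: code_at_def less_Suc_eq_0_disj)

lemma code_at_append:
  "code_at code q (c @ c') \<longleftrightarrow> code_at code q c \<and> code_at code (q + length c) c'"
  by (induction c arbitrary: q) auto

lemma code_at_concat:
  assumes "code_at code q (concat (map c [0..<n]))" and "a < n"
  shows "code_at code (q + (\<Sum>r<a. length (c r))) (c a)"
  using assms
proof (induction n)
  case (Suc n)
  have "length (concat (map c [0..<n])) = (\<Sum>r<n. length (c r))"
    by (simp add: length_concat o_def interv_sum_list_conv_sum_set_nat atLeast0LessThan)
  with Suc show ?case by (auto simp: code_at_append less_Suc_eq)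
qed simp

lemma code_at_Switch:
  assumes "code_at code q (compile k N (Switch i f) q)" and "a < N"
  defines "q' \<equiv> q + 1 + branch_offset (\<lambda>a. code_size N (f a)) a"
  shows "code_at code q' (compile k N (f a) q')"
    and "code_at code (q' + code_size N (f a)) [goto i (\<lambda>_. q + code_size N (Switch i f))]"
proof -
  define c where "c a = compile k N (f a) (q + 1 + branch_offset (\<lambda>a. code_size N (f a)) a) @
    [goto i (\<lambda>_. q + code_size N (Switch i f))]" for a
  have "code_at code (Suc q) (concat (map c [0..<N]))"
    using assms(1) unfolding c_def by simp
  then have "code_at code (Suc q + (\<Sum>r<a. length (c r))) (c a)"
    using \<open>a < N\<close> by (rule code_at_concat)
  moreover have "Suc q + (\<Sum>r<a. length (c r)) = q'"
    by (simp add: q'_def c_def length_compile branch_offset_def)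
  ultimately have "code_at code q' (c a)" by simp
  then show "code_at code q' (compile k N (f a) q')"
    and "code_at code (q' + code_size N (f a)) [goto i (\<lambda>_. q + code_size N (Switch i f))]"
    unfolding c_def q'_def[symmetric] code_at_append length_compile by blast+
qed

definition reaches :: "('c \<Rightarrow> 'c) \<Rightarrow> nat \<Rightarrow> 'c \<Rightarrow> 'c \<Rightarrow> bool"
  where "reaches f t x y \<longleftrightarrow> (\<exists>n\<le>t. (f ^^ n) x = y)"

lemma reaches_refl: "reaches f t x x"
  unfolding reaches_def by (intro exI[of _ 0]) simp

lemma reaches_step: "f x = y \<Longrightarrow> 1 \<le> t \<Longrightarrow> reaches f t x y"
  unfolding reaches_def by (intro exI[of _ 1]) simp

lemma reaches_trans:
  assumes "reaches f t x y" and "reaches f u y z" and "t + u \<le> v"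
  shows "reaches f v x z"
proof -
  from assms(1,2) obtain m n where "m \<le> t" "(f ^^ m) x = y" "n \<le> u" "(f ^^ n) y = z"
    unfolding reaches_def by blast
  then have "n + m \<le> v" "(f ^^ (n + m)) x = z"
    using assms(3) by (simp_all add: funpow_add)
  then show ?thesis unfolding reaches_def by blast
qed

lemma reaches_fixpoint:
  assumes "reaches f t x y" and "f y = y" and "t \<le> n"
  shows "(f ^^ n) x = y"
proof -
  from assms(1) obtain m where m: "m \<le> t" "(f ^^ m) x = y"
    unfolding reaches_def by blast
  have "(f ^^ n) x = (f ^^ (n - m)) ((f ^^ m) x)"
    using m(1) assms(3) by (simp flip: funpow_add comp_apply[of "f ^^ _" "f ^^ _"])
  also have "\<dots> = (f ^^ (n - m)) y"
    by (simp only: m(2))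
  also have "(f ^^ j) y = y" for j
    by (induction j) (simp_all add: assms(2))
  finally show ?thesis .
qed


subsection \<open>Stacks on tapes\<close>

definition word_syms :: "bool list \<Rightarrow> nat list"
  where "word_syms w = map bit_sym w"

definition block :: "int \<Rightarrow> nat list \<Rightarrow> int \<Rightarrow> nat"
  where "block h w j = (if h \<le> j \<and> j < h + int (length w) then w ! nat (j - h) else 0)"

lemma block_peek: "block h w h = peek w"
  by (cases w) (auto simp: block_def)

lemma block_push: "(block h w)(h - 1 := a) = block (h - 1) (a # w)"
proof
  fix j
  show "((block h w)(h - 1 := a)) j = block (h - 1) (a # w) j"
  proof (cases "h \<le> j")
    case True
    then have "nat (j - (h - 1)) = Suc (nat (j - h))" by simp
    with True show ?thesis by (simp add: block_def)
  qed (auto simp: block_def)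
qed

lemma block_pop: "(block h w)(h := 0) = block (h + 1) (tl w)"
proof (cases w)
  case (Cons a v)
  then show ?thesis
    using block_push[of "h + 1" v a] by (auto simp: fun_eq_iff block_def split: if_splits)
qed (auto simp: block_def fun_eq_iff)

lemma block_emit: "(block 0 w)(int (length w) := a) = block 0 (w @ [a])"
  by (auto simp: block_def fun_eq_iff nth_append)

locale stack_machine =
  fixes k N e :: nat and code :: "instr list"
  assumes output_tape: "k < N" and symbols: "2 < N"
begin

abbreviation M :: machine
  where "M \<equiv> machine_of k N e code"

definition stores :: "stacks \<Rightarrow> bool list \<Rightarrow> tape list \<Rightarrow> bool"
  where "stores s out ts \<longleftrightarrow> length ts = N \<and>
    (\<forall>i<N. i \<noteq> k \<longrightarrow> set (s i) \<subseteq> {0<..<N} \<and> (\<exists>h. ts ! i = (block h (s i), h))) \<and>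
    ts ! k = (block 0 (word_syms out), int (length out))"

lemma read_less:
  assumes "stores s out ts" and "j < N"
  shows "read (ts ! j) < N"
proof (cases "j = k")
  case True
  with assms symbols show ?thesis by (auto simp: stores_def block_def word_syms_def)
next
  case False
  with assms obtain h where "ts ! j = (block h (s j), h)" "set (s j) \<subseteq> {0<..<N}"
    by (auto simp: stores_def)
  with symbols show ?thesis by (cases "s j") (auto simp: block_peek)
qed

lemma step_instr:
  assumes "code_at code q [(i, \<delta>)]" and "i < N" and "length ts = N"
    and "\<forall>j<N. read (ts ! j) < N"
  shows "step M (q, ts) =
    (snd (\<delta> (read (ts ! i))), ts[i := act (fst (\<delta> (read (ts ! i)))) (ts ! i)])"
proof -
  define ss where "ss = map read ts"
  have "set ss \<subseteq> {..<N}"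
    using assms(3,4) by (fastforce simp: ss_def in_set_conv_nth simp del: read.simps)
  then have entry: "map_of (table M) (q, ss) = Some (instr_entry N (i, \<delta>) ss)"
    using assms(1,3) by (simp add: map_of_table_machine_of ss_def)
  have act_read: "act (read \<tau>, Stay) \<tau> = \<tau>" for \<tau>
    by (cases \<tau>) auto
  have "map2 act (map (\<lambda>j. if j = i then a else (read (ts ! j), Stay)) [0..<N]) ts =
      ts[i := act a (ts ! i)]" for a
    using assms(2,3) by (auto simp: list_eq_iff_nth_eq act_read nth_list_update)
  moreover have "map (\<lambda>j. if j = i then a else (ss ! j, Stay)) [0..<N] =
      map (\<lambda>j. if j = i then a else (read (ts ! j), Stay)) [0..<N]" for a
    using assms(3) by (simp add: ss_def)
  moreover have "ss ! i = read (ts ! i)"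
    using assms(2,3) by (simp add: ss_def)
  ultimately have "map2 act (snd (instr_entry N (i, \<delta>) ss)) ts =
      ts[i := act (fst (\<delta> (read (ts ! i)))) (ts ! i)]"
    by (simp only: instr_entry_def prod.case snd_conv)
  then show ?thesis
    using entry \<open>ss ! i = read (ts ! i)\<close> by (simp add: instr_entry_def ss_def)
qed

lemma stores_obtain:
  assumes "stores s out ts" and "i < N" and "i \<noteq> k"
  obtains h where "ts ! i = (block h (s i), h)"
  using assms by (auto simp: stores_def)

lemma stores_update:
  assumes "stores s out ts" and "i < N" and "i \<noteq> k" and "set w \<subseteq> {0<..<N}"
  shows "stores (s(i := w)) out (ts[i := (block h w, h)])"
  using assms by (auto simp: stores_def nth_list_update)

lemma step_stack:
  assumes "stores s out ts" and "code_at code q [(i, \<delta>)]" and "i < N" and "i \<noteq> k"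
  shows "step M (q, ts) = (snd (\<delta> (peek (s i))), ts[i := act (fst (\<delta> (peek (s i)))) (ts ! i)])"
proof -
  obtain h where "ts ! i = (block h (s i), h)"
    using assms(1,3,4) by (rule stores_obtain)
  then show ?thesis
    using step_instr[OF assms(2,3)] assms(1) read_less[OF assms(1)]
    by (simp add: stores_def block_peek del: step.simps)
qed

lemma reaches_goto:
  assumes "stores s out ts" and "code_at code q [goto i f]" and "i < N" and "i \<noteq> k"
  shows "reaches (step M) 1 (q, ts) (f (peek (s i)), ts)"
proof -
  obtain h where "ts ! i = (block h (s i), h)"
    using assms(1,3,4) by (rule stores_obtain)
  then have "act (peek (s i), Stay) (ts ! i) = ts ! i"
    by (simp add: block_peek fun_upd_idem)
  then have "step M (q, ts) = (f (peek (s i)), ts)"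
    using step_stack[OF assms(1) assms(2)[unfolded goto_def] assms(3,4)]
    by (simp del: step.simps act.simps)
  then show ?thesis by (rule reaches_step) simp
qed


subsection \<open>Correctness of the compilation\<close>

definition executes :: "prog \<Rightarrow> stacks \<Rightarrow> nat \<Rightarrow> stacks \<Rightarrow> bool list \<Rightarrow> bool"
  where "executes p s t s' os \<longleftrightarrow> (\<forall>q out ts. code_at code q (compile k N p q) \<longrightarrow> stores s out ts \<longrightarrow>
    (\<exists>ts'. reaches (step M) t (q, ts) (q + code_size N p, ts') \<and> stores s' (out @ os) ts'))"

lemma executesI:
  assumes "\<And>q out ts. code_at code q (compile k N p q) \<Longrightarrow> stores s out ts \<Longrightarrow>
    \<exists>ts'. reaches (step M) t (q, ts) (q + code_size N p, ts') \<and> stores s' (out @ os) ts'"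
  shows "executes p s t s' os"
  using assms unfolding executes_def by blast

lemma executesE:
  assumes "executes p s t s' os" and "code_at code q (compile k N p q)" and "stores s out ts"
  obtains ts' where "reaches (step M) t (q, ts) (q + code_size N p, ts')" "stores s' (out @ os) ts'"
  using assms unfolding executes_def by blast

lemma executes_Push:
  assumes wf: "wf_prog k N (Push i a)" and "2 \<le> t"
  shows "executes (Push i a) s t (s(i := a # s i)) []"
proof (rule executesI)
  fix q out ts assume "code_at code q (compile k N (Push i a) q)" and st: "stores s out ts"
  then have code: "code_at code q [(i, \<lambda>r. ((r, Left), q + 1))]"
    "code_at code (Suc q) [(i, \<lambda>r. ((a, Stay), q + 2))]"
    by simp_all
  have i: "i < N" "i \<noteq> k" and a: "a \<in> {0<..<N}" using wf by auto
  obtain h where h: "ts ! i = (block h (s i), h)"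
    using st i by (rule stores_obtain)
  have len: "length ts = N" using st by (simp add: stores_def)
  let ?ts1 = "ts[i := (block h (s i), h - 1)]"
  let ?ts2 = "ts[i := (block (h - 1) (a # s i), h - 1)]"
  have move: "reaches (step M) 1 (q, ts) (Suc q, ?ts1)"
    using step_stack[OF st code(1) i]
    by (intro reaches_step) (simp_all add: h fun_upd_idem block_peek del: step.simps)
  have "read (?ts1 ! j) < N" if "j < N" for j
    using read_less[OF st that] symbols len that by (cases "j = i") (simp_all add: block_def)
  then have put: "reaches (step M) 1 (Suc q, ?ts1) (q + 2, ?ts2)"
    using step_instr[OF code(2) i(1), of ?ts1] len i
    by (intro reaches_step) (simp_all add: block_push del: step.simps)
  have "reaches (step M) t (q, ts) (q + 2, ?ts2)"
    using move put by (rule reaches_trans) (use \<open>2 \<le> t\<close> in simp)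
  moreover have "stores (s(i := a # s i)) out ?ts2"
    using st i a by (intro stores_update) (auto simp: stores_def)
  ultimately show "\<exists>ts'. reaches (step M) t (q, ts) (q + code_size N (Push i a), ts') \<and>
      stores (s(i := a # s i)) (out @ []) ts'"
    by auto
qed

lemma executes_Pop:
  assumes wf: "wf_prog k N (Pop i)" and "1 \<le> t"
  shows "executes (Pop i) s t (s(i := tl (s i))) []"
proof (rule executesI)
  fix q out ts assume code: "code_at code q (compile k N (Pop i) q)" and st: "stores s out ts"
  have i: "i < N" "i \<noteq> k" using wf by auto
  obtain h where h: "ts ! i = (block h (s i), h)"
    using st i by (rule stores_obtain)
  let ?ts' = "ts[i := (block (h + 1) (tl (s i)), h + 1)]"
  have "step M (q, ts) = (q + 1, ?ts')"
    using step_stack[OF st code[unfolded compile.simps] i]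
    by (simp add: h block_pop del: step.simps)
  then have "reaches (step M) t (q, ts) (q + 1, ?ts')"
    using \<open>1 \<le> t\<close> by (rule reaches_step)
  moreover have "set (tl (s i)) \<subseteq> {0<..<N}"
    using st i by (cases "s i") (force simp: stores_def)+
  then have "stores (s(i := tl (s i))) out ?ts'"
    using st i by (intro stores_update)
  ultimately show "\<exists>ts'. reaches (step M) t (q, ts) (q + code_size N (Pop i), ts') \<and>
      stores (s(i := tl (s i))) (out @ []) ts'"
    by auto
qed

lemma executes_Emit:
  assumes "1 \<le> t"
  shows "executes (Emit b) s t s [b]"
proof (rule executesI)
  fix q out ts assume code: "code_at code q (compile k N (Emit b) q)" and st: "stores s out ts"
  let ?ts' = "ts[k := (block 0 (word_syms (out @ [b])), int (length (out @ [b])))]"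
  have "(block 0 (word_syms out))(int (length out) := bit_sym b) = block 0 (word_syms (out @ [b]))"
    using block_emit[of "word_syms out"] by (simp add: word_syms_def)
  then have "step M (q, ts) = (q + 1, ?ts')"
    using step_instr[OF code[unfolded compile.simps] output_tape] read_less[OF st] st
    by (simp add: stores_def add.commute del: step.simps)
  then have "reaches (step M) t (q, ts) (q + 1, ?ts')"
    using assms by (rule reaches_step)
  moreover have "stores s (out @ [b]) ?ts'"
    using st output_tape by (auto simp: stores_def nth_list_update)
  ultimately show "\<exists>ts'. reaches (step M) t (q, ts) (q + code_size N (Emit b), ts') \<and>
      stores s (out @ [b]) ts'"
    by auto
qed

lemma executes_Seq:
  assumes "executes p s t1 s1 o1" and "executes p' s1 t2 s2 o2" and "t1 + t2 \<le> t"
  shows "executes (p ;; p') s t s2 (o1 @ o2)"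
proof (rule executesI)
  fix q out ts assume "code_at code q (compile k N (p ;; p') q)" and st: "stores s out ts"
  then have code: "code_at code q (compile k N p q)"
    "code_at code (q + code_size N p) (compile k N p' (q + code_size N p))"
    by (simp_all add: code_at_append length_compile)
  obtain ts1 where first: "reaches (step M) t1 (q, ts) (q + code_size N p, ts1)"
    and st1: "stores s1 (out @ o1) ts1"
    using assms(1) code(1) st by (rule executesE)
  obtain ts2 where second: "reaches (step M) t2 (q + code_size N p, ts1)
      (q + code_size N p + code_size N p', ts2)" and st2: "stores s2 ((out @ o1) @ o2) ts2"
    using assms(2) code(2) st1 by (rule executesE)
  have "reaches (step M) t (q, ts) (q + code_size N (p ;; p'), ts2)"
    using reaches_trans[OF first second assms(3)] by (simp add: add.assoc)
  with st2 show "\<exists>ts'. reaches (step M) t (q, ts) (q + code_size N (p ;; p'), ts') \<and>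
      stores s2 (out @ o1 @ o2) ts'"
    by auto
qed

lemma executes_Switch:
  assumes wf: "wf_prog k N (Switch i f)" and body: "executes (f (peek (s i))) s t' s' os"
    and "t' + 2 \<le> t"
  shows "executes (Switch i f) s t s' os"
proof (rule executesI)
  fix q out ts assume code: "code_at code q (compile k N (Switch i f) q)" and st: "stores s out ts"
  have i: "i < N" "i \<noteq> k" using wf by auto
  then have "set (s i) \<subseteq> {0<..<N}" using st by (simp add: stores_def)
  then have a: "peek (s i) < N" using symbols by (cases "s i") auto
  define q' where "q' = q + 1 + branch_offset (\<lambda>a. code_size N (f a)) (peek (s i))"
  note branch = code_at_Switch[OF code a, folded q'_def]
  have enter: "reaches (step M) 1 (q, ts) (q', ts)"
    using reaches_goto[OF st _ i, of q "\<lambda>a. q + 1 + branch_offset (\<lambda>a. code_size N (f a)) a"] code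
    by (simp add: q'_def)
  obtain ts' where inner: "reaches (step M) t' (q', ts) (q' + code_size N (f (peek (s i))), ts')"
    and st': "stores s' (out @ os) ts'"
    using body branch(1) st by (rule executesE)
  have leave: "reaches (step M) 1 (q' + code_size N (f (peek (s i))), ts')
      (q + code_size N (Switch i f), ts')"
    using reaches_goto[OF st' branch(2) i] .
  have "reaches (step M) (t' + 1) (q, ts) (q' + code_size N (f (peek (s i))), ts')"
    using enter inner by (rule reaches_trans) simp
  then have "reaches (step M) t (q, ts) (q + code_size N (Switch i f), ts')"
    using leave by (rule reaches_trans) (use assms(3) in simp)
  with st' show "\<exists>ts'. reaches (step M) t (q, ts) (q + code_size N (Switch i f), ts') \<and>
      stores s' (out @ os) ts'"
    by blast
qed

lemma executes_While_False:
  assumes wf: "wf_prog k N (While i P p)" and "\<not> P (peek (s i))" and "1 \<le> t"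
  shows "executes (While i P p) s t s []"
proof (rule executesI)
  fix q out ts assume code: "code_at code q (compile k N (While i P p) q)" and st: "stores s out ts"
  have "reaches (step M) 1 (q, ts) (q + code_size N (While i P p), ts)"
    using reaches_goto[OF st, of q i "\<lambda>a. if P a then q + 1 else q + code_size N p + 2"]
      code wf assms(2)
    by simp
  then have "reaches (step M) t (q, ts) (q + code_size N (While i P p), ts)"
    using reaches_refl[of _ 0] by (rule reaches_trans) (use assms(3) in simp)
  with st show "\<exists>ts'. reaches (step M) t (q, ts) (q + code_size N (While i P p), ts') \<and>
      stores s (out @ []) ts'"
    by auto
qed

lemma executes_While_True:
  assumes wf: "wf_prog k N (While i P p)" and P: "P (peek (s i))"
    and body: "executes p s t1 s1 o1" and rest: "executes (While i P p) s1 t2 s2 o2"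
    and "t1 + t2 + 2 \<le> t"
  shows "executes (While i P p) s t s2 (o1 @ o2)"
proof (rule executesI)
  fix q out ts assume code: "code_at code q (compile k N (While i P p) q)" and st: "stores s out ts"
  have i: "i < N" "i \<noteq> k" using wf by auto
  have parts: "code_at code (q + 1) (compile k N p (q + 1))"
    "code_at code (q + 1 + code_size N p) [goto i (\<lambda>_. q)]"
    using code by (simp_all add: code_at_append length_compile)
  have enter: "reaches (step M) 1 (q, ts) (q + 1, ts)"
    using reaches_goto[OF st _ i, of q "\<lambda>a. if P a then q + 1 else q + code_size N p + 2"] code P
    by simp
  obtain ts1 where inner: "reaches (step M) t1 (q + 1, ts) (q + 1 + code_size N p, ts1)"
    and st1: "stores s1 (out @ o1) ts1"
    using body parts(1) st by (rule executesE)
  have jump: "reaches (step M) 1 (q + 1 + code_size N p, ts1) (q, ts1)"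
    using reaches_goto[OF st1 parts(2) i] .
  obtain ts2 where again: "reaches (step M) t2 (q, ts1) (q + code_size N (While i P p), ts2)"
    and st2: "stores s2 ((out @ o1) @ o2) ts2"
    using rest code st1 by (rule executesE)
  have "reaches (step M) (t1 + 1) (q, ts) (q + 1 + code_size N p, ts1)"
    using enter inner by (rule reaches_trans) simp
  then have "reaches (step M) (t1 + 2) (q, ts) (q, ts1)"
    using jump by (rule reaches_trans) simp
  then have "reaches (step M) t (q, ts) (q + code_size N (While i P p), ts2)"
    using again by (rule reaches_trans) (use assms(5) in simp)
  with st2 show "\<exists>ts'. reaches (step M) t (q, ts) (q + code_size N (While i P p), ts') \<and>
      stores s2 (out @ o1 @ o2) ts'"
    by auto
qed

theorem run_executes:
  assumes "run p s t s' os" and "wf_prog k N p"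
  shows "executes p s t s' os"
  using assms
proof (induction rule: run.induct)
  case (Skip s t)
  show ?case by (rule executesI) (auto intro: reaches_refl)
next
  case (Switch f s i t' s' os t)
  then have "set (s i) \<subseteq> {0<..<N} \<Longrightarrow> executes (f (peek (s i))) s t' s' os"
    using symbols by (cases "s i") auto
  then have "executes (f (peek (s i))) s t' s' os"
    using Switch.prems unfolding executes_def stores_def by auto
  then show ?case using executes_Switch Switch by blast
next
  case (While_True P s i p t1 s1 o1 t2 s2 o2 t)
  then show ?case by (intro executes_While_True) auto
qed (auto intro: executes_Push executes_Pop executes_Emit executes_Seq executes_While_False
    simp del: wf_prog.simps(1-4,6-7))

end


subsection \<open>Polynomial bounds\<close>

definition poly_bounded :: "(nat \<Rightarrow> nat) \<Rightarrow> bool"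
  where "poly_bounded f \<longleftrightarrow> (\<exists>c e. \<forall>n. f n \<le> c * Suc n ^ e)"

lemma poly_bounded_const: "poly_bounded (\<lambda>n. c)"
  unfolding poly_bounded_def by (rule exI[of _ c], rule exI[of _ 0]) simp

lemma poly_bounded_id: "poly_bounded (\<lambda>n. n)"
  unfolding poly_bounded_def by (rule exI[of _ 1], rule exI[of _ 1]) simp

lemma poly_bounded_mono: "poly_bounded g \<Longrightarrow> (\<And>n. f n \<le> g n) \<Longrightarrow> poly_bounded f"
  unfolding poly_bounded_def by (meson order.trans)

lemma poly_bounded_add:
  assumes "poly_bounded f" and "poly_bounded g"
  shows "poly_bounded (\<lambda>n. f n + g n)"
proof -
  obtain a d b e where f: "\<And>n. f n \<le> a * Suc n ^ d" and g: "\<And>n. g n \<le> b * Suc n ^ e"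
    using assms by (auto simp: poly_bounded_def)
  have "f n + g n \<le> (a + b) * Suc n ^ (d + e)" for n
  proof -
    have "a * Suc n ^ d \<le> a * Suc n ^ (d + e)" "b * Suc n ^ e \<le> b * Suc n ^ (d + e)"
      by (intro mult_le_mono2 power_increasing; simp)+
    with f[of n] g[of n] show ?thesis
      unfolding add_mult_distrib by linarith
  qed
  then show ?thesis unfolding poly_bounded_def by blast
qed

lemma poly_bounded_mult:
  assumes "poly_bounded f" and "poly_bounded g"
  shows "poly_bounded (\<lambda>n. f n * g n)"
proof -
  obtain a d b e where f: "\<And>n. f n \<le> a * Suc n ^ d" and g: "\<And>n. g n \<le> b * Suc n ^ e"
    using assms by (auto simp: poly_bounded_def)
  have "f n * g n \<le> (a * b) * Suc n ^ (d + e)" for n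
    using mult_le_mono[OF f[of n] g[of n]] by (simp add: power_add mult_ac)
  then show ?thesis unfolding poly_bounded_def by blast
qed

lemma poly_bounded_Suc: "poly_bounded f \<Longrightarrow> poly_bounded (\<lambda>n. Suc (f n))"
  using poly_bounded_add[OF _ poly_bounded_const[of 1]] by simp

lemma poly_bounded_power: "poly_bounded f \<Longrightarrow> poly_bounded (\<lambda>n. f n ^ e)"
  by (induction e) (simp_all add: poly_bounded_const poly_bounded_mult del: One_nat_def)

lemma poly_bounded_sum:
  "(\<And>i. i < (m::nat) \<Longrightarrow> poly_bounded (f i)) \<Longrightarrow> poly_bounded (\<lambda>n. \<Sum>i<m. f i n)"
  by (induction m) (simp_all add: poly_bounded_const poly_bounded_add)

lemma poly_bounded_sum_list:
  "(\<And>x. x \<in> set xs \<Longrightarrow> poly_bounded (f x)) \<Longrightarrow> poly_bounded (\<lambda>n. \<Sum>x\<leftarrow>xs. f x n)"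
  by (induction xs) (simp_all add: poly_bounded_const poly_bounded_add)

lemmas poly_bounded_intros = poly_bounded_id poly_bounded_const poly_bounded_add
  poly_bounded_mult poly_bounded_power poly_bounded_Suc poly_bounded_sum poly_bounded_sum_list

lemma poly_bounded_compose:
  assumes "poly_bounded f" and "poly_bounded g"
  shows "poly_bounded (\<lambda>n. f (g n))"
proof -
  obtain c e where f: "\<And>n. f n \<le> c * Suc n ^ e"
    using assms(1) by (auto simp: poly_bounded_def)
  have "poly_bounded (\<lambda>n. c * Suc (g n) ^ e)"
    by (intro poly_bounded_intros assms(2))
  then show ?thesis by (rule poly_bounded_mono) (rule f)
qed

lemma poly_bounded_clock:
  assumes "poly_bounded f"
  obtains e where "\<And>n. f n \<le> n ^ e + e"
proof -
  obtain c d where f: "\<And>n. f n \<le> c * Suc n ^ d"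
    using assms by (auto simp: poly_bounded_def)
  let ?e = "c * 2 ^ d + (c + 2 * d)"
  have "c * Suc n ^ d \<le> n ^ ?e + ?e" for n
  proof -
    consider "n = 0" | "n = 1" | (large) "2 \<le> n" by linarith
    then show ?thesis
    proof cases
      case large
      have "Suc n \<le> 2 * n" using large by simp
      also have "\<dots> \<le> n ^ 2" using large by (simp add: power2_eq_square)
      finally have "Suc n ^ d \<le> n ^ (2 * d)"
        unfolding power_mult by (rule power_mono) simp
      moreover have "c \<le> n ^ c"
        using less_exp[of c] power_mono[OF large, of c] by linarith
      ultimately have "c * Suc n ^ d \<le> n ^ (c + 2 * d)"
        unfolding power_add by (intro mult_le_mono)
      also have "\<dots> \<le> n ^ ?e" using large by (intro power_increasing) auto
      finally show ?thesis by linarith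
    qed (simp_all add: power_0_left numeral_2_eq_2)
  qed
  with f show ?thesis by (intro that[of ?e]) (meson order.trans)
qed

lemma poly_bounded_eventually_less_two_power:
  assumes "poly_bounded f"
  shows "\<forall>\<^sub>F n in sequentially. f n < 2 ^ n"
proof -
  obtain c e where f: "\<And>n. f n \<le> c * Suc n ^ e"
    using assms by (auto simp: poly_bounded_def)
  let ?x = "\<lambda>n. real (Suc n) * ln 2"
  have "filterlim ?x at_top sequentially"
    by (intro filterlim_at_top_mult_tendsto_pos[OF tendsto_const]
        filterlim_compose[OF filterlim_real_sequentially filterlim_Suc]) simp
  then have "(\<lambda>n. ?x n ^ e / exp (?x n)) \<longlonglongrightarrow> 0"
    by (rule filterlim_compose[OF tendsto_power_div_exp_0])
  then have "\<forall>\<^sub>F n in sequentially. ?x n ^ e / exp (?x n) < ln 2 ^ e / (2 * (real c + 1))"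
    by (rule order_tendstoD) simp
  then show ?thesis
  proof eventually_elim
    case (elim n)
    have "exp (?x n) = 2 * 2 ^ n"
      unfolding exp_of_nat_mult by simp
    with elim have "real (Suc n) ^ e / (2 * 2 ^ n) < 1 / (2 * (real c + 1))"
      by (simp add: power_mult_distrib divide_simps del: of_nat_Suc)
    then have "(real c + 1) * real (Suc n) ^ e < 2 ^ n"
      by (simp add: field_simps)
    then have "real ((c + 1) * Suc n ^ e) < real (2 ^ n)"
      by (simp add: algebra_simps)
    then have "(c + 1) * Suc n ^ e < 2 ^ n"
      by (simp only: of_nat_less_iff)
    then show ?case
      using f[of n] by (simp only: add_mult_distrib mult_1)
  qed
qed


subsection \<open>Functions computed by programs\<close>

lemma length_word_syms [simp]: "length (word_syms w) = length w"
  by (simp add: word_syms_def)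

lemma word_syms_simps [simp]:
  "word_syms [] = []" "word_syms (b # w) = bit_sym b # word_syms w"
  by (simp_all add: word_syms_def)

lemma bit_sym_simps [simp]:
  "bit_sym b \<noteq> 0" "0 < bit_sym b" "bit_sym b = 2 \<longleftrightarrow> b" "bit_sym b = 1 \<longleftrightarrow> \<not> b"
  "bit_sym b = Suc 0 \<longleftrightarrow> \<not> b"
  by (auto simp: bit_sym_def)

lemma set_word_syms: "set (word_syms w) \<subseteq> {1, 2}"
  by (auto simp: word_syms_def bit_sym_def)

lemma zero_notin_word_syms [simp]: "0 \<notin> set (word_syms w)"
  using set_word_syms[of w] by auto

lemma map_eq_two_word_syms: "map (\<lambda>a. a = 2) (word_syms w) = w"
  by (simp add: word_syms_def o_def)

lemma contents_eq_takeWhile: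
  assumes "t (int n) \<notin> {1, 2}"
  shows "contents (t, h) =
    map (\<lambda>a. a = 2) (takeWhile (\<lambda>a. a \<in> {1, 2}) (map (\<lambda>i. t (int i)) [0..<n]))"
proof -
  define m where "m = (LEAST i. t (int i) \<notin> {1, 2})"
  have "m \<le> n"
    unfolding m_def using assms by (rule Least_le)
  have "t (int m) \<notin> {1, 2}" and "\<And>i. i < m \<Longrightarrow> t (int i) \<in> {1, 2}"
    unfolding m_def using assms by (rule LeastI, metis not_less_Least)
  then have "takeWhile (\<lambda>a. a \<in> {1, 2}) (map (\<lambda>i. t (int i)) [0..<n]) =
      take m (map (\<lambda>i. t (int i)) [0..<n])"
    by (intro takeWhile_eq_take_P_nth) auto
  also have "\<dots> = map (\<lambda>i. t (int i)) [0..<m]"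
    using \<open>m \<le> n\<close> by (simp add: take_map)
  finally show ?thesis
    by (simp add: m_def del: insert_iff)
qed

lemma tape_of_block: "tape_of w = (block 0 (word_syms w), 0)"
  by (auto simp: tape_of_def block_def word_syms_def bit_sym_def fun_eq_iff)

lemma contents_block: "contents (block 0 (word_syms w), h) = w"
proof -
  have "map (\<lambda>i. block 0 (word_syms w) (int i)) [0..<length w] = word_syms w"
    by (rule nth_equalityI) (simp_all add: block_def)
  moreover have "block 0 (word_syms w) (int (length w)) \<notin> {1, 2}"
    by (simp add: block_def)
  moreover have "takeWhile (\<lambda>a. a \<in> {1, 2}) (word_syms w) = word_syms w"
    using set_word_syms[of w] by (auto simp: takeWhile_eq_all_conv)
  ultimately show ?thesis
    by (simp only: contents_eq_takeWhile map_eq_two_word_syms)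
qed

definition with_stacks :: "stacks \<Rightarrow> nat \<Rightarrow> nat list list \<Rightarrow> stacks"
  where "with_stacks s b F i =
    (if i < b then s i else if i < b + length F then F ! (i - b) else [])"

abbreviation with_words :: "stacks \<Rightarrow> nat \<Rightarrow> bool list list \<Rightarrow> stacks"
  where "with_words s b ws \<equiv> with_stacks s b (map word_syms ws)"

abbreviation input_stacks :: "bool list list \<Rightarrow> stacks"
  where "input_stacks ws \<equiv> with_words (\<lambda>_. []) 0 ws"

definition computes ::
    "nat \<Rightarrow> (bool list list \<Rightarrow> bool) \<Rightarrow> machine \<Rightarrow> (bool list list \<Rightarrow> bool list) \<Rightarrow> bool"
  where "computes k Q M F \<longleftrightarrow> clocked_machine M \<and> inputs M = k \<and>
    (\<forall>ws. length ws = k \<longrightarrow> Q ws \<longrightarrow> out_of M ws = F ws)"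

context stack_machine
begin

lemma stores_start:
  assumes "length ws = k"
  shows "stores (input_stacks ws) [] (snd (start M ws))"
proof -
  have tape: "snd (start M ws) ! i = tape_of (if i < k then ws ! i else [])" if "i < N" for i
    using that assms by (simp add: start_def machine_of_def nth_append)
  have "set (word_syms (ws ! i)) \<subseteq> {0<..<N}" for i
    using set_word_syms[of "ws ! i"] symbols by auto
  then show ?thesis
    using assms output_tape
    by (auto simp: stores_def tape tape_of_block with_stacks_def)
      (simp_all add: start_def machine_of_def)
qed

lemma out_of_machine_of:
  assumes code: "code = compile k N p 0" and wf: "wf_prog k N p"
    and run: "run p (input_stacks ws) t s' w" and "length ws = k" and t: "t \<le> clock M ws"
  shows "out_of M ws = w"
proof -
  have "code_at code 0 (compile k N p 0)"
    by (simp add: code code_at_def)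
  then obtain ts where reach: "reaches (step M) t (start M ws) (code_size N p, ts)"
    and ts: "stores s' w ts"
    using executesE[OF run_executes[OF run wf] _ stores_start[OF \<open>length ws = k\<close>], of 0]
    by (auto simp: start_def)
  have "map_of (table M) (code_size N p, map read ts) = None"
    by (simp add: map_of_table_machine_of code length_compile)
  then have "(step M ^^ clock M ws) (start M ws) = (code_size N p, ts)"
    by (intro reaches_fixpoint[OF reach _ t]) simp
  with ts show ?thesis
    by (simp add: out_of_def stores_def contents_block machine_of_def del: contents.simps)
qed

end

theorem computes_prog:
  assumes wf: "\<forall>\<^sub>F N in sequentially. wf_prog k N p" and "1 \<le> k" and \<tau>: "poly_bounded \<tau>"
    and run: "\<And>ws. length ws = k \<Longrightarrow> Q ws \<Longrightarrow>
      \<exists>s'. run p (input_stacks ws) (\<tau> (sum_list (map length ws))) s' (F ws)"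
  shows "\<exists>M. computes k Q M F"
proof -
  from wf eventually_gt_at_top[of "max k 2"]
  have "\<forall>\<^sub>F N in sequentially. wf_prog k N p \<and> max k 2 < N"
    by (rule eventually_conj)
  then obtain N where N: "wf_prog k N p" "k < N" "2 < N"
    unfolding eventually_sequentially by auto
  obtain e where e: "\<And>n. \<tau> n \<le> n ^ e + e"
    using poly_bounded_clock[OF \<tau>] by blast
  define code where "code = compile k N p 0"
  interpret stack_machine k N e code
    using N by unfold_locales
  have "out_of M ws = F ws" if ws: "length ws = k" "Q ws" for ws
  proof -
    obtain s' where "run p (input_stacks ws) (\<tau> (sum_list (map length ws))) s' (F ws)"
      using run[OF ws] by blast
    then show ?thesis
      using N(1) e ws(1)
      by (intro out_of_machine_of[of p]) (auto simp: code_def clock_def machine_of_def Let_def)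
  qed
  then have "computes k Q M F"
    using clocked_machine_of \<open>1 \<le> k\<close> N(2) by (simp add: computes_def machine_of_def)
  then show ?thesis ..
qed


section \<open>Binary notation\<close>

lemma num_of_Nil [simp]: "num_of [] = 0"
  and num_of_Cons [simp]: "num_of (b # w) = of_bool b + 2 * num_of w"
  by (simp_all add: num_of_def)

lemma bits_of_0 [simp]: "bits_of 0 = []"
  by (simp add: bits_of_def len_def floorlog_def)

lemma bits_of_pos: "0 < x \<Longrightarrow> bits_of x = odd x # bits_of (x div 2)"
proof -
  assume "0 < x"
  then have "len x = Suc (len (x div 2))"
    unfolding len_def by (subst compute_floorlog) auto
  then show ?thesis
    unfolding bits_of_def by (simp only: map_upt_Suc) (simp add: bit_0 bit_Suc)
qed

lemma length_bits_of [simp]: "length (bits_of x) = len x"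
  by (simp add: bits_of_def)

lemma num_of_bits_of [simp]: "num_of (bits_of x) = x"
  by (induction x rule: nat_bit_induct) (simp_all add: bits_of_pos)

definition canonical :: "bool list \<Rightarrow> bool"
  where "canonical w \<longleftrightarrow> w = [] \<or> last w"

lemma canonical_bits_of: "canonical (bits_of x)"
  by (induction x rule: nat_bit_induct) (auto simp: canonical_def bits_of_pos)

lemma canonical_Cons: "canonical (b # w) \<longleftrightarrow> canonical w \<and> (w = [] \<longrightarrow> b)"
  by (auto simp: canonical_def)

lemma num_of_eq_0_iff: "canonical w \<Longrightarrow> num_of w = 0 \<longleftrightarrow> w = []"
  by (induction w) (auto simp: canonical_Cons)

lemma bits_of_num_of: "canonical w \<Longrightarrow> bits_of (num_of w) = w"
proof (induction w)
  case (Cons b w)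
  then have "0 < num_of (b # w)"
    using num_of_eq_0_iff[of "b # w"] by simp
  then have "bits_of (num_of (b # w)) = b # bits_of (num_of w)"
    by (subst bits_of_pos) (auto simp: of_bool_def)
  with Cons show ?case by (simp add: canonical_Cons)
qed simp

lemma len_num_of: "canonical w \<Longrightarrow> len (num_of w) = length w"
  by (metis bits_of_num_of length_bits_of)

lemma len_mono: "x \<le> y \<Longrightarrow> len x \<le> len y"
  unfolding len_def by (rule floorlog_mono)

lemma bits_of_two_power: "bits_of (2 ^ n) = replicate n False @ [True]"
proof -
  have "num_of (replicate n False @ [True]) = 2 ^ n"
    by (induction n) auto
  then show ?thesis
    by (metis bits_of_num_of canonical_def last_snoc)
qed

lemma len_two_power: "len (2 ^ n) = Suc n"
  using arg_cong[OF bits_of_two_power[of n], of length] by simp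

lemma len_ones: "len (num_of (replicate k True)) = k"
  by (subst len_num_of) (cases "k = 0"; simp add: canonical_def)+

lemma num_of_map_bit: "i < 2 ^ n \<Longrightarrow> num_of (map (bit i) [0..<n]) = i"
  unfolding num_of_def by (simp add: horner_sum_bit_eq_take_bit take_bit_nat_eq_self)

definition strip :: "bool list \<Rightarrow> bool list"
  where "strip w = rev (dropWhile Not (rev w))"

lemma length_strip: "length (strip w) \<le> length w"
  using length_dropWhile_le[of Not "rev w"] by (simp add: strip_def)

lemma strip_eq: "strip w = bits_of (num_of w)"
proof (induction w rule: rev_induct)
  case (snoc b w)
  show ?case
  proof (cases b)
    case False
    moreover have "num_of (w @ [False]) = num_of w"
      by (induction w) auto
    ultimately show ?thesis using snoc by (simp add: strip_def)
  qed (simp add: strip_def bits_of_num_of canonical_def)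
qed (simp add: strip_def)


section \<open>Running times and effects of programs\<close>

lemma run_mono: "run p s t s' os \<Longrightarrow> t \<le> t' \<Longrightarrow> run p s t' s' os"
proof (induction arbitrary: t' rule: run.induct)
  case (Switch f s i t1 s1 o1 t)
  then show ?case by (meson order.trans run.Switch order.refl)
next
  case (While_True P s i p t1 s1 o1 t2 s2 o2 t)
  then show ?case by (meson order.trans run.While_True order.refl)
next
  case (Seq p s t1 s1 o1 q t2 s2 o2 t)
  then show ?case by (meson order.trans run.Seq order.refl)
qed (auto intro: run.intros)

lemma run_SeqI:
  "run p s t1 s1 o1 \<Longrightarrow> run q s1 t2 s' o2 \<Longrightarrow> t1 + t2 \<le> t \<Longrightarrow> os = o1 @ o2 \<Longrightarrow> run (p ;; q) s t s' os"
  by (auto intro: run.Seq)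

lemma run_SeqI_silent: "run p s t1 s1 [] \<Longrightarrow> run q s1 t2 s' os \<Longrightarrow> run (p ;; q) s (t1 + t2) s' os"
  by (rule run_SeqI[OF _ _ order.refl]) auto


subsection \<open>Loop-free programs\<close>

primrec loop_free :: "prog \<Rightarrow> bool"
  where
    "loop_free Skip \<longleftrightarrow> True"
  | "loop_free (Push i a) \<longleftrightarrow> True"
  | "loop_free (Pop i) \<longleftrightarrow> True"
  | "loop_free (Emit b) \<longleftrightarrow> True"
  | "loop_free (p ;; q) \<longleftrightarrow> loop_free p \<and> loop_free q"
  | "loop_free (Switch i f) \<longleftrightarrow> (\<forall>a. loop_free (f a))"
  | "loop_free (While i P p) \<longleftrightarrow> False"

primrec effect :: "prog \<Rightarrow> stacks \<Rightarrow> stacks"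
  where
    "effect Skip = (\<lambda>s. s)"
  | "effect (Push i a) = (\<lambda>s. s(i := a # s i))"
  | "effect (Pop i) = (\<lambda>s. s(i := tl (s i)))"
  | "effect (Emit b) = (\<lambda>s. s)"
  | "effect (p ;; q) = (\<lambda>s. effect q (effect p s))"
  | "effect (Switch i f) = (\<lambda>s. effect (f (peek (s i))) s)"
  | "effect (While i P p) = (\<lambda>s. s)"

primrec emitted :: "prog \<Rightarrow> stacks \<Rightarrow> bool list"
  where
    "emitted Skip = (\<lambda>s. [])"
  | "emitted (Push i a) = (\<lambda>s. [])"
  | "emitted (Pop i) = (\<lambda>s. [])"
  | "emitted (Emit b) = (\<lambda>s. [b])"
  | "emitted (p ;; q) = (\<lambda>s. emitted p s @ emitted q (effect p s))"
  | "emitted (Switch i f) = (\<lambda>s. emitted (f (peek (s i))) s)"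
  | "emitted (While i P p) = (\<lambda>s. [])"

primrec cost :: "prog \<Rightarrow> stacks \<Rightarrow> nat"
  where
    "cost Skip = (\<lambda>s. 0)"
  | "cost (Push i a) = (\<lambda>s. 2)"
  | "cost (Pop i) = (\<lambda>s. 1)"
  | "cost (Emit b) = (\<lambda>s. 1)"
  | "cost (p ;; q) = (\<lambda>s. cost p s + cost q (effect p s))"
  | "cost (Switch i f) = (\<lambda>s. cost (f (peek (s i))) s + 2)"
  | "cost (While i P p) = (\<lambda>s. 0)"

lemma run_effect: "loop_free p \<Longrightarrow> run p s (cost p s) (effect p s) (emitted p s)"
proof (induction p arbitrary: s)
  case (Switch i f)
  then show ?case by (auto intro!: run.Switch)
next
  case (Seq p q)
  then show ?case by (auto intro!: run.Seq)
qed (auto intro: run.intros)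

lemma run_loop_free:
  "loop_free p \<Longrightarrow> cost p s \<le> t \<Longrightarrow> effect p s = s' \<Longrightarrow> emitted p s = os \<Longrightarrow> run p s t s' os"
  using run_effect run_mono by blast


subsection \<open>Bounded repetition\<close>

primrec Seq_upto :: "(nat \<Rightarrow> prog) \<Rightarrow> nat \<Rightarrow> prog"
  where
    "Seq_upto p 0 = Skip"
  | "Seq_upto p (Suc m) = Seq_upto p m ;; p m"

lemma run_Seq_upto:
  assumes "\<And>j. j < m \<Longrightarrow> run (p j) (\<sigma> j) (c j) (\<sigma> (Suc j)) []"
  shows "run (Seq_upto p m) (\<sigma> 0) (\<Sum>j<m. c j) (\<sigma> m) []"
  using assms
proof (induction m)
  case 0
  show ?case by (simp add: run.Skip)
next
  case (Suc m)
  then have "run (Seq_upto p m) (\<sigma> 0) (\<Sum>j<m. c j) (\<sigma> m) []" "run (p m) (\<sigma> m) (c m) (\<sigma> (Suc m)) []"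
    by simp_all
  then show ?case by (simp add: run_SeqI_silent)
qed

lemma wf_Seq_upto: "wf_prog k N (Seq_upto p m) \<longleftrightarrow> (\<forall>j<m. wf_prog k N (p j))"
  by (induction m) (auto simp: less_Suc_eq)

lemma Seq_upto_cong [fundef_cong]:
  "m = n \<Longrightarrow> (\<And>j. j < n \<Longrightarrow> p j = q j) \<Longrightarrow> Seq_upto p m = Seq_upto q n"
  by (induction n arbitrary: m) auto


subsection \<open>Loops over the symbols of a stack\<close>

definition For :: "nat \<Rightarrow> (nat \<Rightarrow> prog) \<Rightarrow> prog"
  where "For i f = While i (\<lambda>a. a \<noteq> 0) (Switch i (\<lambda>a. if a = 0 then Skip else Pop i ;; f a))"

lemma wf_For: "wf_prog k N (For i f) \<longleftrightarrow> i < N \<and> i \<noteq> k \<and> (\<forall>a. 0 < a \<longrightarrow> a < N \<longrightarrow> wf_prog k N (f a))"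
  by (auto simp: For_def)

lemma run_For_Nil: "s i = [] \<Longrightarrow> 1 \<le> t \<Longrightarrow> run (For i f) s t s []"
  by (simp add: For_def run.While_False)

lemma run_For_Cons:
  assumes "s i = a # w" and "a \<noteq> 0" and body: "run (f a) (s(i := w)) c s1 o1"
    and rest: "run (For i f) s1 t1 s' o2" and "t1 + c + 5 \<le> t" and "os = o1 @ o2"
  shows "run (For i f) s t s' os"
proof -
  have "run (Pop i) s 1 (s(i := w)) []"
    using \<open>s i = a # w\<close> by (intro run_loop_free) auto
  then have "run (Pop i ;; f a) s (1 + c) s1 o1"
    using body by (rule run_SeqI_silent)
  then have "run (Switch i (\<lambda>a. if a = 0 then Skip else Pop i ;; f a)) s (c + 3) s1 o1"
    using assms(1,2) by (intro run.Switch) auto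
  then show ?thesis
    using assms(1,2,5,6) rest[unfolded For_def] unfolding For_def
    by (simp add: run.While_True[of _ s i _ "c + 3" s1 o1 t1])
qed

definition drop_prog :: "nat \<Rightarrow> (nat \<Rightarrow> bool) \<Rightarrow> prog"
  where "drop_prog i P = While i P (Pop i)"

lemma wf_drop_prog: "wf_prog k N (drop_prog i P) \<longleftrightarrow> i < N \<and> i \<noteq> k"
  by (auto simp: drop_prog_def)

lemma run_drop:
  assumes "s i = w" and "\<not> P 0 \<or> (\<exists>a\<in>set w. \<not> P a)" and "3 * length w + 1 \<le> t"
    and "s' = s(i := dropWhile P w)"
  shows "run (drop_prog i P) s t s' []"
  using assms
proof (induction w arbitrary: s t)
  case Nil
  then show ?case
    by (auto simp: drop_prog_def fun_upd_idem intro: run.While_False)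
next
  case (Cons a w)
  show ?case
  proof (cases "P a")
    case True
    have pop: "run (Pop i) s 1 (s(i := w)) []"
      using Cons.prems(1) by (intro run_loop_free) auto
    have rest: "run (drop_prog i P) (s(i := w)) (3 * length w + 1) s' []"
      using Cons.prems True by (intro Cons.IH) auto
    show ?thesis
      using run.While_True[OF _ pop rest[unfolded drop_prog_def], of t] True Cons.prems(1,3)
      by (simp add: drop_prog_def)
  next
    case False
    then have "s' = s"
      using Cons.prems(1,4) by (simp add: fun_upd_idem)
    with False Cons.prems(1,3) show ?thesis
      by (simp add: drop_prog_def run.While_False)
  qed
qed

definition transfer_prog :: "nat \<Rightarrow> (nat \<Rightarrow> bool) \<Rightarrow> nat \<Rightarrow> (nat \<Rightarrow> nat) \<Rightarrow> prog"
  where "transfer_prog i P j f = While i P (Switch i (\<lambda>a. Pop i ;; Push j (f a)))"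

lemma wf_transfer_prog:
  "wf_prog k N (transfer_prog i P j f) \<longleftrightarrow>
    i < N \<and> i \<noteq> k \<and> j < N \<and> j \<noteq> k \<and> (\<forall>a<N. 0 < f a \<and> f a < N)"
  by (auto simp: transfer_prog_def)

lemma run_transfer:
  assumes "s i = w" and "\<not> P 0" and "i \<noteq> j" and "7 * length w + 1 \<le> t"
    and "s' = s(i := dropWhile P w, j := rev (map f (takeWhile P w)) @ s j)"
  shows "run (transfer_prog i P j f) s t s' []"
  using assms
proof (induction w arbitrary: s t)
  case Nil
  then show ?case
    by (auto simp: transfer_prog_def fun_upd_idem intro: run.While_False)
next
  case (Cons a w)
  show ?case
  proof (cases "P a")
    case True
    let ?s1 = "s(i := w, j := f a # s j)"
    have body: "run (Switch i (\<lambda>a. Pop i ;; Push j (f a))) s 5 ?s1 []"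
      using Cons.prems(1,3) by (intro run_loop_free) auto
    have rest: "run (transfer_prog i P j f) ?s1 (7 * length w + 1) s' []"
      using Cons.prems True by (intro Cons.IH) (auto simp: fun_eq_iff)
    show ?thesis
      using run.While_True[OF _ body rest[unfolded transfer_prog_def], of t] True Cons.prems(1,4)
      by (simp add: transfer_prog_def)
  next
    case False
    then have "s' = s"
      using Cons.prems(1,5) by (simp add: fun_upd_idem)
    with False Cons.prems(1,4) show ?thesis
      by (simp add: transfer_prog_def run.While_False)
  qed
qed

lemma takeWhile_neq: "x \<notin> set xs \<Longrightarrow> takeWhile (\<lambda>y. y \<noteq> x) xs = xs"
  and dropWhile_neq: "x \<notin> set xs \<Longrightarrow> dropWhile (\<lambda>y. y \<noteq> x) xs = []"
  unfolding takeWhile_eq_all_conv dropWhile_eq_Nil_conv by metis+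

text \<open>A move pushes \<open>max 1 a\<close> for \<open>a\<close> only because no program may push 0.\<close>

definition move_prog :: "nat \<Rightarrow> nat \<Rightarrow> prog"
  where "move_prog i j = transfer_prog i (\<lambda>a. a \<noteq> 0) j (max 1)"

lemma wf_move_prog: "2 \<le> N \<Longrightarrow> wf_prog k N (move_prog i j) \<longleftrightarrow> i < N \<and> i \<noteq> k \<and> j < N \<and> j \<noteq> k"
  by (auto simp: move_prog_def wf_transfer_prog)

lemma run_move:
  assumes "s i = w" and "0 \<notin> set w" and "i \<noteq> j" and "7 * length w + 1 \<le> t"
    and "s' = s(i := [], j := rev w @ s j)"
  shows "run (move_prog i j) s t s' []"
proof -
  have "a \<noteq> 0" if "a \<in> set w" for a
    using that assms(2) by metis
  then have "map (max 1) w = w"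
    by (intro map_idI) (simp add: max_absorb2 Suc_leI)
  then have "s' = s(i := dropWhile (\<lambda>a. a \<noteq> 0) w,
      j := rev (map (max 1) (takeWhile (\<lambda>a. a \<noteq> 0) w)) @ s j)"
    by (simp only: assms(5) takeWhile_neq[OF assms(2)] dropWhile_neq[OF assms(2)])
  then show ?thesis
    unfolding move_prog_def using assms(1,3,4) by (intro run_transfer) simp_all
qed

definition copy_prog :: "nat \<Rightarrow> nat \<Rightarrow> nat \<Rightarrow> (nat \<Rightarrow> nat) \<Rightarrow> prog"
  where "copy_prog i j l f = For i (\<lambda>a. Push j a ;; Push l (f a))"

lemma wf_copy_prog:
  "(\<And>a. 0 < a \<Longrightarrow> a < N \<Longrightarrow> 0 < f a \<and> f a < N) \<Longrightarrow> i < N \<Longrightarrow> j < N \<Longrightarrow> l < N \<Longrightarrow> i \<noteq> k \<Longrightarrow> j \<noteq> k \<Longrightarrow> l \<noteq> k \<Longrightarrow>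
    wf_prog k N (copy_prog i j l f)"
  by (simp add: copy_prog_def wf_For)

lemma run_copy:
  assumes "s i = w" and "0 \<notin> set w" and "i \<noteq> j" and "i \<noteq> l" and "j \<noteq> l" and "9 * length w + 1 \<le> t"
    and "s' = s(i := [], j := rev w @ s j, l := rev (map f w) @ s l)"
  shows "run (copy_prog i j l f) s t s' []"
  using assms
proof (induction w arbitrary: s t)
  case Nil
  then show ?case
    by (simp add: copy_prog_def run_For_Nil fun_upd_idem)
next
  case (Cons a w)
  let ?s1 = "s(i := w, j := a # s j, l := f a # s l)"
  have "run (Push j a ;; Push l (f a)) (s(i := w)) 4 ?s1 []"
    using Cons.prems(3-5) by (intro run_loop_free) auto
  moreover have "run (copy_prog i j l f) ?s1 (9 * length w + 1) s' []"
    using Cons.prems by (intro Cons.IH) (auto simp: fun_eq_iff)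
  ultimately show ?case
    using Cons.prems(2,6) unfolding copy_prog_def
    by (intro run_For_Cons[of s i a w]) (use Cons.prems(1) in auto)
qed

lemma run_emit_stack:
  assumes "s i = word_syms w" and "6 * length w + 1 \<le> t" and "s' = s(i := [])"
  shows "run (For i (\<lambda>a. Emit (a = 2))) s t s' w"
  using assms
proof (induction w arbitrary: s t)
  case Nil
  then show ?case by (simp add: fun_upd_idem run_For_Nil)
next
  case (Cons b w)
  have emit: "run (Emit (bit_sym b = 2)) (s(i := word_syms w)) 1 (s(i := word_syms w)) [b]"
    by (intro run_loop_free) auto
  have rest: "run (For i (\<lambda>a. Emit (a = 2))) (s(i := word_syms w)) (6 * length w + 1) s' w"
    using Cons.prems by (intro Cons.IH) auto
  show ?case
    using Cons.prems emit rest by (intro run_For_Cons[of s i "bit_sym b" "word_syms w"]) auto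
qed

definition flag :: "bool \<Rightarrow> nat list"
  where "flag b = (if b then [2] else [])"


section \<open>Basic machines\<close>

definition computes_num :: "nat \<Rightarrow> machine \<Rightarrow> (nat list \<Rightarrow> nat) \<Rightarrow> bool"
  where "computes_num k M f \<longleftrightarrow> clocked_machine M \<and> inputs M = k \<and>
    (\<forall>xs. length xs = k \<longrightarrow> fun_of M xs = f xs)"

lemma computes_num_of_computes:
  assumes "computes k (list_all canonical) M F"
    and "\<And>xs. length xs = k \<Longrightarrow> num_of (F (map bits_of xs)) = f xs"
  shows "computes_num k M f"
  using assms
  by (auto simp: computes_num_def computes_def fun_of_def list_all_iff canonical_bits_of)

definition emit_word :: "bool list \<Rightarrow> prog"
  where "emit_word w = foldr (\<lambda>b p. Emit b ;; p) w Skip"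

lemma run_emit_word: "run (emit_word w) s (length w) s w"
proof (induction w)
  case (Cons b w)
  have "run (Emit b) s 1 s [b]"
    by (rule run.Emit) simp
  then show ?case
    using Cons unfolding emit_word_def by (auto intro: run_SeqI)
qed (simp add: emit_word_def run.Skip)

lemma wf_emit_word: "wf_prog k N (emit_word w)"
  by (induction w) (auto simp: emit_word_def)

lemma computes_const:
  assumes "1 \<le> k"
  shows "\<exists>M. computes_num k M (\<lambda>_. c)"
proof -
  have "\<exists>M. computes k (list_all canonical) M (\<lambda>_. bits_of c)"
  proof (rule computes_prog)
    show "\<forall>\<^sub>F N in sequentially. wf_prog k N (emit_word (bits_of c))"
      by (simp add: wf_emit_word)
    show "poly_bounded (\<lambda>_. len c)"
      by (rule poly_bounded_const)
    show "\<exists>s'. run (emit_word (bits_of c)) (input_stacks ws) (len c) s' (bits_of c)" for ws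
      using run_emit_word[of "bits_of c"] by auto
  qed fact
  then show ?thesis
    by (elim ex_forward, elim computes_num_of_computes) simp
qed


subsection \<open>Comparing numbers\<close>

text \<open>The flag tells how the lower bits compare; missing bits of the first word count as 0.\<close>

fun less_word :: "bool \<Rightarrow> bool list \<Rightarrow> bool list \<Rightarrow> bool"
  where
    "less_word f u [] \<longleftrightarrow> u = [] \<and> f"
  | "less_word f u (b # v) \<longleftrightarrow> less_word (if (u \<noteq> [] \<and> hd u) = b then f else b) (tl u) v"

lemma less_word_iff:
  "canonical u \<Longrightarrow> canonical v \<Longrightarrow>
    less_word f u v \<longleftrightarrow> num_of u < num_of v \<or> num_of u = num_of v \<and> f"
proof (induction f u v rule: less_word.induct)
  case (1 f u)
  then show ?case by (simp add: num_of_eq_0_iff)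
next
  case (2 f u b v)
  then show ?case
    by (cases u) (auto simp: canonical_Cons of_bool_def)
qed

definition less_step :: "nat \<Rightarrow> prog"
  where "less_step b = Switch 0 (\<lambda>a. Pop 0 ;;
    (if (a = 2) = (b = 2) then Skip else if b = 2 then Pop 3 ;; Push 3 2 else Pop 3))"

lemma run_less_steps:
  assumes "s 0 = word_syms u" and "s 1 = word_syms v" and "s 3 = flag f"
  shows "\<exists>s' u' f'. run (For 1 less_step) s (11 * length v + 1) s' [] \<and>
    s' 0 = word_syms u' \<and> s' 3 = flag f' \<and> (u' = [] \<and> f' \<longleftrightarrow> less_word f u v)"
  using assms
proof (induction f u v arbitrary: s rule: less_word.induct)
  case (1 f u)
  then have "run (For 1 less_step) s 1 s []"
    by (intro run_For_Nil) simp_all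
  with 1 show ?case by auto
next
  case (2 f u b v)
  let ?f = "if (u \<noteq> [] \<and> hd u) = b then f else b"
  let ?s = "s(0 := word_syms (tl u), 1 := word_syms v, 3 := flag ?f)"
  have "?s 0 = word_syms (tl u)" "?s 1 = word_syms v" "?s 3 = flag ?f"
    by simp_all
  from "2.IH"[OF this] obtain s' u' f' where
    rest: "run (For 1 less_step) ?s (11 * length v + 1) s' []"
    and s': "s' 0 = word_syms u'" "s' 3 = flag f'" "u' = [] \<and> f' \<longleftrightarrow> less_word ?f (tl u) v"
    by blast
  have step: "run (less_step (bit_sym b)) (s(1 := word_syms v)) 6 ?s []"
    using "2.prems" unfolding less_step_def
    by (cases u; intro run_loop_free) (auto simp: fun_eq_iff flag_def)
  have "run (For 1 less_step) s (11 * length (b # v) + 1) s' []"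
    using "2.prems" step rest by (intro run_For_Cons[of s 1 "bit_sym b" "word_syms v"]) auto
  with s' show ?case
    by (intro exI[of _ s'] exI[of _ u'] exI[of _ f']) simp
qed

lemma computes_less: "\<exists>M. computes_num 2 M (\<lambda>xs. of_bool (xs ! 0 < xs ! 1))"
proof -
  let ?answer = "Switch 0 (\<lambda>a. Switch 3 (\<lambda>c. if a = 0 \<and> c = 2 then Emit True else Skip))"
  let ?F = "\<lambda>ws. if less_word False (ws ! 0) (ws ! 1) then [True] else []"
  have "\<exists>M. computes 2 (list_all canonical) M ?F"
  proof (rule computes_prog)
    show "\<forall>\<^sub>F N in sequentially. wf_prog 2 N (For 1 less_step ;; ?answer)"
      by (intro eventually_sequentiallyI[of 4]) (simp add: less_step_def wf_For)
    show "poly_bounded (\<lambda>n. 11 * n + 6)"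
      by (intro poly_bounded_intros)
    fix ws :: "bool list list" assume "length ws = 2"
    then obtain u v where ws: "ws = [u, v]"
      by (auto simp: numeral_2_eq_2 length_Suc_conv)
    obtain s' u' f' where less: "run (For 1 less_step) (input_stacks ws) (11 * length v + 1) s' []"
      and s': "s' 0 = word_syms u'" "s' 3 = flag f'" "u' = [] \<and> f' \<longleftrightarrow> less_word False u v"
      using run_less_steps[of "input_stacks ws" u v False]
      by (force simp: ws with_stacks_def flag_def)
    have "run ?answer s' 5 s' (?F ws)"
      using s' by (intro run_loop_free; cases u') (auto simp: flag_def ws)
    with less show "\<exists>s'. run (For 1 less_step ;; ?answer) (input_stacks ws)
        (11 * sum_list (map length ws) + 6) s' (?F ws)"
      by (intro exI run_SeqI) (auto simp: ws)
  qed simp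
  then show ?thesis
    by (elim ex_forward, elim computes_num_of_computes)
      (auto simp: numeral_2_eq_2 length_Suc_conv less_word_iff canonical_bits_of)
qed

lemma run_pop_in_parallel:
  assumes "s i = w" and "0 \<notin> set w" and "i \<noteq> j"
  shows "run (For i (\<lambda>_. Pop j)) s (6 * length w + 1) (s(i := [], j := drop (length w) (s j))) []"
  using assms
proof (induction w arbitrary: s)
  case Nil
  then show ?case by (simp add: run_For_Nil fun_upd_idem)
next
  case (Cons a w)
  let ?s1 = "s(i := w, j := tl (s j))"
  have pop: "run (Pop j) (s(i := w)) 1 ?s1 []"
    using Cons.prems by (intro run_loop_free) auto
  have "run (For i (\<lambda>_. Pop j)) ?s1 (6 * length w + 1)
      (?s1(i := [], j := drop (length w) (?s1 j))) []"
    using Cons.prems by (intro Cons.IH) auto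
  moreover have "?s1(i := [], j := drop (length w) (?s1 j)) =
      s(i := [], j := drop (length (a # w)) (s j))"
    by (auto simp: fun_eq_iff drop_Suc)
  ultimately have rest: "run (For i (\<lambda>_. Pop j)) ?s1 (6 * length w + 1)
      (s(i := [], j := drop (length (a # w)) (s j))) []"
    by metis
  show ?case
  proof (rule run_For_Cons)
    show "s i = a # w" "a \<noteq> 0"
      using Cons.prems by auto
  qed (rule pop rest | simp)+
qed

lemma computes_len_le: "\<exists>M. computes_num 2 M (\<lambda>xs. of_bool (len (xs ! 0) \<le> len (xs ! 1)))"
proof -
  let ?answer = "Switch 0 (\<lambda>a. if a = 0 then Emit True else Skip)"
  let ?F = "\<lambda>ws. if length (ws ! 0) \<le> length (ws ! 1) then [True] else []"
  have "\<exists>M. computes 2 (list_all canonical) M ?F"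
  proof (rule computes_prog)
    show "\<forall>\<^sub>F N in sequentially. wf_prog 2 N (For 1 (\<lambda>_. Pop 0) ;; ?answer)"
      by (intro eventually_sequentiallyI[of 4]) (simp add: wf_For)
    show "poly_bounded (\<lambda>n. 6 * n + 4)"
      by (intro poly_bounded_intros)
    fix ws :: "bool list list" assume "length ws = 2"
    then obtain u v where ws: "ws = [u, v]"
      by (auto simp: numeral_2_eq_2 length_Suc_conv)
    let ?s' = "(input_stacks ws)(1 := [], 0 := drop (length v) (word_syms u))"
    have "run (For 1 (\<lambda>_. Pop 0)) (input_stacks ws) (6 * length v + 1) ?s' []"
      using run_pop_in_parallel[of "input_stacks ws" 1 "word_syms v" 0]
      by (simp add: ws with_stacks_def)
    moreover have "run ?answer ?s' 3 ?s' (?F ws)"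
      using set_drop_subset[of "length v" "word_syms u"] zero_notin_word_syms[of u]
      by (cases "drop (length v) (word_syms u)"; intro run_loop_free) (auto simp: ws)
    ultimately show "\<exists>s'. run (For 1 (\<lambda>_. Pop 0) ;; ?answer) (input_stacks ws)
        (6 * sum_list (map length ws) + 4) s' (?F ws)"
      by (intro exI run_SeqI) (auto simp: ws)
  qed simp
  then show ?thesis
    by (elim ex_forward, elim computes_num_of_computes)
      (auto simp: numeral_2_eq_2 length_Suc_conv)
qed


subsection \<open>The length of a product\<close>

lemma run_emit_each:
  assumes "s i = w" and "0 \<notin> set w" and "i \<noteq> j"
  shows "run (For i (\<lambda>a. Push j a ;; Emit True)) s (8 * length w + 1)
    (s(i := [], j := rev w @ s j)) (replicate (length w) True)"
  using assms
proof (induction w arbitrary: s)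
  case Nil
  then show ?case by (simp add: run_For_Nil fun_upd_idem)
next
  case (Cons a w)
  let ?s1 = "s(i := w, j := a # s j)"
  have emit: "run (Push j a ;; Emit True) (s(i := w)) 3 ?s1 [True]"
    using Cons.prems by (intro run_loop_free) auto
  have "run (For i (\<lambda>a. Push j a ;; Emit True)) ?s1 (8 * length w + 1)
      (?s1(i := [], j := rev w @ ?s1 j)) (replicate (length w) True)"
    using Cons.prems by (intro Cons.IH) auto
  moreover have "?s1(i := [], j := rev w @ ?s1 j) = s(i := [], j := rev (a # w) @ s j)"
    using Cons.prems by (auto simp: fun_eq_iff)
  ultimately have rest: "run (For i (\<lambda>a. Push j a ;; Emit True)) ?s1 (8 * length w + 1)
      (s(i := [], j := rev (a # w) @ s j)) (replicate (length w) True)"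
    by metis
  show ?case
  proof (rule run_For_Cons)
    show "s i = a # w" "a \<noteq> 0"
      using Cons.prems by auto
  qed (rule emit rest | simp)+
qed

definition product_prog :: prog
  where "product_prog = For 0 (\<lambda>_. For 1 (\<lambda>a. Push 3 a ;; Emit True) ;; move_prog 3 1)"

lemma run_product_prog:
  assumes "s 0 = u" and "0 \<notin> set u" and "s 1 = v" and "0 \<notin> set v" and "s 3 = []"
  shows "run product_prog s (length u * (15 * length v + 7) + 1) (s(0 := []))
    (replicate (length u * length v) True)"
  using assms
proof (induction u arbitrary: s)
  case Nil
  then show ?case by (simp add: product_prog_def run_For_Nil fun_upd_idem)
next
  case (Cons a u)
  let ?s = "s(0 := u)"
  have "run (For 1 (\<lambda>a. Push 3 a ;; Emit True)) ?s (8 * length v + 1)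
      (?s(1 := [], 3 := rev v)) (replicate (length v) True)"
    using run_emit_each[of ?s 1 v 3] Cons.prems by simp
  moreover have "run (move_prog 3 1) (?s(1 := [], 3 := rev v)) (7 * length v + 1) ?s []"
    using Cons.prems by (intro run_move[of _ _ "rev v"]) (auto simp: fun_eq_iff)
  ultimately have body: "run (For 1 (\<lambda>a. Push 3 a ;; Emit True) ;; move_prog 3 1) ?s
      (15 * length v + 2) ?s (replicate (length v) True)"
    by (rule run_SeqI) simp_all
  have "run product_prog ?s (length u * (15 * length v + 7) + 1) (?s(0 := []))
      (replicate (length u * length v) True)"
    using Cons.prems by (intro Cons.IH) auto
  then have rest: "run product_prog ?s (length u * (15 * length v + 7) + 1) (s(0 := []))
      (replicate (length u * length v) True)"
    by simp
  show ?case
    unfolding product_prog_def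
  proof (rule run_For_Cons)
    show "s 0 = a # u" "a \<noteq> 0"
      using Cons.prems by auto
  qed (rule body rest[unfolded product_prog_def] | simp add: replicate_add)+
qed

lemma computes_len_mult:
  "\<exists>M. computes_num 2 M (\<lambda>xs. num_of (replicate (len (xs ! 0) * len (xs ! 1)) True))"
proof -
  let ?F = "\<lambda>ws. replicate (length (ws ! 0) * length (ws ! 1)) True"
  have "\<exists>M. computes 2 (list_all canonical) M ?F"
  proof (rule computes_prog)
    show "\<forall>\<^sub>F N in sequentially. wf_prog 2 N product_prog"
      by (intro eventually_sequentiallyI[of 4]) (simp add: product_prog_def wf_For wf_move_prog)
    show "poly_bounded (\<lambda>n. n * (15 * n + 7) + 1)"
      by (intro poly_bounded_intros)
    fix ws :: "bool list list" assume "length ws = 2"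
    then obtain u v where ws: "ws = [u, v]"
      by (auto simp: numeral_2_eq_2 length_Suc_conv)
    let ?n = "length u + length v"
    have "run product_prog (input_stacks ws) (length u * (15 * length v + 7) + 1)
        ((input_stacks ws)(0 := [])) (?F ws)"
      using run_product_prog[of "input_stacks ws" "word_syms u" "word_syms v"]
      by (simp add: ws with_stacks_def)
    moreover have "length u * (15 * length v + 7) + 1 \<le> ?n * (15 * ?n + 7) + 1"
      by (intro add_mono mult_mono) auto
    ultimately show "\<exists>s'. run product_prog (input_stacks ws)
        (sum_list (map length ws) * (15 * sum_list (map length ws) + 7) + 1) s' (?F ws)"
      by (auto simp: ws intro: run_mono)
  qed simp
  then show ?thesis
    by (elim ex_forward, elim computes_num_of_computes)
      (auto simp: numeral_2_eq_2 length_Suc_conv)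
qed


section \<open>Simulating a machine on stacks\<close>

lemma run_length_le: "run p s t s' os \<Longrightarrow> length (s' i) \<le> length (s i) + t"
  by (induction rule: run.induct) auto


subsection \<open>Tapes as pairs of stacks\<close>

text \<open>
  A simulated tape is kept as two stacks, left and right of its head.  Symbols are shifted so that
  blanks can be pushed, and they carry a mark for cell 0, from where the output is read off.
\<close>

definition enc :: "nat \<Rightarrow> bool \<Rightarrow> nat"
  where "enc a f = Suc (2 * a + of_bool f)"

definition dec :: "nat \<Rightarrow> nat"
  where "dec c = (c - 1) div 2"

definition marked :: "nat \<Rightarrow> bool"
  where "marked c \<longleftrightarrow> c \<noteq> 0 \<and> even c"

lemma enc_simps [simp]:
  "enc a f \<noteq> 0" "0 < enc a f" "dec (enc a f) = a" "marked (enc a f) = f" "dec 0 = 0" "\<not> marked 0"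
  by (auto simp: enc_def dec_def marked_def)

definition cell :: "(int \<Rightarrow> nat) \<Rightarrow> int \<Rightarrow> nat"
  where "cell t i = enc (t i) (i = 0)"

type_synonym tape_halves = "nat list \<times> nat list"

definition zipper :: "tape \<Rightarrow> tape_halves \<Rightarrow> bool"
  where "zipper \<tau> Z \<longleftrightarrow> (\<exists>lo hi. lo \<le> 0 \<and> 0 \<le> hi \<and> lo \<le> snd \<tau> \<and> snd \<tau> \<le> hi + 1 \<and>
    (\<forall>i. i < lo \<or> hi < i \<longrightarrow> fst \<tau> i = 0) \<and>
    fst Z = map (cell (fst \<tau>)) (rev [lo..snd \<tau> - 1]) \<and> snd Z = map (cell (fst \<tau>)) [snd \<tau>..hi])"

lemma zipperE:
  assumes "zipper (t, h) (L, R)"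
  obtains lo hi where "lo \<le> 0" "0 \<le> hi" "lo \<le> h" "h \<le> hi + 1" "\<And>i. i < lo \<or> hi < i \<Longrightarrow> t i = 0"
    "L = map (cell t) (rev [lo..h - 1])" "R = map (cell t) [h..hi]"
  using assms unfolding zipper_def by auto

lemma zipperI:
  assumes "lo \<le> 0" and "0 \<le> hi" and "lo \<le> h" and "h \<le> hi + 1" and "\<And>i. i < lo \<or> hi < i \<Longrightarrow> t i = 0"
    and "L = map (cell t) (rev [lo..h - 1])" and "R = map (cell t) [h..hi]"
  shows "zipper (t, h) (L, R)"
  using assms unfolding zipper_def by auto

lemma zipper_peek:
  assumes "zipper \<tau> Z"
  shows "dec (peek (snd Z)) = read \<tau>" and "marked (peek (snd Z)) \<longleftrightarrow> snd \<tau> = 0"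
proof -
  obtain t h L R where eq: "\<tau> = (t, h)" "Z = (L, R)" by (metis surj_pair)
  from assms[unfolded eq] have "dec (peek R) = t h \<and> (marked (peek R) \<longleftrightarrow> h = 0)"
  proof (rule zipperE)
    fix lo hi assume span: "0 \<le> hi" "h \<le> hi + 1" "\<And>i. i < lo \<or> hi < i \<Longrightarrow> t i = 0"
      "R = map (cell t) [h..hi]"
    then show ?thesis
      by (cases "h \<le> hi") (auto simp: upto_rec1 cell_def)
  qed
  then show "dec (peek (snd Z)) = read \<tau>" and "marked (peek (snd Z)) \<longleftrightarrow> snd \<tau> = 0"
    by (simp_all add: eq)
qed

lemma zipper_nonzero: "zipper \<tau> Z \<Longrightarrow> 0 \<notin> set (fst Z) \<union> set (snd Z)"
  unfolding zipper_def by (auto simp: cell_def)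

lemma zipper_write:
  assumes "zipper (t, h) (L, R)"
  shows "zipper (t(h := a), h) (L, enc a (marked (peek R)) # tl R)"
  using assms
proof (rule zipperE)
  fix lo hi assume span: "lo \<le> 0" "0 \<le> hi" "lo \<le> h" "h \<le> hi + 1" "\<And>i. i < lo \<or> hi < i \<Longrightarrow> t i = 0"
    "L = map (cell t) (rev [lo..h - 1])" "R = map (cell t) [h..hi]"
  have "enc a (marked (peek R)) # tl R = map (cell (t(h := a))) [h..max hi h]"
    using span zipper_peek(2)[OF assms]
    by (cases "h \<le> hi") (auto simp: upto_rec1[of h hi] cell_def max_def)
  moreover have "L = map (cell (t(h := a))) (rev [lo..h - 1])"
    using span by (auto simp: cell_def)
  ultimately show ?thesis
    using span by (intro zipperI[of lo "max hi h"]) auto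
qed

lemma zipper_right:
  assumes "zipper (t, h) (L, c # R)"
  shows "zipper (t, h + 1) (c # L, R)"
  using assms
proof (rule zipperE)
  fix lo hi assume span: "lo \<le> 0" "0 \<le> hi" "lo \<le> h" "h \<le> hi + 1" "\<And>i. i < lo \<or> hi < i \<Longrightarrow> t i = 0"
    "L = map (cell t) (rev [lo..h - 1])" "c # R = map (cell t) [h..hi]"
  then have "h \<le> hi"
    by (cases "h \<le> hi") auto
  then have "c = cell t h" "R = map (cell t) [h + 1..hi]"
    using span by (auto simp: upto_rec1[of h hi])
  then show ?thesis
    using span \<open>h \<le> hi\<close> by (intro zipperI[of lo hi]) (auto simp: upto_rec2[of lo h])
qed

text \<open>An empty left half is extended by a blank without mark, whose code is 1.\<close>

lemma zipper_left:
  assumes "zipper (t, h) (L, R)"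
  shows "zipper (t, h - 1) (tl L, (if L = [] then 1 else hd L) # R)"
  using assms
proof (rule zipperE)
  fix lo hi assume span: "lo \<le> 0" "0 \<le> hi" "lo \<le> h" "h \<le> hi + 1" "\<And>i. i < lo \<or> hi < i \<Longrightarrow> t i = 0"
    "L = map (cell t) (rev [lo..h - 1])" "R = map (cell t) [h..hi]"
  have R: "[h - 1..hi] = (h - 1) # [h..hi]"
    using span by (simp add: upto_rec1[of "h - 1" hi])
  show ?thesis
  proof (cases "lo \<le> h - 1")
    case True
    then have "L = cell t (h - 1) # map (cell t) (rev [lo..h - 1 - 1])"
      using span by (simp add: upto_rec2[of lo "h - 1"])
    then show ?thesis
      using span True R by (intro zipperI[of lo hi]) auto
  next
    case False
    then have "h = lo" using span by simp
    moreover have "cell t (lo - 1) = 1" using span by (auto simp: cell_def enc_def)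
    ultimately show ?thesis
      using span R by (intro zipperI[of "lo - 1" hi]) auto
  qed
qed

fun act_zip :: "nat \<times> move \<Rightarrow> tape_halves \<Rightarrow> tape_halves"
  where
    "act_zip (a, Stay) (L, R) = (L, enc a (marked (peek R)) # tl R)"
  | "act_zip (a, Right) (L, R) = (enc a (marked (peek R)) # L, tl R)"
  | "act_zip (a, Left) (L, R) =
      (tl L, (if L = [] then 1 else hd L) # enc a (marked (peek R)) # tl R)"

lemma zipper_act:
  assumes "zipper \<tau> Z"
  shows "zipper (act x \<tau>) (act_zip x Z)"
proof -
  obtain a d t h L R where eq: "x = (a, d)" "\<tau> = (t, h)" "Z = (L, R)"
    by (metis surj_pair)
  note written = zipper_write[OF assms[unfolded eq], of a]
  show ?thesis
    unfolding eq using written zipper_right[OF written] zipper_left[OF written]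
    by (cases d) simp_all
qed

lemma zipper_append:
  assumes "zipper (t, h) (L, R)"
  obtains lo hi where "lo \<le> 0" "0 \<le> hi" "t (hi + 1) = 0" "rev L @ R = map (cell t) [lo..hi]"
  using assms
proof (rule zipperE)
  fix lo hi assume span: "lo \<le> 0" "0 \<le> hi" "lo \<le> h" "h \<le> hi + 1" "\<And>i. i < lo \<or> hi < i \<Longrightarrow> t i = 0"
    "L = map (cell t) (rev [lo..h - 1])" "R = map (cell t) [h..hi]"
  have "[lo..hi] = [lo..h - 1] @ [h..hi]"
    using span by (cases "h = hi + 1") (auto intro: upto_split1)
  then have "rev L @ R = map (cell t) [lo..hi]"
    using span by (simp add: rev_map)
  with span show ?thesis by (intro that[of lo hi]) auto
qed

lemma zipper_has_mark: "zipper \<tau> (L, R) \<Longrightarrow> \<exists>a\<in>set (rev L @ R). marked a"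
proof (cases \<tau>)
  case (Pair t h)
  assume "zipper \<tau> (L, R)"
  then have "zipper (t, h) (L, R)" by (simp add: Pair)
  then show ?thesis
  proof (rule zipper_append)
    fix lo hi :: int assume "lo \<le> 0" "0 \<le> hi" "rev L @ R = map (cell t) [lo..hi]"
    then have "cell t 0 \<in> set (rev L @ R)" by simp
    moreover have "marked (cell t 0)" by (simp add: cell_def)
    ultimately show ?thesis by blast
  qed
qed

lemma zipper_contents:
  assumes "zipper (t, h) (L, R)"
  defines "Y \<equiv> dropWhile (\<lambda>a. \<not> marked a) (rev L @ R)"
  shows "map (\<lambda>a. if dec a = 2 then 2 else 1) (takeWhile (\<lambda>a. dec a = 1 \<or> dec a = 2) Y) =
    word_syms (contents (t, h))"
  using assms(1)
proof (rule zipper_append)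
  fix lo hi :: int
  assume bounds: "lo \<le> 0" "0 \<le> hi" and blank: "t (hi + 1) = 0"
    and cells: "rev L @ R = map (cell t) [lo..hi]"
  have "[lo..hi] = [lo..0 - 1] @ [0..hi]"
    using bounds by (intro upto_split1) auto
  then have "Y = map (cell t) [0..hi]"
    unfolding Y_def cells using bounds
    by (simp only: map_append) (subst dropWhile_append2; auto simp: cell_def upto_rec1[of 0 hi])
  also have "[0..hi] = map int [0..<nat (hi + 1)]"
    by (rule nth_equalityI) (use bounds in \<open>auto simp: nth_upto\<close>)
  finally have Y: "Y = map (cell t \<circ> int) [0..<nat (hi + 1)]"
    by simp
  have "contents (t, h) = map (\<lambda>a. a = 2) (takeWhile (\<lambda>a. a \<in> {1, 2})
      (map (\<lambda>i. t (int i)) [0..<nat (hi + 1)]))"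
    using bounds blank by (intro contents_eq_takeWhile) simp
  then show ?thesis
    unfolding Y by (simp add: takeWhile_map o_def cell_def word_syms_def bit_sym_def)
qed


subsection \<open>Layout of the stacks\<close>

text \<open>
  A simulation uses the stacks from \<open>b\<close> on.  The remaining clock and the size, which is the total
  length of the inputs, are kept in unary; the product stack is a second scratch stack.
\<close>

abbreviation (input) scratch_stack :: "nat \<Rightarrow> nat"
  where "scratch_stack b \<equiv> b"

abbreviation (input) clock_stack :: "nat \<Rightarrow> nat"
  where "clock_stack b \<equiv> b + 1"

abbreviation (input) size_stack :: "nat \<Rightarrow> nat"
  where "size_stack b \<equiv> b + 2"

abbreviation (input) product_stack :: "nat \<Rightarrow> nat"
  where "product_stack b \<equiv> b + 3"

abbreviation (input) state_stack :: "nat \<Rightarrow> nat"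
  where "state_stack b \<equiv> b + 4"

abbreviation (input) left_stack :: "nat \<Rightarrow> nat \<Rightarrow> nat"
  where "left_stack b j \<equiv> b + (5 + j)"

abbreviation (input) right_stack :: "nat \<Rightarrow> nat \<Rightarrow> nat \<Rightarrow> nat"
  where "right_stack b m j \<equiv> b + (5 + m + j)"

definition sim_stacks ::
    "stacks \<Rightarrow> nat \<Rightarrow> nat list \<Rightarrow> nat list \<Rightarrow> nat list \<Rightarrow> tape_halves list \<Rightarrow> stacks"
  where "sim_stacks s b clk sz q zs =
    with_stacks s b ([[], clk, sz, [], q] @ map fst zs @ map snd zs)"

lemma with_stacks_nth: "j < length F \<Longrightarrow> with_stacks s b F (b + j) = F ! j"
  by (simp add: with_stacks_def)

lemma with_stacks_update:
  "j < length F \<Longrightarrow> (with_stacks s b F)(b + j := w) = with_stacks s b (F[j := w])"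
  by (auto simp: with_stacks_def fun_eq_iff nth_list_update)

lemma sim_stacks_registers [simp]:
  "i < b \<Longrightarrow> sim_stacks s b clk sz q zs i = s i"
  "sim_stacks s b clk sz q zs (scratch_stack b) = []"
  "sim_stacks s b clk sz q zs (clock_stack b) = clk"
  "sim_stacks s b clk sz q zs (Suc b) = clk"
  "sim_stacks s b clk sz q zs (size_stack b) = sz"
  "sim_stacks s b clk sz q zs (Suc (Suc b)) = sz"
  "sim_stacks s b clk sz q zs (product_stack b) = []"
  "sim_stacks s b clk sz q zs (state_stack b) = q"
  by (simp_all add: sim_stacks_def with_stacks_def)

lemma sim_stacks_tapes:
  assumes "j < length zs"
  shows "sim_stacks s b clk sz q zs (left_stack b j) = fst (zs ! j)"
    and "sim_stacks s b clk sz q zs (right_stack b (length zs) j) = snd (zs ! j)"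
  unfolding sim_stacks_def using assms by (subst with_stacks_nth; simp add: nth_append)+

lemma sim_stacks_update:
  "(sim_stacks s b clk sz q zs)(clock_stack b := clk') = sim_stacks s b clk' sz q zs"
  "(sim_stacks s b clk sz q zs)(Suc b := clk') = sim_stacks s b clk' sz q zs"
  "(sim_stacks s b clk sz q zs)(size_stack b := sz') = sim_stacks s b clk sz' q zs"
  "(sim_stacks s b clk sz q zs)(Suc (Suc b) := sz') = sim_stacks s b clk sz' q zs"
  "(sim_stacks s b clk sz q zs)(state_stack b := q') = sim_stacks s b clk sz q' zs"
proof -
  show clk: "(sim_stacks s b clk sz q zs)(clock_stack b := clk') = sim_stacks s b clk' sz q zs"
    and sz: "(sim_stacks s b clk sz q zs)(size_stack b := sz') = sim_stacks s b clk sz' q zs"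
    and "(sim_stacks s b clk sz q zs)(state_stack b := q') = sim_stacks s b clk sz q' zs"
    unfolding sim_stacks_def by (subst with_stacks_update; simp)+
  show "(sim_stacks s b clk sz q zs)(Suc b := clk') = sim_stacks s b clk' sz q zs"
    and "(sim_stacks s b clk sz q zs)(Suc (Suc b) := sz') = sim_stacks s b clk sz' q zs"
    using clk sz by simp_all
qed

lemma sim_stacks_update_tape:
  assumes "j < length zs"
  shows "(sim_stacks s b clk sz q zs)(left_stack b j := L, right_stack b (length zs) j := R) =
    sim_stacks s b clk sz q (zs[j := (L, R)])"
proof -
  define registers where "registers = [[], clk, sz, [], q]"
  have "length registers = 5" by (simp add: registers_def)
  then have "(registers @ map fst zs @ map snd zs)[5 + j := L, 5 + length zs + j := R] =
      registers @ map fst (zs[j := (L, R)]) @ map snd (zs[j := (L, R)])"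
    using assms by (simp add: list_update_append map_update)
  then show ?thesis
    using assms \<open>length registers = 5\<close> unfolding sim_stacks_def registers_def[symmetric]
    by (simp add: with_stacks_update)
qed


subsection \<open>Simulating a step\<close>

definition tape_prog :: "nat \<Rightarrow> nat \<Rightarrow> nat \<times> move \<Rightarrow> prog"
  where "tape_prog l r x = Switch r (\<lambda>c. Pop r ;;
    (case x of
       (a, Stay) \<Rightarrow> Push r (enc a (marked c))
     | (a, Right) \<Rightarrow> Push l (enc a (marked c))
     | (a, Left) \<Rightarrow> Push r (enc a (marked c)) ;;
         Switch l (\<lambda>c. Pop l ;; Push r (if c = 0 then 1 else c))))"

lemma run_tape_prog:
  assumes "l \<noteq> r" and "0 \<notin> set (s l)" and "act_zip x (s l, s r) = (L, R)"
    and "s' = s(l := L, r := R)"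
  shows "run (tape_prog l r x) s 10 s' []"
proof -
  obtain a d where x: "x = (a, d)" by (metis surj_pair)
  show ?thesis
    using assms unfolding tape_prog_def x
    by (cases d; cases "s l"; intro run_loop_free) (auto simp: fun_eq_iff)
qed

lemma wf_tape_prog:
  assumes "l < N" "r < N" "l \<noteq> k" "r \<noteq> k" "enc (fst x) True < N"
  shows "wf_prog k N (tape_prog l r x)"
proof -
  have "enc (fst x) f < N" for f
    using assms(5) by (cases f) (auto simp: enc_def)
  then show ?thesis
    using assms by (cases "snd x"; cases x) (auto simp: tape_prog_def enc_def)
qed

definition acts_prog :: "nat \<Rightarrow> (nat \<times> move) list \<Rightarrow> prog"
  where "acts_prog b xs =
    Seq_upto (\<lambda>j. tape_prog (left_stack b j) (right_stack b (length xs) j) (xs ! j)) (length xs)"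

lemma run_acts_prog:
  assumes "length zs = length xs" and "list_all2 zipper ts zs"
  shows "run (acts_prog b xs) (sim_stacks s b clk sz q zs) (10 * length xs)
    (sim_stacks s b clk sz q (map2 act_zip xs zs)) []"
proof -
  define mixed where
    "mixed j = map (\<lambda>i. if i < j then act_zip (xs ! i) (zs ! i) else zs ! i) [0..<length xs]" for j
  have step: "run (tape_prog (left_stack b j) (right_stack b (length xs) j) (xs ! j))
      (sim_stacks s b clk sz q (mixed j)) 10 (sim_stacks s b clk sz q (mixed (Suc j))) []"
    if j: "j < length xs" for j
  proof (rule run_tape_prog)
    have len: "length (mixed j) = length xs" and nth: "mixed j ! j = zs ! j"
      using j by (simp_all add: mixed_def)
    note halves = sim_stacks_tapes[of j "mixed j" s b clk sz q, unfolded len nth, OF j]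
    show "0 \<notin> set (sim_stacks s b clk sz q (mixed j) (left_stack b j))"
      using assms j zipper_nonzero unfolding halves by (fastforce simp: list_all2_conv_all_nth)
    show "act_zip (xs ! j) (sim_stacks s b clk sz q (mixed j) (left_stack b j),
        sim_stacks s b clk sz q (mixed j) (right_stack b (length xs) j)) =
      (fst (act_zip (xs ! j) (zs ! j)), snd (act_zip (xs ! j) (zs ! j)))"
      unfolding halves by simp
    have "mixed (Suc j) = (mixed j)[j := act_zip (xs ! j) (zs ! j)]"
      by (rule nth_equalityI) (auto simp: mixed_def nth_list_update less_Suc_eq)
    then show "sim_stacks s b clk sz q (mixed (Suc j)) = (sim_stacks s b clk sz q (mixed j))
        (left_stack b j := fst (act_zip (xs ! j) (zs ! j)),
         right_stack b (length xs) j := snd (act_zip (xs ! j) (zs ! j)))"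
      using sim_stacks_update_tape[of j "mixed j" s b clk sz q, unfolded len, OF j] by simp
  qed (use j in auto)
  have "mixed 0 = zs"
    by (simp add: mixed_def map_nth flip: assms(1))
  moreover have "mixed (length xs) = map2 act_zip xs zs"
    by (rule nth_equalityI) (simp_all add: mixed_def assms(1))
  ultimately show ?thesis
    using run_Seq_upto[where \<sigma> = "\<lambda>j. sim_stacks s b clk sz q (mixed j)" and m = "length xs",
        OF step]
    by (simp add: acts_prog_def mult.commute)
qed

lemma wf_acts_prog:
  assumes "\<And>x. x \<in> set xs \<Longrightarrow> enc (fst x) True < N" and "k < b" and "left_stack b (2 * length xs) \<le> N"
  shows "wf_prog k N (acts_prog b xs)"
  using assms(2,3) by (auto simp: acts_prog_def wf_Seq_upto intro!: wf_tape_prog assms(1))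

primrec read_prog :: "nat list \<Rightarrow> (nat list \<Rightarrow> prog) \<Rightarrow> prog"
  where
    "read_prog [] f = f []"
  | "read_prog (i # is) f = Switch i (\<lambda>c. read_prog is (\<lambda>cs. f (c # cs)))"

lemma run_read_prog:
  "run (f (map (\<lambda>i. peek (s i)) is)) s t s' os \<Longrightarrow> run (read_prog is f) s (t + 2 * length is) s' os"
proof (induction "is" arbitrary: f)
  case (Cons i "is")
  then have "run (read_prog is (\<lambda>cs. f (peek (s i) # cs))) s (t + 2 * length is) s' os"
    by simp
  then show ?case by (auto intro: run.Switch)
qed simp

lemma wf_read_prog:
  "(\<And>cs. wf_prog k N (f cs)) \<Longrightarrow> (\<forall>i\<in>set is. i < N \<and> i \<noteq> k) \<Longrightarrow> wf_prog k N (read_prog is f)"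
  by (induction "is" arbitrary: f) auto

definition transition_prog :: "machine \<Rightarrow> nat \<Rightarrow> nat list \<Rightarrow> prog"
  where "transition_prog M b cs =
    (case map_of (table M) (hd cs - 1, map dec (tl cs)) of
       None \<Rightarrow> Skip
     | Some (q, xs) \<Rightarrow> Pop (state_stack b) ;; Push (state_stack b) (Suc q) ;; acts_prog b xs)"

definition step_prog :: "machine \<Rightarrow> nat \<Rightarrow> prog"
  where "step_prog M b = read_prog
    (state_stack b # map (right_stack b (tapes M)) [0..<tapes M]) (transition_prog M b)"

lemma length_step:
  assumes "clocked_machine M" and "length (snd C) = tapes M"
  shows "length (snd (step M C)) = tapes M"
proof -
  obtain q ts where C: "C = (q, ts)" by (metis surj_pair)
  show ?thesis
    using assms map_of_SomeD[of "table M" "(q, map read ts)"]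
    by (fastforce simp: C clocked_machine_def split: option.split)
qed

lemma read_tapes:
  assumes "list_all2 zipper ts zs"
  shows "map (\<lambda>j. dec (peek (sim_stacks s b clk sz q zs (right_stack b (length ts) j))))
    [0..<length ts] = map read ts"
proof (rule nth_equalityI)
  fix j assume "j < length (map (\<lambda>j. dec (peek (sim_stacks s b clk sz q zs
    (right_stack b (length ts) j)))) [0..<length ts])"
  then have j: "j < length ts" by simp
  have len: "length zs = length ts"
    using assms by (simp add: list_all2_lengthD)
  have "zipper (ts ! j) (zs ! j)"
    using assms j by (simp add: list_all2_conv_all_nth)
  then show "map (\<lambda>j. dec (peek (sim_stacks s b clk sz q zs (right_stack b (length ts) j))))
      [0..<length ts] ! j = map read ts ! j"
    using zipper_peek(1) j sim_stacks_tapes(2)[of j zs s b clk sz q]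
    by (simp add: len)
qed simp

lemma list_all2_zipper_act:
  "list_all2 zipper ts zs \<Longrightarrow> length xs = length ts \<Longrightarrow>
    list_all2 zipper (map2 act xs ts) (map2 act_zip xs zs)"
  by (auto simp: list_all2_conv_all_nth intro!: zipper_act)

lemma run_transition_prog:
  assumes M: "clocked_machine M" and ts: "length ts = tapes M" "list_all2 zipper ts zs"
    and cs: "hd cs = Suc q" "map dec (tl cs) = map read ts"
  shows "\<exists>zs'. run (transition_prog M b cs) (sim_stacks s b clk sz [Suc q] zs) (10 * tapes M + 3)
      (sim_stacks s b clk sz [Suc (fst (step M (q, ts)))] zs') [] \<and>
    list_all2 zipper (snd (step M (q, ts))) zs'"
proof (cases "map_of (table M) (q, map read ts)")
  case None
  then show ?thesis
    using ts(2) cs by (auto simp: transition_prog_def intro: run.Skip)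
next
  case (Some y)
  obtain q' xs where y: "y = (q', xs)" by (metis surj_pair)
  let ?s = "\<lambda>q. sim_stacks s b clk sz [Suc q] zs" and ?zs' = "map2 act_zip xs zs"
  have "length xs = tapes M"
    using M map_of_SomeD[OF Some] by (auto simp: clocked_machine_def y)
  then have len: "length zs = length xs" "length xs = tapes M"
    using ts by (simp_all add: list_all2_lengthD[symmetric])
  have "run (Pop (state_stack b)) (?s q) 1 ((?s q)(state_stack b := [])) []"
    by (intro run_loop_free) simp_all
  moreover have "run (Push (state_stack b) (Suc q')) ((?s q)(state_stack b := [])) 2 (?s q') []"
    by (intro run_loop_free) (simp_all add: sim_stacks_update)
  moreover have "run (acts_prog b xs) (?s q') (10 * tapes M)
      (sim_stacks s b clk sz [Suc q'] ?zs') []"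
    using run_acts_prog[OF len(1) ts(2)] len(2) by simp
  ultimately have "run (transition_prog M b cs) (?s q) (1 + (2 + 10 * tapes M))
      (sim_stacks s b clk sz [Suc q'] ?zs') []"
    unfolding transition_prog_def cs diff_Suc_1 Some y option.case prod.case
    by (intro run_SeqI_silent)
  moreover have "list_all2 zipper (map2 act xs ts) ?zs'"
    using ts len by (intro list_all2_zipper_act) simp_all
  ultimately show ?thesis
    by (intro exI[of _ ?zs']) (simp add: Some y add.commute numeral_3_eq_3)
qed

lemma run_step_prog:
  assumes M: "clocked_machine M" and ts: "length (snd C) = tapes M" "list_all2 zipper (snd C) zs"
  shows "\<exists>zs'. run (step_prog M b) (sim_stacks s b clk sz [Suc (fst C)] zs) (12 * tapes M + 5)
      (sim_stacks s b clk sz [Suc (fst (step M C))] zs') [] \<and>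
    list_all2 zipper (snd (step M C)) zs'"
proof -
  let ?s = "sim_stacks s b clk sz [Suc (fst C)] zs"
  let ?is = "state_stack b # map (right_stack b (tapes M)) [0..<tapes M]"
  let ?cs = "map (\<lambda>i. peek (?s i)) ?is"
  have "hd ?cs = Suc (fst C)" "map dec (tl ?cs) = map read (snd C)"
    using read_tapes[OF ts(2)] ts(1) by (simp_all add: o_def)
  from run_transition_prog[OF M ts this, of b s clk sz] obtain zs' where
    "run (transition_prog M b ?cs) ?s (10 * tapes M + 3)
      (sim_stacks s b clk sz [Suc (fst (step M C))] zs') []"
    and zs': "list_all2 zipper (snd (step M C)) zs'"
    by (simp only: prod.collapse) blast
  then have "run (step_prog M b) ?s (10 * tapes M + 3 + 2 * length ?is)
      (sim_stacks s b clk sz [Suc (fst (step M C))] zs') []"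
    unfolding step_prog_def by (intro run_read_prog)
  then have "run (step_prog M b) ?s (12 * tapes M + 5)
      (sim_stacks s b clk sz [Suc (fst (step M C))] zs') []"
    by (rule run_mono) simp
  with zs' show ?thesis by blast
qed

lemma run_sim_loop:
  assumes M: "clocked_machine M" and "length (snd C) = tapes M" and "list_all2 zipper (snd C) zs"
  shows "\<exists>zs'. run (For (clock_stack b) (\<lambda>_. step_prog M b))
      (sim_stacks s b (replicate c 1) sz [Suc (fst C)] zs) (c * (12 * tapes M + 10) + 1)
      (sim_stacks s b [] sz [Suc (fst ((step M ^^ c) C))] zs') [] \<and>
    list_all2 zipper (snd ((step M ^^ c) C)) zs'"
  using assms(2,3)
proof (induction c arbitrary: C zs)
  case 0
  then show ?case
    by (intro exI[of _ zs]) (simp add: run_For_Nil)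
next
  case (Suc c)
  let ?s = "\<lambda>c q. sim_stacks s b (replicate c 1) sz [Suc q]"
  obtain zs1 where body: "run (step_prog M b) (?s c (fst C) zs) (12 * tapes M + 5)
      (?s c (fst (step M C)) zs1) []" and zs1: "list_all2 zipper (snd (step M C)) zs1"
    using run_step_prog[OF M Suc.prems] by blast
  obtain zs' where rest: "run (For (clock_stack b) (\<lambda>_. step_prog M b)) (?s c (fst (step M C)) zs1)
      (c * (12 * tapes M + 10) + 1)
      (sim_stacks s b [] sz [Suc (fst ((step M ^^ c) (step M C)))] zs') []"
    and zs': "list_all2 zipper (snd ((step M ^^ c) (step M C))) zs'"
    using Suc.IH[OF length_step[OF M Suc.prems(1)] zs1] by blast
  have "run (For (clock_stack b) (\<lambda>_. step_prog M b)) (?s (Suc c) (fst C) zs)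
      (Suc c * (12 * tapes M + 10) + 1)
      (sim_stacks s b [] sz [Suc (fst ((step M ^^ c) (step M C)))] zs') []"
  proof (rule run_For_Cons)
    show "?s (Suc c) (fst C) zs (clock_stack b) = 1 # replicate c 1" "(1 :: nat) \<noteq> 0"
      by simp_all
    show "run (step_prog M b) ((?s (Suc c) (fst C) zs)(clock_stack b := replicate c 1))
        (12 * tapes M + 5) (?s c (fst (step M C)) zs1) []"
      using body by (simp only: sim_stacks_update)
  qed (rule rest | simp)+
  with zs' show ?case
    by (auto simp: funpow_swap1 simp del: step.simps)
qed


subsection \<open>Loading the inputs\<close>

definition load_list :: "bool list \<Rightarrow> nat list"
  where "load_list w = (case w of [] \<Rightarrow> [enc 0 True]
    | b # v \<Rightarrow> enc (bit_sym b) True # map (\<lambda>b. enc (bit_sym b) False) v)"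

lemma zipper_load_list: "zipper (tape_of w) ([], load_list w)"
proof (cases w)
  case Nil
  have "load_list w = map (cell (\<lambda>_. 0)) [0..0]"
    by (simp add: Nil load_list_def cell_def)
  then show ?thesis
    unfolding tape_of_def by (intro zipperI[of 0 0]) (auto simp: Nil cell_def)
next
  case (Cons b v)
  let ?t = "fst (tape_of w)"
  have "load_list w = map (cell ?t) [0..int (length v)]"
  proof (rule nth_equalityI)
    fix i assume "i < length (load_list w)"
    then have "i \<le> length v" by (simp add: Cons load_list_def)
    then show "load_list w ! i = map (cell ?t) [0..int (length v)] ! i"
      by (cases i) (auto simp: Cons load_list_def tape_of_def cell_def bit_sym_def nth_upto
          nat_add_distrib)
  qed (simp add: Cons load_list_def)
  then show ?thesis
    unfolding tape_of_def by (intro zipperI[of 0 "int (length v)"]) (auto simp: Cons cell_def)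
qed

definition load_prog :: "nat \<Rightarrow> nat \<Rightarrow> nat \<Rightarrow> prog"
  where "load_prog b i r =
    copy_prog i (scratch_stack b) (size_stack b) (\<lambda>_. 1) ;;
    transfer_prog (scratch_stack b) (\<lambda>a. a \<noteq> 0) r (\<lambda>a. enc (if a = 2 then 2 else 1) False) ;;
    Switch r (\<lambda>a. Pop r ;;
      Push r (enc (if a = 0 then 0 else if a = enc 2 False then 2 else 1) True))"

lemma run_load_prog:
  assumes "s i = word_syms w" and "s (scratch_stack b) = []" and "s r = []"
    and "i \<notin> {scratch_stack b, size_stack b, r}" and "r \<notin> {scratch_stack b, size_stack b}"
    and "s' = s(i := [], r := load_list w,
      size_stack b := replicate (length w) 1 @ s (size_stack b))"
  shows "run (load_prog b i r) s (16 * length w + 7) s' []"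
proof -
  let ?s1 = "s(i := [], scratch_stack b := rev (word_syms w),
    size_stack b := replicate (length w) 1 @ s (size_stack b))"
  let ?s2 = "s(i := [], r := map (\<lambda>b. enc (bit_sym b) False) w,
    size_stack b := replicate (length w) 1 @ s (size_stack b))"
  have copy: "run (copy_prog i (scratch_stack b) (size_stack b) (\<lambda>_. 1)) s
      (9 * length w + 1) ?s1 []"
    using assms by (intro run_copy[of s i "word_syms w"]) (auto simp: map_replicate_const)
  have "map (\<lambda>a. enc (if a = 2 then 2 else 1) False) (word_syms w) =
      map (\<lambda>b. enc (bit_sym b) False) w"
    by (simp add: word_syms_def bit_sym_def)
  then have transfer: "run (transfer_prog (scratch_stack b) (\<lambda>a. a \<noteq> 0) r
      (\<lambda>a. enc (if a = 2 then 2 else 1) False)) ?s1 (7 * length w + 1) ?s2 []"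
    using assms by (intro run_transfer[of _ _ "rev (word_syms w)"])
      (simp_all add: fun_eq_iff rev_map takeWhile_neq dropWhile_neq del: neq0_conv)
  have mark: "run (Switch r (\<lambda>a. Pop r ;;
      Push r (enc (if a = 0 then 0 else if a = enc 2 False then 2 else 1) True))) ?s2 5 s' []"
    using assms by (cases w; intro run_loop_free)
      (auto simp: fun_eq_iff load_list_def bit_sym_def enc_def)
  show ?thesis
    unfolding load_prog_def by (rule run_SeqI[OF copy run_SeqI_silent[OF transfer mark]]) simp_all
qed

lemma wf_load_prog:
  assumes "7 \<le> N" and "k < b" and "b + 2 < N" and "i < N" and "i \<noteq> k" and "r < N" and "r \<noteq> k"
  shows "wf_prog k N (load_prog b i r)"
  using assms by (auto simp: load_prog_def wf_transfer_prog enc_def intro!: wf_copy_prog)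

text \<open>
  A simulation finds the arguments on the stacks from \<open>a\<close> on and works on the stacks above them.
  Tapes without input are loaded from an empty stack.
\<close>

definition load_all :: "machine \<Rightarrow> nat \<Rightarrow> prog"
  where "load_all M a = (let b = a + inputs M in
    Seq_upto (\<lambda>j. load_prog b (if j < inputs M then a + j else product_stack b)
      (right_stack b (tapes M) j)) (tapes M))"

lemma with_stacks_empty: "set F \<subseteq> {[]} \<Longrightarrow> with_stacks s b F = with_stacks s b []"
  using nth_mem[of _ F] by (force simp: with_stacks_def fun_eq_iff)

lemma sim_stacks_update_below:
  "i < b \<Longrightarrow> (sim_stacks s b clk sz q zs)(i := w) = sim_stacks (s(i := w)) b clk sz q zs"
  by (auto simp: sim_stacks_def with_stacks_def)

lemma sim_stacks_update_right:
  assumes "j < length zs"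
  shows "(sim_stacks s b clk sz q zs)(right_stack b (length zs) j := R) =
    sim_stacks s b clk sz q (zs[j := (fst (zs ! j), R)])"
proof -
  have "(sim_stacks s b clk sz q zs)(left_stack b j := fst (zs ! j)) = sim_stacks s b clk sz q zs"
    by (rule fun_upd_idem) (rule sim_stacks_tapes(1)[OF assms])
  then show ?thesis
    using sim_stacks_update_tape[OF assms, of s b clk sz q "fst (zs ! j)" R] by simp
qed

definition inputs_left :: "machine \<Rightarrow> stacks \<Rightarrow> nat \<Rightarrow> bool list list \<Rightarrow> nat \<Rightarrow> stacks"
  where "inputs_left M s a W j =
    with_stacks s a (map (\<lambda>i. if i < j then [] else word_syms (W ! i)) [0..<inputs M])"

lemma inputs_left_Suc:
  assumes "j < inputs M"
  shows "(inputs_left M s a W j)(a + j := []) = inputs_left M s a W (Suc j)"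
proof -
  have "(map (\<lambda>i. if i < j then [] else word_syms (W ! i)) [0..<inputs M])[j := []] =
      map (\<lambda>i. if i < Suc j then [] else word_syms (W ! i)) [0..<inputs M]"
    by (rule nth_equalityI) (auto simp: nth_list_update less_Suc_eq)
  with assms show ?thesis
    by (simp add: inputs_left_def with_stacks_update)
qed

lemma inputs_left_after: "inputs M \<le> j \<Longrightarrow> inputs_left M s a W j = with_stacks s a []"
  unfolding inputs_left_def by (rule with_stacks_empty) auto

definition tapes_loaded :: "machine \<Rightarrow> bool list list \<Rightarrow> nat \<Rightarrow> tape_halves list"
  where "tapes_loaded M W j = map (\<lambda>i. ([], if i < j then load_list (W ! i) else [])) [0..<tapes M]"

lemma length_tapes_loaded [simp]: "length (tapes_loaded M W j) = tapes M"
  by (simp add: tapes_loaded_def)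

lemma tapes_loaded_Suc:
  "j < tapes M \<Longrightarrow> (tapes_loaded M W j)[j := ([], load_list (W ! j))] = tapes_loaded M W (Suc j)"
  by (rule nth_equalityI) (auto simp: tapes_loaded_def nth_list_update less_Suc_eq)

definition loaded_upto :: "machine \<Rightarrow> stacks \<Rightarrow> nat \<Rightarrow> bool list list \<Rightarrow> nat \<Rightarrow> stacks"
  where "loaded_upto M s a W j = sim_stacks (inputs_left M s a W j) (a + inputs M) []
    (replicate (\<Sum>i<j. length (W ! i)) 1) [] (tapes_loaded M W j)"

lemma loaded_upto_Suc:
  fixes a j :: nat
  assumes "j < tapes M"
  defines "b \<equiv> a + inputs M"
  shows "loaded_upto M s a W (Suc j) = (loaded_upto M s a W j)
    (if j < inputs M then a + j else product_stack b := [],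
     right_stack b (tapes M) j := load_list (W ! j),
     size_stack b := replicate (length (W ! j)) 1 @ loaded_upto M s a W j (size_stack b))"
proof -
  have input: "(sim_stacks (inputs_left M s a W j) b [] sz [] zs)
        (if j < inputs M then a + j else product_stack b := []) =
      sim_stacks (inputs_left M s a W (Suc j)) b [] sz [] zs" for sz zs
    by (simp add: b_def sim_stacks_update_below inputs_left_Suc inputs_left_after fun_upd_idem)
  have tape: "(sim_stacks s b clk sz q (tapes_loaded M W j))
        (right_stack b (tapes M) j := load_list (W ! j)) =
      sim_stacks s b clk sz q (tapes_loaded M W (Suc j))" for s clk sz q
    using sim_stacks_update_right[of j "tapes_loaded M W j"] assms(1) tapes_loaded_Suc[of j M W]
    by (simp add: tapes_loaded_def)
  have "replicate (length (W ! j)) 1 @ replicate (\<Sum>i<j. length (W ! i)) 1 =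
      replicate (\<Sum>i<Suc j. length (W ! i)) (1 :: nat)"
    by (simp add: add.commute flip: replicate_add)
  then show ?thesis
    unfolding loaded_upto_def b_def[symmetric] input tape sim_stacks_registers sim_stacks_update
    by simp
qed

lemma loaded_upto_0:
  assumes "length ws = inputs M"
  shows "loaded_upto M s a (ws @ vs) 0 = with_words s a ws"
proof -
  have "map (\<lambda>i. word_syms ((ws @ vs) ! i)) [0..<inputs M] = map word_syms ws"
    by (rule nth_equalityI) (simp_all add: assms nth_append)
  moreover have "sim_stacks s b [] [] [] (tapes_loaded M (ws @ vs) 0) = with_stacks s b []" for s b
    unfolding sim_stacks_def by (rule with_stacks_empty) (auto simp: tapes_loaded_def)
  ultimately show ?thesis
    using assms by (auto simp: loaded_upto_def inputs_left_def with_stacks_def fun_eq_iff)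
qed

lemma sum_length_nth: "(\<Sum>i<length ws. length (ws ! i)) = sum_list (map length ws)"
  by (simp add: sum_list_sum_nth atLeast0LessThan)

lemma loaded_upto_tapes:
  assumes "length W = tapes M" and "inputs M \<le> tapes M"
  shows "loaded_upto M s a W (tapes M) = sim_stacks (with_stacks s a []) (a + inputs M) []
    (replicate (sum_list (map length W)) 1) [] (map (\<lambda>w. ([], load_list w)) W)"
proof -
  have "tapes_loaded M W (tapes M) = map (\<lambda>w. ([], load_list w)) W"
    by (rule nth_equalityI) (simp_all add: tapes_loaded_def assms(1))
  then show ?thesis
    using sum_length_nth[of W] assms by (simp add: loaded_upto_def inputs_left_after)
qed

lemma run_load_all:
  assumes ws: "length ws = inputs M" and M: "clocked_machine M"
  shows "run (load_all M a) (with_words s a ws) (16 * sum_list (map length ws) + 7 * tapes M)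
    (sim_stacks (with_words s a []) (a + inputs M) [] (replicate (sum_list (map length ws)) 1) []
      (map (\<lambda>w. ([], load_list w)) (ws @ replicate (tapes M - inputs M) []))) []"
proof -
  let ?b = "a + inputs M" and ?m = "tapes M"
  let ?W = "ws @ replicate (?m - inputs M) []"
  have "inputs M < ?m" using M by (simp add: clocked_machine_def)
  then have len: "length ?W = ?m" using ws by simp
  have "run (load_prog ?b (if j < inputs M then a + j else product_stack ?b) (right_stack ?b ?m j))
      (loaded_upto M s a ?W j) (16 * length (?W ! j) + 7) (loaded_upto M s a ?W (Suc j)) []"
    if j: "j < ?m" for j
  proof (rule run_load_prog[OF _ _ _ _ _ loaded_upto_Suc[OF j]])
    show "loaded_upto M s a ?W j (if j < inputs M then a + j else product_stack ?b) =
        word_syms (?W ! j)"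
      using j by (auto simp: loaded_upto_def inputs_left_def with_stacks_def nth_append ws)
    show "loaded_upto M s a ?W j (right_stack ?b ?m j) = []"
      using sim_stacks_tapes(2)[of j "tapes_loaded M ?W j"] j
      by (simp add: loaded_upto_def) (simp add: tapes_loaded_def)
  qed (use j in \<open>auto simp: loaded_upto_def\<close>)
  then have "run (load_all M a) (loaded_upto M s a ?W 0) (\<Sum>j<?m. 16 * length (?W ! j) + 7)
      (loaded_upto M s a ?W ?m) []"
    unfolding load_all_def Let_def by (rule run_Seq_upto)
  moreover have "(\<Sum>j<?m. 16 * length (?W ! j) + 7) = 16 * sum_list (map length ?W) + 7 * ?m"
    using sum_length_nth[of ?W] unfolding len
    by (simp only: sum.distrib flip: sum_distrib_left) simp
  moreover have "sum_list (map length ?W) = sum_list (map length ws)"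
    by (simp add: sum_list_replicate)
  ultimately show ?thesis
    using loaded_upto_tapes[OF len] \<open>inputs M < ?m\<close>
    by (simp add: loaded_upto_0[OF ws] del: map_append sum_list_append)
qed

lemma wf_load_all:
  assumes "7 \<le> N" and "k < a" and "left_stack (a + inputs M) (2 * tapes M) \<le> N"
  shows "wf_prog k N (load_all M a)"
  using assms by (auto simp: load_all_def Let_def wf_Seq_upto intro!: wf_load_prog)


subsection \<open>Computing the clock\<close>

definition add_prog :: "nat \<Rightarrow> prog"
  where "add_prog b = copy_prog (size_stack b) (scratch_stack b) (product_stack b) (\<lambda>_. 1) ;;
    move_prog (scratch_stack b) (size_stack b)"

lemma run_add_prog:
  assumes "s (size_stack b) = replicate n 1" and "s (scratch_stack b) = []"
  shows "run (add_prog b) s (16 * n + 2)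
    (s(product_stack b := replicate n 1 @ s (product_stack b))) []"
proof -
  let ?s1 = "s(size_stack b := [], scratch_stack b := replicate n 1,
    product_stack b := replicate n 1 @ s (product_stack b))"
  have copy: "run (copy_prog (size_stack b) (scratch_stack b) (product_stack b) (\<lambda>_. 1)) s
      (9 * n + 1) ?s1 []"
    using assms by (intro run_copy[of _ _ "replicate n 1"]) (simp_all add: map_replicate_const)
  have "run (move_prog (scratch_stack b) (size_stack b)) ?s1 (7 * n + 1)
      (s(product_stack b := replicate n 1 @ s (product_stack b))) []"
    using assms by (intro run_move[of _ _ "replicate n 1"]) (auto simp: fun_eq_iff)
  with copy show ?thesis
    unfolding add_prog_def by (rule run_SeqI) simp_all
qed

lemma run_add_loop:
  assumes "s (clock_stack b) = replicate c 1" and "s (size_stack b) = replicate n 1"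
    and "s (scratch_stack b) = []"
    and "s' = s(clock_stack b := [], product_stack b := replicate (c * n) 1 @ s (product_stack b))"
  shows "run (For (clock_stack b) (\<lambda>_. add_prog b)) s (c * (16 * n + 7) + 1) s' []"
  using assms
proof (induction c arbitrary: s)
  case 0
  then show ?case by (simp add: run_For_Nil fun_upd_idem)
next
  case (Suc c)
  let ?s = "s(clock_stack b := replicate c 1)"
  let ?s1 = "?s(product_stack b := replicate n 1 @ s (product_stack b))"
  have add: "run (add_prog b) ?s (16 * n + 2) ?s1 []"
    using run_add_prog[of ?s b n] Suc.prems by simp
  have ones: "replicate (Suc c * n) 1 = replicate (c * n) 1 @ replicate n (1 :: nat)"
    by (simp add: add.commute flip: replicate_add)
  have s': "s' = ?s1(clock_stack b := [],
      product_stack b := replicate (c * n) 1 @ ?s1 (product_stack b))"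
    unfolding Suc.prems(4) ones by (simp add: fun_eq_iff)
  have rest: "run (For (clock_stack b) (\<lambda>_. add_prog b)) ?s1 (c * (16 * n + 7) + 1) s' []"
    by (rule Suc.IH[OF _ _ _ s']) (use Suc.prems(2,3) in simp_all)
  show ?case
  proof (rule run_For_Cons)
    show "s (clock_stack b) = 1 # replicate c 1" "(1 :: nat) \<noteq> 0"
      using Suc.prems(1) by simp_all
  qed (rule add rest | simp)+
qed

definition mul_prog :: "nat \<Rightarrow> prog"
  where "mul_prog b = For (clock_stack b) (\<lambda>_. add_prog b) ;;
    move_prog (product_stack b) (clock_stack b)"

lemma run_mul_prog:
  assumes "s (clock_stack b) = replicate c 1" and "s (size_stack b) = replicate n 1"
    and "s (scratch_stack b) = []" and "s (product_stack b) = []"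
    and "s' = s(clock_stack b := replicate (c * n) 1)"
  shows "run (mul_prog b) s (c * (23 * n + 7) + 2) s' []"
proof -
  let ?s1 = "s(clock_stack b := [], product_stack b := replicate (c * n) 1)"
  have multiply: "run (For (clock_stack b) (\<lambda>_. add_prog b)) s (c * (16 * n + 7) + 1) ?s1 []"
    using assms by (intro run_add_loop) simp_all
  have "run (move_prog (product_stack b) (clock_stack b)) ?s1 (7 * (c * n) + 1) s' []"
    using assms by (intro run_move[of _ _ "replicate (c * n) 1"]) (auto simp: fun_eq_iff)
  with multiply show ?thesis
    unfolding mul_prog_def by (rule run_SeqI) (simp_all add: algebra_simps)
qed

definition clock_prog :: "nat \<Rightarrow> nat \<Rightarrow> prog"
  where "clock_prog b e = Push (clock_stack b) 1 ;; Seq_upto (\<lambda>_. mul_prog b) e ;;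
    Seq_upto (\<lambda>_. Push (clock_stack b) 1) e"

lemma wf_clock_prog: "2 \<le> N \<Longrightarrow> k < b \<Longrightarrow> b + 3 < N \<Longrightarrow> wf_prog k N (clock_prog b e)"
  by (simp add: clock_prog_def mul_prog_def add_prog_def wf_Seq_upto wf_For wf_move_prog
      wf_copy_prog)

definition clock_time :: "nat \<Rightarrow> nat \<Rightarrow> nat"
  where "clock_time e n = 2 + ((\<Sum>i<e. n ^ i * (23 * n + 7) + 2) + (\<Sum>i<e. 2))"

lemma run_clock_prog:
  assumes "s (clock_stack b) = []" and "s (size_stack b) = replicate n 1"
    and "s (scratch_stack b) = []" and "s (product_stack b) = []"
    and "s' = s(clock_stack b := replicate (n ^ e + e) 1)"
  shows "run (clock_prog b e) s (clock_time e n) s' []"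
proof -
  let ?s = "\<lambda>c. s(clock_stack b := replicate c 1)"
  have one: "run (Push (clock_stack b) 1) s 2 (?s (n ^ 0)) []"
    using assms(1) by (intro run_loop_free) simp_all
  have power: "run (Seq_upto (\<lambda>_. mul_prog b) e) (?s (n ^ 0))
      (\<Sum>i<e. n ^ i * (23 * n + 7) + 2) (?s (n ^ e)) []"
    using assms by (intro run_Seq_upto[where \<sigma> = "\<lambda>i. ?s (n ^ i)"] run_mul_prog)
      (simp_all add: mult.commute)
  have add: "run (Seq_upto (\<lambda>_. Push (clock_stack b) 1) e) (?s (n ^ e + 0)) (\<Sum>i<e. 2)
      (?s (n ^ e + e)) []"
    by (intro run_Seq_upto[where \<sigma> = "\<lambda>i. ?s (n ^ e + i)"] run_loop_free) simp_all
  show ?thesis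
    using run_SeqI_silent[OF one run_SeqI_silent[OF power add[unfolded add_0_right]]]
    unfolding clock_prog_def clock_time_def assms(5) .
qed

definition init_prog :: "machine \<Rightarrow> nat \<Rightarrow> prog"
  where "init_prog M a = (let b = a + inputs M in
    load_all M a ;; clock_prog b (clock_exp M) ;; drop_prog (size_stack b) (\<lambda>a. a \<noteq> 0) ;;
    Push (state_stack b) 1)"

definition init_time :: "machine \<Rightarrow> nat \<Rightarrow> nat"
  where "init_time M n =
    16 * n + 7 * tapes M + (clock_time (clock_exp M) n + (3 * n + 1 + 2))"

lemma run_init_prog:
  assumes M: "clocked_machine M" and ws: "length ws = inputs M"
  shows "\<exists>zs. run (init_prog M a) (with_words s a ws) (init_time M (sum_list (map length ws)))
      (sim_stacks (with_words s a []) (a + inputs M) (replicate (clock M ws) 1) [] [1] zs) [] \<and>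
    list_all2 zipper (snd (start M ws)) zs"
proof (intro exI conjI)
  let ?n = "sum_list (map length ws)" and ?b = "a + inputs M" and ?e = "clock_exp M"
  define zs where
    "zs = map (\<lambda>w. ([] :: nat list, load_list w)) (ws @ replicate (tapes M - inputs M) [])"
  let ?s = "\<lambda>clk sz q. sim_stacks (with_words s a []) ?b clk sz q zs"
  have load: "run (load_all M a) (with_words s a ws) (16 * ?n + 7 * tapes M)
      (?s [] (replicate ?n 1) []) []"
    using run_load_all[OF ws M] by (simp add: zs_def)
  have clock: "run (clock_prog ?b ?e) (?s [] (replicate ?n 1) []) (clock_time ?e ?n)
      (?s (replicate (clock M ws) 1) (replicate ?n 1) []) []"
    by (intro run_clock_prog) (simp_all add: sim_stacks_update clock_def Let_def)
  have discard: "run (drop_prog (size_stack ?b) (\<lambda>a. a \<noteq> 0))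
      (?s (replicate (clock M ws) 1) (replicate ?n 1) []) (3 * ?n + 1)
      (?s (replicate (clock M ws) 1) [] []) []"
    by (intro run_drop[of _ _ "replicate ?n 1"])
      (simp_all add: sim_stacks_update dropWhile_neq del: neq0_conv)
  have state: "run (Push (state_stack ?b) 1) (?s (replicate (clock M ws) 1) [] []) 2
      (?s (replicate (clock M ws) 1) [] [1]) []"
    by (intro run_loop_free) (simp_all add: sim_stacks_update)
  show "run (init_prog M a) (with_words s a ws) (init_time M ?n)
      (?s (replicate (clock M ws) 1) [] [1]) []"
    using run_SeqI_silent[OF load run_SeqI_silent[OF clock run_SeqI_silent[OF discard state]]]
    unfolding init_prog_def init_time_def Let_def .
  have "snd (start M ws) = map tape_of (ws @ replicate (tapes M - inputs M) [])"
    by (simp add: start_def)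
  then show "list_all2 zipper (snd (start M ws)) zs"
    by (simp add: zs_def list_all2_map1 list_all2_map2 list_all2_same zipper_load_list
        del: map_append map_replicate)
qed


subsection \<open>Returning the output\<close>

definition clear_prog :: "nat \<Rightarrow> nat \<Rightarrow> prog"
  where "clear_prog b m = Seq_upto (\<lambda>j. drop_prog (b + j) (\<lambda>a. a \<noteq> 0)) m"

lemma run_clear_prog:
  assumes "\<And>i. b \<le> i \<Longrightarrow> i < b + m \<Longrightarrow> 0 \<notin> set (s i) \<and> length (s i) \<le> B"
  shows "run (clear_prog b m) s (m * (3 * B + 1)) (\<lambda>i. if b \<le> i \<and> i < b + m then [] else s i) []"
proof -
  define \<sigma> where "\<sigma> j = (\<lambda>i. if b \<le> i \<and> i < b + j then [] else s i)" for j
  have "run (drop_prog (b + j) (\<lambda>a. a \<noteq> 0)) (\<sigma> j) (3 * B + 1) (\<sigma> (Suc j)) []" if "j < m" for j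
    using assms[of "b + j"] that
    by (intro run_drop[of _ _ "s (b + j)"])
      (auto simp: \<sigma>_def fun_eq_iff dropWhile_neq simp del: neq0_conv)
  then have "run (clear_prog b m) (\<sigma> 0) (\<Sum>j<m. 3 * B + 1) (\<sigma> m) []"
    unfolding clear_prog_def by (rule run_Seq_upto)
  moreover have "\<sigma> 0 = s"
    by (rule ext) (auto simp: \<sigma>_def)
  ultimately show ?thesis
    by (simp add: \<sigma>_def mult.commute)
qed

definition read_off_prog :: "nat \<Rightarrow> nat \<Rightarrow> nat \<Rightarrow> prog"
  where "read_off_prog b l r =
    move_prog l r ;; drop_prog r (\<lambda>a. \<not> marked a) ;;
    transfer_prog r (\<lambda>a. dec a = 1 \<or> dec a = 2) (scratch_stack b)
      (\<lambda>a. if dec a = 2 then 2 else 1) ;;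
    drop_prog (scratch_stack b) (\<lambda>a. a = 1)"

lemma dropWhile_word_syms:
  "dropWhile (\<lambda>a. a = 1) (rev (word_syms w)) = rev (word_syms (strip w))"
  by (simp add: word_syms_def strip_def rev_map dropWhile_map o_def)

lemma run_read_off_prog:
  assumes zip: "zipper \<tau> (s l, s r)" and "length (s l) + length (s r) \<le> B"
    and "s (scratch_stack b) = []" and distinct: "l \<noteq> r" "l \<noteq> scratch_stack b" "r \<noteq> scratch_stack b"
  shows "\<exists>R. run (read_off_prog b l r) s (23 * B + 4)
      (s(l := [], r := R, scratch_stack b := rev (word_syms (strip (contents \<tau>))))) [] \<and>
    0 \<notin> set R \<and> length R \<le> B \<and> length (contents \<tau>) \<le> B"
proof -
  let ?X = "rev (s l) @ s r" and ?bit = "\<lambda>a. dec a = 1 \<or> dec a = 2"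
  let ?Y = "dropWhile (\<lambda>a. \<not> marked a) ?X"
  let ?R = "dropWhile ?bit ?Y" and ?w = "word_syms (contents \<tau>)"
  have bits: "map (\<lambda>a. if dec a = 2 then 2 else 1) (takeWhile ?bit ?Y) = ?w"
    using zipper_contents[of "fst \<tau>" "snd \<tau>"] zip by simp
  have len: "length ?X \<le> B" "length ?Y \<le> B" "length ?R \<le> B"
    using assms(2) length_dropWhile_le[of "\<lambda>a. \<not> marked a" ?X] length_dropWhile_le[of ?bit ?Y]
    by auto
  have "length ?w \<le> length ?Y"
    unfolding bits[symmetric] by (simp add: length_takeWhile_le)
  then have len_w: "length (contents \<tau>) \<le> B"
    using len by simp
  have join: "run (move_prog l r) s (7 * B + 1) (s(l := [], r := ?X)) []"
    using zipper_nonzero[OF zip] assms(2) distinct by (intro run_move[OF refl]) auto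
  have seek: "run (drop_prog r (\<lambda>a. \<not> marked a)) (s(l := [], r := ?X)) (3 * B + 1)
      (s(l := [], r := ?Y)) []"
    using zipper_has_mark[OF zip] len by (intro run_drop[of _ _ ?X]) auto
  have transfer: "run (transfer_prog r ?bit (scratch_stack b) (\<lambda>a. if dec a = 2 then 2 else 1))
      (s(l := [], r := ?Y)) (7 * B + 1) (s(l := [], r := ?R, scratch_stack b := rev ?w)) []"
    using len assms(3) distinct bits by (intro run_transfer[of _ _ ?Y]) auto
  have strip: "run (drop_prog (scratch_stack b) (\<lambda>a. a = 1))
      (s(l := [], r := ?R, scratch_stack b := rev ?w)) (3 * B + 1)
      (s(l := [], r := ?R, scratch_stack b := rev (word_syms (strip (contents \<tau>))))) []"
    using len_w dropWhile_word_syms by (intro run_drop[of _ _ "rev ?w"]) simp_all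
  have "0 \<notin> set ?R"
    using zipper_nonzero[OF zip] by (auto dest!: set_dropWhileD)
  moreover have "run (read_off_prog b l r) s (23 * B + 4)
      (s(l := [], r := ?R, scratch_stack b := rev (word_syms (strip (contents \<tau>))))) []"
    unfolding read_off_prog_def
    by (rule run_mono[OF run_SeqI_silent[OF join run_SeqI_silent[OF seek
          run_SeqI_silent[OF transfer strip]]]]) simp
  ultimately show ?thesis
    using len(3) len_w by blast
qed

definition finish_prog :: "machine \<Rightarrow> nat \<Rightarrow> prog"
  where "finish_prog M a = (let b = a + inputs M; k = inputs M; m = tapes M in
    read_off_prog b (left_stack b k) (right_stack b m k) ;;
    clear_prog (state_stack b) (1 + 2 * m) ;;
    move_prog (scratch_stack b) a)"

definition finish_time :: "machine \<Rightarrow> nat \<Rightarrow> nat"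
  where "finish_time M B = 23 * B + 4 + ((1 + 2 * tapes M) * (3 * B + 1) + (7 * B + 1))"

lemma sim_stacks_nonzero:
  assumes "list_all2 zipper ts zs" and "0 \<notin> set clk" and "0 \<notin> set sz" and "0 \<notin> set q" and "b \<le> i"
  shows "0 \<notin> set (sim_stacks s b clk sz q zs i)"
proof -
  let ?F = "[[], clk, sz, [], q] @ map fst zs @ map snd zs"
  have "sim_stacks s b clk sz q zs i \<in> insert [] (set ?F)"
    using nth_mem[of "i - b" ?F] assms(5) unfolding sim_stacks_def with_stacks_def by auto
  moreover have "0 \<notin> set (fst Z) \<union> set (snd Z)" if Z: "Z \<in> set zs" for Z
  proof -
    obtain j where "j < length zs" "zs ! j = Z"
      using Z unfolding in_set_conv_nth by blast
    then have "zipper (ts ! j) Z"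
      using list_all2_nthD2[OF assms(1), of j] by simp
    then show ?thesis by (rule zipper_nonzero)
  qed
  ultimately show ?thesis
    using assms(2-4) by auto
qed

lemma run_return:
  fixes s :: stacks and a t :: nat and zs :: "tape_halves list" and q L R :: "nat list"
    and w :: "bool list"
  assumes "0 < inputs M" and "inputs M < tapes M"
  defines "b \<equiv> a + inputs M" and "m \<equiv> tapes M"
  defines "s' \<equiv> (sim_stacks (with_words s a []) b [] [] q zs)
    (left_stack b (inputs M) := L, right_stack b m (inputs M) := R,
     scratch_stack b := rev (word_syms w))"
  assumes "length zs = m" and "7 * length w + 1 \<le> t"
  shows "run (move_prog (scratch_stack b) a)
    (\<lambda>i. if state_stack b \<le> i \<and> i < state_stack b + (1 + 2 * m) then [] else s' i) t
    (with_words s a [w]) []"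
proof (rule run_move)
  let ?s = "\<lambda>i. if state_stack b \<le> i \<and> i < state_stack b + (1 + 2 * m) then [] else s' i"
  show "?s (scratch_stack b) = rev (word_syms w)"
    by (simp add: s'_def)
  show "with_words s a [w] = ?s(scratch_stack b := [], a := rev (rev (word_syms w)) @ ?s a)"
  proof
    fix i
    consider "i < b" | "i = b" | "i = b + 1" | "i = b + 2" | "i = b + 3"
      | "state_stack b \<le> i" "i < state_stack b + (1 + 2 * m)" | "state_stack b + (1 + 2 * m) \<le> i"
      by linarith
    then show "with_words s a [w] i =
        (?s(scratch_stack b := [], a := rev (rev (word_syms w)) @ ?s a)) i"
      using assms(1,2,6)
      by cases (auto simp: b_def m_def s'_def with_stacks_def sim_stacks_def)
  qed
qed (use assms(1,7) in \<open>auto simp: b_def\<close>)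

lemma run_finish_prog:
  fixes s :: stacks and a B q :: nat and zs :: "tape_halves list"
  assumes M: "clocked_machine M" and zip: "list_all2 zipper ts zs" and len: "length ts = tapes M"
  defines "b \<equiv> a + inputs M"
  defines "s0 \<equiv> sim_stacks (with_words s a []) b [] [] [q] zs"
  assumes "q \<noteq> 0" and B: "\<And>i. b \<le> i \<Longrightarrow> 2 * length (s0 i) \<le> B"
  shows "run (finish_prog M a) s0 (finish_time M B)
    (with_words s a [strip (contents (ts ! inputs M))]) []"
proof -
  let ?k = "inputs M" and ?m = "tapes M" and ?w = "strip (contents (ts ! inputs M))"
  let ?l = "left_stack b ?k" and ?r = "right_stack b ?m ?k"
  have k: "0 < ?k" "?k < ?m" using M by (auto simp: clocked_machine_def)
  have zs: "length zs = ?m" using zip len by (simp add: list_all2_lengthD)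
  have "zipper (ts ! ?k) (zs ! ?k)" using zip len k by (simp add: list_all2_conv_all_nth)
  then have "zipper (ts ! ?k) (s0 ?l, s0 ?r)"
    using sim_stacks_tapes[of ?k zs] k zs by (simp add: s0_def)
  moreover have "length (s0 ?l) + length (s0 ?r) \<le> B"
    using B[of ?l] B[of ?r] by linarith
  ultimately obtain R where read_off: "run (read_off_prog b ?l ?r) s0 (23 * B + 4)
      (s0(?l := [], ?r := R, scratch_stack b := rev (word_syms ?w))) []"
    and R: "0 \<notin> set R" "length R \<le> B" and w: "length (contents (ts ! ?k)) \<le> B"
    using run_read_off_prog[of "ts ! ?k" s0 ?l ?r B b] k by (auto simp: s0_def)
  let ?s1 = "s0(?l := [], ?r := R, scratch_stack b := rev (word_syms ?w))"
  let ?s2 = "\<lambda>i. if state_stack b \<le> i \<and> i < state_stack b + (1 + 2 * ?m) then [] else ?s1 i"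
  have "0 \<notin> set (s0 i)" if "b \<le> i" for i
    using sim_stacks_nonzero[OF zip _ _ _ that] \<open>q \<noteq> 0\<close> by (simp add: s0_def)
  moreover have "length (s0 i) \<le> B" if "b \<le> i" for i
    using B[OF that] by simp
  ultimately have clear: "run (clear_prog (state_stack b) (1 + 2 * ?m)) ?s1
      ((1 + 2 * ?m) * (3 * B + 1)) ?s2 []"
    using R by (intro run_clear_prog) auto
  have return: "run (move_prog (scratch_stack b) a) ?s2 (7 * B + 1) (with_words s a [?w]) []"
    unfolding s0_def b_def
    by (rule run_return[OF k zs]) (use w length_strip[of "contents (ts ! ?k)"] in linarith)
  show ?thesis
    unfolding finish_prog_def finish_time_def Let_def b_def[symmetric]
    by (rule run_SeqI_silent[OF read_off run_SeqI_silent[OF clear return]])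
qed


subsection \<open>The whole simulation\<close>

definition sim_prog :: "machine \<Rightarrow> nat \<Rightarrow> prog"
  where "sim_prog M a = (let b = a + inputs M in
    init_prog M a ;; For (clock_stack b) (\<lambda>_. step_prog M b) ;; finish_prog M a)"

definition sim_bound :: "machine \<Rightarrow> nat \<Rightarrow> nat"
  where "sim_bound M n =
    init_time M n + ((n ^ clock_exp M + clock_exp M) * (12 * tapes M + 10) + 1)"

definition sim_time :: "machine \<Rightarrow> nat \<Rightarrow> nat"
  where "sim_time M n = sim_bound M n + finish_time M (2 * sim_bound M n)"

lemma poly_bounded_sim_time: "poly_bounded (sim_time M)"
proof -
  have "poly_bounded (\<lambda>n. sim_time M n)"
    unfolding sim_time_def sim_bound_def finish_time_def init_time_def clock_time_def
    by (intro poly_bounded_intros)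
  then show ?thesis by simp
qed

lemma mono_sim_time: "m \<le> n \<Longrightarrow> sim_time M m \<le> sim_time M n"
  unfolding sim_time_def sim_bound_def finish_time_def init_time_def clock_time_def
  by (intro add_mono mult_mono power_mono sum_mono order.refl) auto

text \<open>
  The stacks above the arguments are empty at first; hence their contents at any later time are
  bounded by the time that has passed.
\<close>

theorem run_sim_prog:
  assumes M: "clocked_machine M" and ws: "length ws = inputs M"
  shows "run (sim_prog M a) (with_words s a ws) (sim_time M (sum_list (map length ws)))
    (with_words s a [strip (out_of M ws)]) []"
proof -
  let ?n = "sum_list (map length ws)" and ?b = "a + inputs M" and ?c = "clock M ws"
  let ?C = "(step M ^^ ?c) (start M ws)" and ?s = "sim_stacks (with_words s a []) ?b"
  have clock: "?c = ?n ^ clock_exp M + clock_exp M"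
    by (simp add: clock_def Let_def)
  have len0: "length (snd (start M ws)) = tapes M"
    using M ws by (auto simp: start_def clocked_machine_def)
  have len: "length (snd ((step M ^^ c) (start M ws))) = tapes M" for c
    by (induction c) (simp_all add: len0 length_step[OF M] del: step.simps)
  obtain zs0 where init: "run (init_prog M a) (with_words s a ws) (init_time M ?n)
      (?s (replicate ?c 1) [] [1] zs0) []" and zs0: "list_all2 zipper (snd (start M ws)) zs0"
    using run_init_prog[OF M ws] by blast
  obtain zs where loop: "run (For (clock_stack ?b) (\<lambda>_. step_prog M ?b))
      (?s (replicate ?c 1) [] [1] zs0) (?c * (12 * tapes M + 10) + 1)
      (?s [] [] [Suc (fst ?C)] zs) []"
    and zs: "list_all2 zipper (snd ?C) zs"
    using run_sim_loop[OF M len0 zs0, of ?b _ ?c "[]"] by (auto simp: start_def)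
  have simulate: "run (init_prog M a ;; For (clock_stack ?b) (\<lambda>_. step_prog M ?b))
      (with_words s a ws) (sim_bound M ?n) (?s [] [] [Suc (fst ?C)] zs) []"
    using run_SeqI_silent[OF init loop] by (simp add: sim_bound_def clock)
  have "2 * length (?s [] [] [Suc (fst ?C)] zs i) \<le> 2 * sim_bound M ?n" if "?b \<le> i" for i
    using run_length_le[OF simulate, of i] that ws by (simp add: with_stacks_def)
  then have finish: "run (finish_prog M a) (?s [] [] [Suc (fst ?C)] zs)
      (finish_time M (2 * sim_bound M ?n)) (with_words s a [strip (out_of M ws)]) []"
    unfolding out_of_def by (intro run_finish_prog M zs len) simp_all
  show ?thesis
    unfolding sim_prog_def Let_def sim_time_def sim_bound_def clock[symmetric] add.assoc
    using run_SeqI_silent[OF init run_SeqI_silent[OF loop finish]]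
    by (simp add: sim_bound_def clock add.assoc)
qed

lemma eventually_table_symbols:
  "\<forall>\<^sub>F N in sequentially. \<forall>(_, q, xs)\<in>set (table M).
    Suc q < N \<and> (\<forall>x\<in>set xs. enc (fst x) True < N)"
  by (intro eventually_ball_finite ballI finite_set)
    (auto split: prod.split intro!: eventually_conj eventually_ball_finite eventually_gt_at_top)

lemma wf_transition_prog:
  assumes M: "clocked_machine M" and b: "k < b" "left_stack b (2 * tapes M) \<le> N"
    and symbols: "\<forall>(_, q, xs)\<in>set (table M). Suc q < N \<and> (\<forall>x\<in>set xs. enc (fst x) True < N)"
  shows "wf_prog k N (transition_prog M b cs)"
proof (cases "map_of (table M) (hd cs - 1, map dec (tl cs))")
  case (Some y)
  obtain q xs where y: "y = (q, xs)" by (metis surj_pair)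
  have "((hd cs - 1, map dec (tl cs)), q, xs) \<in> set (table M)"
    using map_of_SomeD[OF Some] y by simp
  then have "length xs = tapes M" "Suc q < N" "\<And>x. x \<in> set xs \<Longrightarrow> enc (fst x) True < N"
    using M symbols by (fastforce simp: clocked_machine_def)+
  then show ?thesis
    unfolding transition_prog_def Some y option.case prod.case using b by (simp add: wf_acts_prog)
qed (simp add: transition_prog_def)

lemma wf_step_prog:
  assumes "clocked_machine M" and "k < b" and "left_stack b (2 * tapes M) \<le> N"
    and "\<forall>(_, q, xs)\<in>set (table M). Suc q < N \<and> (\<forall>x\<in>set xs. enc (fst x) True < N)"
  shows "wf_prog k N (step_prog M b)"
  unfolding step_prog_def using assms(2,3) wf_transition_prog[OF assms] by (intro wf_read_prog) auto

lemma wf_sim_prog: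
  assumes M: "clocked_machine M" and "k < a"
  shows "\<forall>\<^sub>F N in sequentially. wf_prog k N (sim_prog M a)"
  using eventually_table_symbols[of M]
    eventually_ge_at_top[of "7 + left_stack (a + inputs M) (2 * tapes M)"]
proof eventually_elim
  case (elim N)
  have "inputs M < tapes M"
    using M by (simp add: clocked_machine_def)
  with elim \<open>k < a\<close> have "wf_prog k N (init_prog M a)" "wf_prog k N (finish_prog M a)"
    by (simp_all add: init_prog_def finish_prog_def Let_def wf_load_all wf_clock_prog wf_drop_prog
        read_off_prog_def clear_prog_def wf_Seq_upto wf_transfer_prog wf_move_prog)
  moreover have "wf_prog k N (step_prog M (a + inputs M))"
    using elim \<open>k < a\<close> by (intro wf_step_prog[OF M]) auto
  ultimately show ?case
    using elim \<open>k < a\<close> by (simp add: sim_prog_def Let_def wf_For)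
qed


section \<open>Evaluating terms\<close>

abbreviation std_val :: "(nat \<Rightarrow> nat) \<Rightarrow> machine trm \<Rightarrow> nat"
  where "std_val \<equiv> tval standard_model"

lemma tval_cong: "(\<And>i. i \<in> tvars t \<Longrightarrow> e i = e' i) \<Longrightarrow> tval S e t = tval S e' t"
proof (induction t)
  case (Fn f ts)
  then have "map (tval S e) ts = map (tval S e') ts" by auto
  then show ?case by (simp only: tval.simps)
qed simp

text \<open>The value of variable \<open>x\<close> is kept on stack \<open>\<iota> x\<close>, below the stack \<open>b\<close> of the result.\<close>

function eval_prog :: "(nat \<Rightarrow> nat) \<Rightarrow> nat \<Rightarrow> machine trm \<Rightarrow> prog"
  where
    "eval_prog \<iota> b (Var x) = move_prog (\<iota> x) (b + 1) ;; copy_prog (b + 1) (\<iota> x) b id"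
  | "eval_prog \<iota> b (Fn M ts) =
      Seq_upto (\<lambda>j. eval_prog \<iota> (b + j) (ts ! j)) (length ts) ;; sim_prog M b"
  by pat_completeness auto
termination
proof (relation "measure (\<lambda>(_, _, t). size t)")
  fix ts :: "machine trm list" and j M and \<iota> :: "nat \<Rightarrow> nat" and b :: nat
  assume "j < length ts"
  then have "size (ts ! j) \<le> size_list size ts"
    by (intro size_list_estimation'[OF nth_mem order.refl])
  then show "((\<iota>, b + j, ts ! j), \<iota>, b, Fn M ts) \<in> measure (\<lambda>(_, _, t). size t)"
    by simp
qed simp

fun eval_time :: "machine trm \<Rightarrow> nat \<Rightarrow> nat"
  where
    "eval_time (Var x) n = 16 * n + 2"
  | "eval_time (Fn M ts) n =
      (\<Sum>t\<leftarrow>ts. eval_time t n) + sim_time M (\<Sum>t\<leftarrow>ts. eval_time t n)"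

lemma poly_bounded_eval_time: "poly_bounded (eval_time t)"
proof (induction t)
  case (Fn M ts)
  then have "poly_bounded (\<lambda>n. \<Sum>t\<leftarrow>ts. eval_time t n)"
    by (intro poly_bounded_sum_list)
  then have "poly_bounded (\<lambda>n. (\<Sum>t\<leftarrow>ts. eval_time t n) + sim_time M (\<Sum>t\<leftarrow>ts. eval_time t n))"
    by (intro poly_bounded_add poly_bounded_compose[OF poly_bounded_sim_time])
  then show ?case by simp
next
  case (Var x)
  have "poly_bounded (\<lambda>n. 16 * n + 2)"
    by (intro poly_bounded_intros)
  then show ?case by simp
qed

lemma wf_eval_prog:
  assumes "PV_trm t" and "k < b" and "\<And>x. x \<in> tvars t \<Longrightarrow> \<iota> x < b \<and> \<iota> x \<noteq> k"
  shows "\<forall>\<^sub>F N in sequentially. wf_prog k N (eval_prog \<iota> b t)"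
  using assms
proof (induction t arbitrary: b)
  case (Var x)
  then show ?case
    by (intro eventually_sequentiallyI[of "b + 2"]) (simp add: wf_move_prog wf_copy_prog)
next
  case (Fn M ts)
  have "\<forall>\<^sub>F N in sequentially. \<forall>j\<in>{..<length ts}. wf_prog k N (eval_prog \<iota> (b + j) (ts ! j))"
  proof (intro eventually_ball_finite ballI)
    fix j assume "j \<in> {..<length ts}"
    then have "ts ! j \<in> set ts" by simp
    with Fn.prems show "\<forall>\<^sub>F N in sequentially. wf_prog k N (eval_prog \<iota> (b + j) (ts ! j))"
      by (intro Fn.IH) (auto intro: trans_less_add1)
  qed simp
  moreover have "\<forall>\<^sub>F N in sequentially. wf_prog k N (sim_prog M b)"
    using Fn.prems by (intro wf_sim_prog) auto
  ultimately show ?case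
    by eventually_elim (simp add: wf_Seq_upto)
qed

definition holds_vars ::
    "(nat \<Rightarrow> nat) \<Rightarrow> nat \<Rightarrow> stacks \<Rightarrow> (nat \<Rightarrow> nat) \<Rightarrow> nat \<Rightarrow> nat set \<Rightarrow> bool"
  where "holds_vars \<iota> b s e n V \<longleftrightarrow>
    (\<forall>x\<in>V. \<iota> x < b \<and> s (\<iota> x) = word_syms (bits_of (e x)) \<and> len (e x) \<le> n)"

lemma with_words_append:
  "with_words (with_words s b us) (b + length us) vs = with_words s b (us @ vs)"
  by (auto simp: with_stacks_def fun_eq_iff nth_append)

lemma run_eval_Var:
  assumes "\<iota> x < b" and "s (\<iota> x) = word_syms w" and "length w \<le> n"
  shows "run (eval_prog \<iota> b (Var x)) (with_words s b []) (16 * n + 2) (with_words s b [w]) []"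
proof -
  let ?s = "(with_words s b [])(\<iota> x := [], b + 1 := rev (word_syms w))"
  have "run (move_prog (\<iota> x) (b + 1)) (with_words s b []) (7 * n + 1) ?s []"
    using assms by (intro run_move[of _ _ "word_syms w"]) (simp_all add: with_stacks_def)
  moreover have "run (copy_prog (b + 1) (\<iota> x) b id) ?s (9 * n + 1) (with_words s b [w]) []"
    using assms
    by (intro run_copy[of _ _ "rev (word_syms w)"]) (auto simp: with_stacks_def fun_eq_iff)
  ultimately show ?thesis
    unfolding eval_prog.simps by (rule run_SeqI) simp_all
qed

lemma run_result_length_le:
  assumes "run p (with_words s b []) t (with_words s b [w]) []"
  shows "length w \<le> t"
  using run_length_le[OF assms, of b] by (simp add: with_stacks_def)

lemma run_eval_args:
  assumes vars: "holds_vars \<iota> b s e n (\<Union>t\<in>set ts. tvars t)"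
    and eval: "\<And>t b s. t \<in> set ts \<Longrightarrow> holds_vars \<iota> b s e n (tvars t) \<Longrightarrow>
      run (eval_prog \<iota> b t) (with_words s b []) (eval_time t n)
        (with_words s b [bits_of (std_val e t)]) []"
  shows "run (Seq_upto (\<lambda>j. eval_prog \<iota> (b + j) (ts ! j)) (length ts)) (with_words s b [])
    (\<Sum>t\<leftarrow>ts. eval_time t n) (with_words s b (map (\<lambda>t. bits_of (std_val e t)) ts)) []"
proof -
  let ?ws = "map (\<lambda>t. bits_of (std_val e t)) ts"
  define \<sigma> where "\<sigma> j = with_words s b (take j ?ws)" for j
  have "run (eval_prog \<iota> (b + j) (ts ! j)) (\<sigma> j) (eval_time (ts ! j) n) (\<sigma> (Suc j)) []"
    if j: "j < length ts" for j
  proof -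
    have "holds_vars \<iota> (b + j) (\<sigma> j) e n (tvars (ts ! j))"
      using vars nth_mem[OF j] by (fastforce simp: holds_vars_def \<sigma>_def with_stacks_def)
    then have "run (eval_prog \<iota> (b + j) (ts ! j)) (with_words (\<sigma> j) (b + j) [])
        (eval_time (ts ! j) n) (with_words (\<sigma> j) (b + j) [?ws ! j]) []"
      using eval[OF nth_mem[OF j]] j by simp
    moreover have "with_words (\<sigma> j) (b + j) us = with_words s b (take j ?ws @ us)" for us
      using with_words_append[of s b "take j ?ws" us] j by (simp add: \<sigma>_def)
    moreover have "take (Suc j) ?ws = take j ?ws @ [?ws ! j]"
      using j by (intro take_Suc_conv_app_nth) simp
    ultimately show ?thesis
      by (simp only: \<sigma>_def append_Nil2)
  qed
  then show ?thesis
    using run_Seq_upto[where \<sigma> = \<sigma> and m = "length ts"]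
    by (simp add: \<sigma>_def sum_list_sum_nth atLeast0LessThan)
qed

theorem run_eval_prog:
  assumes "PV_trm t" and "holds_vars \<iota> b s e n (tvars t)"
  shows "run (eval_prog \<iota> b t) (with_words s b []) (eval_time t n)
    (with_words s b [bits_of (std_val e t)]) []"
  using assms
proof (induction t arbitrary: b s)
  case (Var x)
  then show ?case
    using run_eval_Var[of \<iota> x b s "bits_of (e x)" n] by (simp add: holds_vars_def)
next
  case (Fn M ts)
  let ?ws = "map (\<lambda>t. bits_of (std_val e t)) ts"
  have M: "clocked_machine M" "length ?ws = inputs M"
    using Fn.prems(1) by simp_all
  have eval: "run (eval_prog \<iota> b t) (with_words s b []) (eval_time t n)
      (with_words s b [bits_of (std_val e t)]) []"
    if "t \<in> set ts" "holds_vars \<iota> b s e n (tvars t)" for t b s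
    using Fn.IH that Fn.prems(1) by simp
  have args: "run (Seq_upto (\<lambda>j. eval_prog \<iota> (b + j) (ts ! j)) (length ts)) (with_words s b [])
      (\<Sum>t\<leftarrow>ts. eval_time t n) (with_words s b ?ws) []"
    using Fn.prems(2) by (intro run_eval_args eval) simp_all
  have "len (std_val e t) \<le> eval_time t n" if "t \<in> set ts" for t
  proof -
    have "holds_vars \<iota> b s e n (tvars t)"
      using Fn.prems(2) that by (auto simp: holds_vars_def)
    then show ?thesis
      using run_result_length_le[OF eval[OF that]] by simp
  qed
  then have "(\<Sum>w\<leftarrow>?ws. length w) \<le> (\<Sum>t\<leftarrow>ts. eval_time t n)"
    by (simp add: o_def sum_list_mono)
  then have call: "run (sim_prog M b) (with_words s b ?ws) (sim_time M (\<Sum>t\<leftarrow>ts. eval_time t n))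
      (with_words s b [strip (out_of M ?ws)]) []"
    using run_mono[OF run_sim_prog[OF M] mono_sim_time] by blast
  have "strip (out_of M ?ws) = bits_of (std_val e (Fn M ts))"
    by (simp add: standard_model_def strip_eq fun_of_def o_def)
  with run_SeqI_silent[OF args call] show ?case
    by simp
qed

lemma len_std_val_le:
  assumes "PV_trm t"
  shows "len (std_val (\<lambda>_. a) t) \<le> eval_time t (len a)"
proof -
  have "holds_vars (\<lambda>_. 0) 1 (\<lambda>_. word_syms (bits_of a)) (\<lambda>_. a) (len a) (tvars t)"
    by (simp add: holds_vars_def)
  then show ?thesis
    using run_result_length_le[OF run_eval_prog[OF assms]] by fastforce
qed

theorem computes_term:
  assumes t: "PV_trm t" and vars: "tvars t \<subseteq> {..<k}" and "1 \<le> k"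
  shows "\<exists>M. computes_num k M (\<lambda>xs. std_val (\<lambda>i. xs ! i) t)"
proof -
  let ?F = "\<lambda>ws. bits_of (std_val (\<lambda>i. num_of (ws ! i)) t)"
  let ?eval = "eval_prog id (Suc k) t" and ?emit = "For (Suc k) (\<lambda>a. Emit (a = 2))"
  have "\<exists>M. computes k (list_all canonical) M ?F"
  proof (rule computes_prog)
    have "\<forall>\<^sub>F N in sequentially. wf_prog k N ?eval"
      using vars by (intro wf_eval_prog[OF t]) (auto simp: less_Suc_eq)
    then show "\<forall>\<^sub>F N in sequentially. wf_prog k N (?eval ;; ?emit)"
      using eventually_gt_at_top[of "Suc k"] by eventually_elim (simp add: wf_For)
    show "poly_bounded (\<lambda>n. eval_time t n + (6 * eval_time t n + 1))"
      by (intro poly_bounded_intros poly_bounded_eval_time)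
    fix ws assume ws: "length ws = k" "list_all canonical ws"
    let ?n = "sum_list (map length ws)" and ?e = "\<lambda>i. num_of (ws ! i)"
    have word: "bits_of (?e x) = ws ! x" "length (ws ! x) \<le> ?n" if "x < k" for x
      using that ws by (auto simp: bits_of_num_of list_all_length intro!: member_le_sum_list)
    then have "len (?e x) \<le> ?n" if "x < k" for x
      using that by (metis length_bits_of)
    then have "holds_vars id (Suc k) (input_stacks ws) ?e ?n (tvars t)"
      using vars ws(1) word by (auto simp: holds_vars_def with_stacks_def less_Suc_eq)
    from run_eval_prog[OF t this] have eval: "run ?eval (with_words (input_stacks ws) (Suc k) [])
        (eval_time t ?n) (with_words (input_stacks ws) (Suc k) [?F ws]) []" .
    have "with_words (input_stacks ws) (Suc k) [] = input_stacks ws"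
      using ws(1) by (auto simp: with_stacks_def fun_eq_iff)
    moreover have "\<exists>s'. run ?emit (with_words (input_stacks ws) (Suc k) [?F ws])
        (6 * eval_time t ?n + 1) s' (?F ws)"
      using run_result_length_le[OF eval]
      by (intro exI run_emit_stack) (simp_all add: with_stacks_def)
    ultimately show "\<exists>s'. run (?eval ;; ?emit) (input_stacks ws)
        (eval_time t ?n + (6 * eval_time t ?n + 1)) s' (?F ws)"
      using eval by (metis run_SeqI_silent)
  qed fact
  moreover have "std_val (\<lambda>i. num_of (map bits_of xs ! i)) t = std_val (\<lambda>i. xs ! i) t"
    if "length xs = k" for xs
    using that vars by (intro tval_cong) auto
  ultimately show ?thesis
    by (elim ex_forward, elim computes_num_of_computes) simp
qed


section \<open>The bits of a value are decided in polynomial time\<close>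

text \<open>
  Entry \<open>num_of w\<close> of a list is found by keeping, for each bit of \<open>w\<close> in turn, the entries at even
  or at odd positions; counting down from \<open>num_of w\<close> would take exponential time.
\<close>

fun evens :: "'a list \<Rightarrow> 'a list"
  where
    "evens [] = []"
  | "evens (x # xs) = x # evens (tl xs)"

lemma length_evens: "length (evens xs) = (length xs + 1) div 2"
proof (induction xs rule: evens.induct)
  case (2 x xs)
  then show ?case by (cases xs) simp_all
qed simp

lemma length_evens_le: "length (evens xs) \<le> length xs"
  by (simp add: length_evens)

lemma nth_evens: "2 * i < length xs \<Longrightarrow> evens xs ! i = xs ! (2 * i)"
  by (induction xs arbitrary: i rule: evens.induct) (auto simp: nth_Cons nth_tl split: nat.split)

lemma set_evens: "set (evens xs) \<subseteq> set xs"
proof (induction xs rule: evens.induct)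
  case (2 x xs)
  then show ?case by (cases xs) auto
qed simp

primrec pick :: "bool list \<Rightarrow> 'a list \<Rightarrow> 'a list"
  where
    "pick [] xs = xs"
  | "pick (b # w) xs = pick w (evens (if b then tl xs else xs))"

lemma pick_eq_Nil_iff: "pick w xs = [] \<longleftrightarrow> length xs \<le> num_of w"
proof (induction w arbitrary: xs)
  case (Cons b w)
  show ?case
    by (cases b) (auto simp: Cons.IH length_evens)
qed simp

lemma hd_pick: "num_of w < length xs \<Longrightarrow> hd (pick w xs) = xs ! num_of w"
proof (induction w arbitrary: xs)
  case Nil
  then show ?case by (simp add: hd_conv_nth)
next
  case (Cons b w)
  let ?xs = "if b then tl xs else xs"
  have "2 * num_of w < length ?xs"
    using Cons.prems by auto
  then have "hd (pick w (evens ?xs)) = ?xs ! (2 * num_of w)"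
    using Cons.IH[of "evens ?xs"] by (simp add: length_evens nth_evens)
  then show ?case
    using Cons.prems by (cases xs) auto
qed

text \<open>
  Stack 0 holds \<open>w\<close>, stack 2 the argument \<open>2 ^ n\<close> of the term, stack 4 the list to pick from; stacks
  3 and 5 are scratch.
\<close>

definition evens_prog :: prog
  where "evens_prog = For 4 (\<lambda>a. Push 5 a ;; Pop 4)"

lemma run_evens_prog:
  assumes "s 4 = xs" and "0 \<notin> set xs"
  shows "run evens_prog s (8 * length xs + 1) (s(4 := [], 5 := rev (evens xs) @ s 5)) []"
  using assms
proof (induction xs arbitrary: s rule: evens.induct)
  case 1
  then show ?case by (simp add: evens_prog_def run_For_Nil fun_upd_idem)
next
  case (2 x xs)
  let ?s1 = "s(4 := tl xs, 5 := x # s 5)"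
  have body: "run (Push 5 x ;; Pop 4) (s(4 := xs)) 3 ?s1 []"
    by (intro run_loop_free) (auto simp: fun_eq_iff)
  have "run evens_prog ?s1 (8 * length (tl xs) + 1)
      (?s1(4 := [], 5 := rev (evens (tl xs)) @ ?s1 5)) []"
    using "2.prems" by (cases xs; intro "2.IH") auto
  moreover have "?s1(4 := [], 5 := rev (evens (tl xs)) @ ?s1 5) =
      s(4 := [], 5 := rev (evens (x # xs)) @ s 5)"
    by (auto simp: fun_eq_iff)
  ultimately have rest: "run evens_prog ?s1 (8 * length (tl xs) + 1)
      (s(4 := [], 5 := rev (evens (x # xs)) @ s 5)) []"
    by metis
  show ?case
    unfolding evens_prog_def
  proof (rule run_For_Cons)
    show "s 4 = x # xs" "x \<noteq> 0"
      using "2.prems" by auto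
  qed (rule body rest[unfolded evens_prog_def] | simp)+
qed

definition halve_prog :: "nat \<Rightarrow> prog"
  where "halve_prog b = (if b = 2 then Pop 4 else Skip) ;; evens_prog ;; move_prog 5 4"

lemma run_halve_prog:
  assumes "s 4 = xs" and "s 5 = []" and "0 \<notin> set xs" and "length xs \<le> m"
    and "s' = s(4 := evens (if b then tl xs else xs))"
  shows "run (halve_prog (bit_sym b)) s (15 * m + 3) s' []"
proof -
  let ?xs = "if b then tl xs else xs"
  let ?s1 = "s(4 := ?xs)" and ?s2 = "s(4 := [], 5 := rev (evens ?xs))"
  have xs: "0 \<notin> set ?xs" "length ?xs \<le> m"
    using assms(3,4) by (cases xs; auto)+
  have drop: "run (if bit_sym b = 2 then Pop 4 else Skip) s 1 ?s1 []"
    using assms(1) by (intro run_loop_free) auto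
  have evens: "run evens_prog ?s1 (8 * m + 1) ?s2 []"
    using run_mono[OF run_evens_prog[of ?s1 ?xs]] xs assms(2) by simp
  have restore: "run (move_prog 5 4) ?s2 (7 * m + 1) s' []"
    using xs set_evens[of ?xs] assms(2,5)
    by (intro run_move[of _ _ "rev (evens ?xs)"]) (auto simp: fun_eq_iff
        intro: order.trans[OF length_evens_le])
  show ?thesis
    unfolding halve_prog_def
    by (rule run_SeqI[OF drop run_SeqI_silent[OF evens restore]]) simp_all
qed

lemma run_pick:
  assumes "s 0 = word_syms w" and "s 4 = xs" and "s 5 = []" and "0 \<notin> set xs" and "length xs \<le> m"
  shows "run (For 0 halve_prog) s (length w * (15 * m + 8) + 1) (s(0 := [], 4 := pick w xs)) []"
  using assms
proof (induction w arbitrary: s xs)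
  case Nil
  then show ?case by (simp add: run_For_Nil fun_upd_idem)
next
  case (Cons b w)
  let ?xs = "evens (if b then tl xs else xs)"
  let ?s1 = "s(0 := word_syms w, 4 := ?xs)"
  have body: "run (halve_prog (bit_sym b)) (s(0 := word_syms w)) (15 * m + 3) ?s1 []"
    using Cons.prems by (intro run_halve_prog[of _ xs]) simp_all
  have "0 \<notin> set ?xs"
    using Cons.prems(4) set_evens[of "if b then tl xs else xs"]
    by (cases xs) (auto split: if_splits)
  moreover have "length ?xs \<le> m"
    using Cons.prems(5) length_evens_le[of "if b then tl xs else xs"] by auto
  ultimately have "run (For 0 halve_prog) ?s1 (length w * (15 * m + 8) + 1)
      (?s1(0 := [], 4 := pick w ?xs)) []"
    using Cons.prems(3) by (intro Cons.IH) simp_all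
  moreover have "?s1(0 := [], 4 := pick w ?xs) = s(0 := [], 4 := pick (b # w) xs)"
    by (auto simp: fun_eq_iff)
  ultimately have rest: "run (For 0 halve_prog) ?s1 (length w * (15 * m + 8) + 1)
      (s(0 := [], 4 := pick (b # w) xs)) []"
    by metis
  show ?case
  proof (rule run_For_Cons)
    show "s 0 = bit_sym b # word_syms w" "bit_sym b \<noteq> 0"
      using Cons.prems by simp_all
  qed (rule body rest | simp)+
qed

definition power_prog :: prog
  where "power_prog = Push 2 2 ;; copy_prog 0 3 2 (\<lambda>_. 1) ;; move_prog 3 0"

lemma run_power_prog:
  assumes "s 0 = word_syms w" and "s 2 = []" and "s 3 = []"
    and "s' = s(2 := word_syms (bits_of (2 ^ length w)))"
  shows "run power_prog s (16 * length w + 4) s' []"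
proof -
  let ?ones = "replicate (length w) 1 @ [2]"
  have ones: "word_syms (bits_of (2 ^ length w)) = ?ones"
    by (simp add: bits_of_two_power word_syms_def bit_sym_def)
  have base: "run (Push 2 2) s 2 (s(2 := [2])) []"
    using assms by (intro run_loop_free) auto
  have copy: "run (copy_prog 0 3 2 (\<lambda>_. 1)) (s(2 := [2])) (9 * length w + 1)
      (s(0 := [], 3 := rev (word_syms w), 2 := ?ones)) []"
    using assms
    by (intro run_copy[of _ _ "word_syms w"]) (auto simp: fun_eq_iff map_replicate_const)
  have restore: "run (move_prog 3 0) (s(0 := [], 3 := rev (word_syms w), 2 := ?ones))
      (7 * length w + 1) s' []"
    using assms ones by (intro run_move[of _ _ "rev (word_syms w)"]) (auto simp: fun_eq_iff)
  show ?thesis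
    unfolding power_prog_def
    by (rule run_mono[OF run_SeqI_silent[OF base run_SeqI_silent[OF copy restore]]]) simp
qed

definition term_at :: "machine trm \<Rightarrow> nat \<Rightarrow> nat"
  where "term_at t n = std_val (\<lambda>_. 2 ^ n) t"

lemma len_term_at_le: "PV_trm t \<Longrightarrow> len (term_at t n) \<le> eval_time t (Suc n)"
  using len_std_val_le[of t "2 ^ n"] by (simp add: term_at_def len_two_power)

definition bit_language :: "machine trm \<Rightarrow> bool list set"
  where "bit_language t =
    {w. num_of w < len (term_at t (length w)) \<and> bits_of (term_at t (length w)) ! num_of w}"

definition bit_prog :: "machine trm \<Rightarrow> prog"
  where "bit_prog t = power_prog ;; eval_prog (\<lambda>_. 2) 4 t ;; For 0 halve_prog ;;
    Switch 4 (\<lambda>a. if a = 2 then Emit True else Skip)"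

definition bit_time :: "machine trm \<Rightarrow> nat \<Rightarrow> nat"
  where "bit_time t n = 16 * n + 4 +
    (eval_time t (Suc n) + (n * (15 * eval_time t (Suc n) + 8) + 1 + 3))"

lemma peek_pick: "peek (pick w (word_syms v)) = 2 \<longleftrightarrow> num_of w < length v \<and> v ! num_of w"
proof (cases "num_of w < length v")
  case True
  then have "pick w (word_syms v) \<noteq> []"
    by (simp add: pick_eq_Nil_iff)
  then have "peek (pick w (word_syms v)) = hd (pick w (word_syms v))"
    by (cases "pick w (word_syms v)") simp_all
  with True show ?thesis
    by (simp add: hd_pick) (simp add: word_syms_def)
next
  case False
  then have "pick w (word_syms v) = []"
    by (simp add: pick_eq_Nil_iff)
  with False show ?thesis by simp
qed

lemma run_bit_prog:
  assumes t: "PV_trm t"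
  shows "\<exists>s'. run (bit_prog t) (input_stacks [w]) (bit_time t (length w)) s'
    (if w \<in> bit_language t then [True] else [])"
proof -
  let ?n = "length w" and ?y = "term_at t (length w)"
  let ?answer = "Switch 4 (\<lambda>a. if a = 2 then Emit True else Skip)"
  let ?s1 = "(input_stacks [w])(2 := word_syms (bits_of (2 ^ ?n)))"
  let ?s2 = "?s1(4 := word_syms (bits_of ?y))"
  let ?s3 = "?s2(0 := [], 4 := pick w (word_syms (bits_of ?y)))"
  have power: "run power_prog (input_stacks [w]) (16 * ?n + 4) ?s1 []"
    by (intro run_power_prog) (simp_all add: with_stacks_def)
  have "holds_vars (\<lambda>_. 2) 4 ?s1 (\<lambda>_. 2 ^ ?n) (Suc ?n) (tvars t)"
    by (simp add: holds_vars_def len_two_power)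
  from run_eval_prog[OF t this] have "run (eval_prog (\<lambda>_. 2) 4 t) (with_words ?s1 4 [])
      (eval_time t (Suc ?n)) (with_words ?s1 4 [bits_of ?y]) []"
    by (simp add: term_at_def)
  moreover have "with_words ?s1 4 [] = ?s1" "with_words ?s1 4 [bits_of ?y] = ?s2"
    by (auto simp: with_stacks_def fun_eq_iff)
  ultimately have eval: "run (eval_prog (\<lambda>_. 2) 4 t) ?s1 (eval_time t (Suc ?n)) ?s2 []"
    by simp
  have pick: "run (For 0 halve_prog) ?s2 (?n * (15 * eval_time t (Suc ?n) + 8) + 1) ?s3 []"
    using len_term_at_le[OF t, of ?n]
    by (intro run_pick[of _ _ "word_syms (bits_of ?y)"]) (simp_all add: with_stacks_def)
  have answer: "run ?answer ?s3 3 ?s3 (if w \<in> bit_language t then [True] else [])"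
    using peek_pick[of w "bits_of ?y"] by (intro run_loop_free) (simp_all add: bit_language_def)
  show ?thesis
    using run_SeqI_silent[OF power run_SeqI_silent[OF eval run_SeqI_silent[OF pick answer]]]
    unfolding bit_prog_def bit_time_def by blast
qed

theorem bit_language_in_P:
  assumes t: "PV_trm t"
  shows "bit_language t \<in> class_P"
proof -
  have "\<exists>M. computes 1 (\<lambda>_. True) M (\<lambda>ws. if hd ws \<in> bit_language t then [True] else [])"
  proof (rule computes_prog)
    have "\<forall>\<^sub>F N in sequentially. wf_prog 1 N (eval_prog (\<lambda>_. 2) 4 t)"
      by (intro wf_eval_prog[OF t]) simp_all
    then show "\<forall>\<^sub>F N in sequentially. wf_prog 1 N (bit_prog t)"
      using eventually_ge_at_top[of 6]
      by eventually_elim (simp add: bit_prog_def power_prog_def halve_prog_def evens_prog_def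
          wf_For wf_copy_prog wf_move_prog)
    show "poly_bounded (bit_time t)"
      unfolding bit_time_def
      by (intro poly_bounded_intros poly_bounded_compose[OF poly_bounded_eval_time])
    show "\<exists>s'. run (bit_prog t) (input_stacks ws) (bit_time t (sum_list (map length ws))) s'
        (if hd ws \<in> bit_language t then [True] else [])" if "length ws = 1" for ws
      using run_bit_prog[OF t, of "hd ws"] that by (cases ws) simp_all
  qed simp
  then obtain M where M: "clocked_machine M" "inputs M = 1"
    and "\<And>w. out_of M [w] = (if w \<in> bit_language t then [True] else [])"
    by (auto simp: computes_def)
  then have "\<forall>w. w \<in> bit_language t \<longleftrightarrow> out_of M [w] = [True]"
    by simp
  with M show ?thesis
    unfolding class_P_def by blast
qed


section \<open>The generator\<close>

text \<open>
  An instruction takes three bits, and \<open>OpNone\<close> is coded by ones only.  Hence programs can be padded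
  with ones to any length, multiple of three or not; an incomplete last instruction is ignored.
\<close>

datatype oper = OpLeft | OpRight | OpLoad | OpAnd | OpOr | OpNot | OpStore | OpNone

fun decode :: "bool \<Rightarrow> bool \<Rightarrow> bool \<Rightarrow> oper"
  where
    "decode False False False = OpLeft"
  | "decode False False True = OpRight"
  | "decode False True False = OpLoad"
  | "decode False True True = OpAnd"
  | "decode True False False = OpOr"
  | "decode True False True = OpNot"
  | "decode True True False = OpStore"
  | "decode True True True = OpNone"

text \<open>The memory is a bit tape, split at the head, together with an accumulator.\<close>

type_synonym memory = "bool list \<times> bool list \<times> bool"

definition head_bit :: "bool list \<Rightarrow> bool"
  where "head_bit R \<longleftrightarrow> R \<noteq> [] \<and> hd R"

fun apply_op :: "oper \<Rightarrow> memory \<Rightarrow> memory"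
  where
    "apply_op OpLeft (L, R, a) = (tl L, head_bit L # R, a)"
  | "apply_op OpRight (L, R, a) = (head_bit R # L, tl R, a)"
  | "apply_op OpLoad (L, R, a) = (L, R, head_bit R)"
  | "apply_op OpAnd (L, R, a) = (L, R, a \<and> head_bit R)"
  | "apply_op OpOr (L, R, a) = (L, R, a \<or> head_bit R)"
  | "apply_op OpNot (L, R, a) = (L, R, \<not> a)"
  | "apply_op OpStore (L, R, a) = (L, a # tl R, a)"
  | "apply_op OpNone (L, R, a) = (L, R, a)"

fun exec_word :: "bool list \<Rightarrow> memory \<Rightarrow> memory"
  where
    "exec_word (a # b # c # w) \<mu> = exec_word w (apply_op (decode a b c) \<mu>)"
  | "exec_word w \<mu> = \<mu>"

fun accumulator :: "memory \<Rightarrow> bool"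
  where "accumulator (L, R, a) = a"

definition blank_memory :: memory
  where "blank_memory = ([], [], False)"

definition gen_out :: "bool list \<Rightarrow> bool list"
  where "gen_out w =
    map (\<lambda>i. accumulator ((exec_word w ^^ Suc i) blank_memory)) [0..<length w] @ [True]"


subsection \<open>The generator as a stack program\<close>

definition acc_prog :: "(bool \<Rightarrow> bool \<Rightarrow> bool) \<Rightarrow> prog"
  where "acc_prog f = Switch 5 (\<lambda>c. Switch 6 (\<lambda>a. Pop 6 ;;
    (if f (a = 2) (c = 2) then Push 6 2 else Skip)))"

fun oper_prog :: "oper \<Rightarrow> prog"
  where
    "oper_prog OpLeft = Switch 4 (\<lambda>c. Pop 4 ;; Push 5 (if c = 2 then 2 else 1))"
  | "oper_prog OpRight = Switch 5 (\<lambda>c. Pop 5 ;; Push 4 (if c = 2 then 2 else 1))"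
  | "oper_prog OpLoad = acc_prog (\<lambda>a c. c)"
  | "oper_prog OpAnd = acc_prog (\<lambda>a c. a \<and> c)"
  | "oper_prog OpOr = acc_prog (\<lambda>a c. a \<or> c)"
  | "oper_prog OpNot = acc_prog (\<lambda>a c. \<not> a)"
  | "oper_prog OpStore = Switch 6 (\<lambda>a. Pop 5 ;; Push 5 (if a = 2 then 2 else 1))"
  | "oper_prog OpNone = Skip"

text \<open>
  Stack 0 holds the program, stack 2 its part already read, stack 3 the remaining rounds in unary,
  stacks 4 and 5 the memory left and right of the head, stack 6 the accumulator.
\<close>

fun with_memory :: "stacks \<Rightarrow> memory \<Rightarrow> stacks"
  where "with_memory s (L, R, a) = s(4 := word_syms L, 5 := word_syms R, 6 := flag a)"

lemma with_memory_other: "i < 4 \<Longrightarrow> with_memory s \<mu> i = s i"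
  by (cases \<mu>) auto

lemma with_memory_update: "i < 4 \<Longrightarrow> (with_memory s \<mu>)(i := w) = with_memory (s(i := w)) \<mu>"
  by (cases \<mu>) (auto simp: fun_eq_iff)

lemma loop_free_oper_prog: "loop_free (oper_prog x)"
  by (cases x) (simp_all add: acc_prog_def)

lemma oper_prog_correct:
  "effect (oper_prog x) (with_memory s \<mu>) = with_memory s (apply_op x \<mu>)"
  "emitted (oper_prog x) (with_memory s \<mu>) = []"
  "cost (oper_prog x) (with_memory s \<mu>) \<le> 8"
proof -
  obtain L R a where \<mu>: "\<mu> = (L, R, a)" by (metis prod_cases3)
  show "effect (oper_prog x) (with_memory s \<mu>) = with_memory s (apply_op x \<mu>)"
    unfolding \<mu>
    by (cases x; cases L; cases R)
      (auto simp: acc_prog_def head_bit_def flag_def fun_eq_iff bit_sym_def)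
  show "emitted (oper_prog x) (with_memory s \<mu>) = []"
    and "cost (oper_prog x) (with_memory s \<mu>) \<le> 8"
    by (cases x; simp add: acc_prog_def)+
qed

lemma wf_oper_prog: "7 \<le> N \<Longrightarrow> wf_prog 1 N (oper_prog x)"
  by (cases x) (auto simp: acc_prog_def)

definition fetch_prog :: "(nat \<Rightarrow> prog) \<Rightarrow> prog"
  where "fetch_prog f = Switch 0 (\<lambda>b. if b = 0 then Skip else Pop 0 ;; Push 2 b ;; f b)"

definition instr_prog :: "nat \<Rightarrow> prog"
  where "instr_prog a = Push 2 a ;; fetch_prog (\<lambda>b. fetch_prog (\<lambda>c.
    oper_prog (decode (a = 2) (b = 2) (c = 2))))"

lemma wf_instr_prog: "7 \<le> N \<Longrightarrow> 0 < a \<Longrightarrow> a < N \<Longrightarrow> wf_prog 1 N (instr_prog a)"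
  using wf_oper_prog[of N] by (simp add: instr_prog_def fetch_prog_def)

lemma run_instr_prog:
  fixes a :: bool and w :: "bool list"
  shows "run (instr_prog (bit_sym a)) (with_memory (s(0 := word_syms w)) \<mu>) 20
    (with_memory (s(0 := word_syms (drop 2 w), 2 := rev (word_syms (take 2 w)) @ bit_sym a # s 2))
      (exec_word (a # take 2 w) \<mu>)) []"
  by (cases w rule: remdups_adj.cases; intro run_loop_free)
    (simp_all add: instr_prog_def fetch_prog_def loop_free_oper_prog oper_prog_correct
      with_memory_other with_memory_update)

lemma exec_word_Cons: "exec_word (a # w) \<mu> = exec_word (drop 2 w) (exec_word (a # take 2 w) \<mu>)"
  by (cases w rule: remdups_adj.cases) auto

lemma run_exec_word:
  assumes "s 0 = word_syms w"
  shows "run (For 0 instr_prog) (with_memory s \<mu>) (25 * length w + 1)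
    (with_memory (s(0 := [], 2 := rev (word_syms w) @ s 2)) (exec_word w \<mu>)) []"
  using assms
proof (induction w arbitrary: s \<mu> rule: length_induct)
  case (1 w)
  show ?case
  proof (cases w)
    case Nil
    with 1 show ?thesis by (simp add: run_For_Nil fun_upd_idem with_memory_other)
  next
    case (Cons a v)
    let ?s1 = "s(0 := word_syms (drop 2 v), 2 := rev (word_syms (take 2 v)) @ bit_sym a # s 2)"
    have body: "run (instr_prog (bit_sym a)) ((with_memory s \<mu>)(0 := word_syms v)) 20
        (with_memory ?s1 (exec_word (a # take 2 v) \<mu>)) []"
      using run_instr_prog[of a s v \<mu>] by (simp add: with_memory_update)
    have "run (For 0 instr_prog) (with_memory ?s1 (exec_word (a # take 2 v) \<mu>))
        (25 * length (drop 2 v) + 1)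
        (with_memory (?s1(0 := [], 2 := rev (word_syms (drop 2 v)) @ ?s1 2))
          (exec_word (drop 2 v) (exec_word (a # take 2 v) \<mu>))) []"
      by (intro "1.IH"[rule_format]) (simp_all add: Cons)
    moreover have "rev (word_syms (drop 2 v)) @ rev (word_syms (take 2 v)) = rev (word_syms v)"
      by (simp add: word_syms_def flip: rev_append map_append)
    then have "?s1(0 := [], 2 := rev (word_syms (drop 2 v)) @ ?s1 2) =
        s(0 := [], 2 := rev (word_syms w) @ s 2)"
      by (simp add: Cons fun_eq_iff)
    moreover have "exec_word (drop 2 v) (exec_word (a # take 2 v) \<mu>) = exec_word w \<mu>"
      using exec_word_Cons[of a v \<mu>] Cons by simp
    ultimately have rest: "run (For 0 instr_prog) (with_memory ?s1 (exec_word (a # take 2 v) \<mu>))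
        (25 * length (drop 2 v) + 1)
        (with_memory (s(0 := [], 2 := rev (word_syms w) @ s 2)) (exec_word w \<mu>)) []"
      by (simp only:)
    show ?thesis
    proof (rule run_For_Cons)
      show "with_memory s \<mu> 0 = bit_sym a # word_syms v" "bit_sym a \<noteq> 0"
        using 1 Cons by (simp_all add: with_memory_other)
    qed (rule body rest | simp add: Cons)+
  qed
qed

definition round_prog :: prog
  where "round_prog = For 0 instr_prog ;; move_prog 2 0 ;; Switch 6 (\<lambda>a. Emit (a = 2))"

lemma run_round_prog:
  assumes "s 0 = word_syms w" and "s 2 = []"
  shows "run round_prog (with_memory s \<mu>) (32 * length w + 5) (with_memory s (exec_word w \<mu>))
    [accumulator (exec_word w \<mu>)]"
proof -
  let ?s1 = "s(0 := [], 2 := rev (word_syms w))"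
  have exec: "run (For 0 instr_prog) (with_memory s \<mu>) (25 * length w + 1)
      (with_memory ?s1 (exec_word w \<mu>)) []"
    using run_exec_word[of s w \<mu>] assms by simp
  have "?s1(2 := [], 0 := word_syms w) = s"
    using assms by (auto simp: fun_eq_iff)
  then have restore: "run (move_prog 2 0) (with_memory ?s1 (exec_word w \<mu>)) (7 * length w + 1)
      (with_memory s (exec_word w \<mu>)) []"
    by (intro run_move[of _ _ "rev (word_syms w)"])
      (simp_all add: with_memory_other with_memory_update)
  have emit: "run (Switch 6 (\<lambda>a. Emit (a = 2))) (with_memory s (exec_word w \<mu>)) 3
      (with_memory s (exec_word w \<mu>)) [accumulator (exec_word w \<mu>)]"
    by (cases "exec_word w \<mu>"; intro run_loop_free) (simp_all add: flag_def)
  show ?thesis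
    unfolding round_prog_def
    by (rule run_mono[OF run_SeqI_silent[OF exec run_SeqI_silent[OF restore emit]]]) simp
qed

lemma run_rounds:
  assumes "s 0 = word_syms w" and "s 2 = []" and "s 3 = replicate m 1"
  shows "run (For 3 (\<lambda>_. round_prog)) (with_memory s \<mu>) (m * (32 * length w + 10) + 1)
    (with_memory (s(3 := [])) ((exec_word w ^^ m) \<mu>))
    (map (\<lambda>i. accumulator ((exec_word w ^^ Suc i) \<mu>)) [0..<m])"
  using assms
proof (induction m arbitrary: s \<mu>)
  case 0
  then show ?case by (simp add: run_For_Nil fun_upd_idem with_memory_other)
next
  case (Suc m)
  let ?s1 = "s(3 := replicate m 1)"
  have "run round_prog (with_memory ?s1 \<mu>) (32 * length w + 5) (with_memory ?s1 (exec_word w \<mu>))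
      [accumulator (exec_word w \<mu>)]"
    using Suc.prems by (intro run_round_prog) simp_all
  then have body: "run round_prog ((with_memory s \<mu>)(3 := replicate m 1)) (32 * length w + 5)
      (with_memory ?s1 (exec_word w \<mu>)) [accumulator (exec_word w \<mu>)]"
    by (simp add: with_memory_update)
  have "?s1 0 = word_syms w" "?s1 2 = []" "?s1 3 = replicate m 1"
    using Suc.prems by simp_all
  from Suc.IH[OF this, of "exec_word w \<mu>"]
  have rest: "run (For 3 (\<lambda>_. round_prog)) (with_memory ?s1 (exec_word w \<mu>))
      (m * (32 * length w + 10) + 1) (with_memory (s(3 := [])) ((exec_word w ^^ Suc m) \<mu>))
      (map (\<lambda>i. accumulator ((exec_word w ^^ Suc i) (exec_word w \<mu>))) [0..<m])"
    by (simp only: fun_upd_upd funpow_Suc_right comp_apply)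
  show ?case
  proof (rule run_For_Cons)
    show "with_memory s \<mu> 3 = 1 # replicate m 1" "(1 :: nat) \<noteq> 0"
      using Suc.prems by (simp_all add: with_memory_other)
    show "map (\<lambda>i. accumulator ((exec_word w ^^ Suc i) \<mu>)) [0..<Suc m] =
        [accumulator (exec_word w \<mu>)] @
        map (\<lambda>i. accumulator ((exec_word w ^^ Suc i) (exec_word w \<mu>))) [0..<m]"
      by (simp add: map_upt_Suc funpow_swap1 del: upt_Suc)
  qed (rule body rest | simp)+
qed

definition gen_prog :: prog
  where "gen_prog = copy_prog 0 2 3 (\<lambda>_. 1) ;; move_prog 2 0 ;; For 3 (\<lambda>_. round_prog) ;; Emit True"

definition gen_time :: "nat \<Rightarrow> nat"
  where "gen_time n = 9 * n + 1 + (7 * n + 1 + (n * (32 * n + 10) + 1 + 1))"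

lemma run_gen_prog: "\<exists>s'. run gen_prog (input_stacks [w]) (gen_time (length w)) s' (gen_out w)"
proof -
  let ?n = "length w" and ?s = "input_stacks [w]"
  let ?s1 = "?s(0 := [], 2 := rev (word_syms w), 3 := replicate ?n 1)"
  let ?s2 = "?s(3 := replicate ?n 1)"
  have blank: "with_memory ?s2 blank_memory = ?s2"
    by (auto simp: blank_memory_def flag_def with_stacks_def fun_eq_iff)
  have copy: "run (copy_prog 0 2 3 (\<lambda>_. 1)) ?s (9 * ?n + 1) ?s1 []"
    by (intro run_copy[of _ _ "word_syms w"])
      (auto simp: with_stacks_def fun_eq_iff map_replicate_const)
  have restore: "run (move_prog 2 0) ?s1 (7 * ?n + 1) ?s2 []"
    by (intro run_move[of _ _ "rev (word_syms w)"]) (auto simp: with_stacks_def fun_eq_iff)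
  have rounds: "run (For 3 (\<lambda>_. round_prog)) ?s2 (?n * (32 * ?n + 10) + 1)
      (with_memory (?s2(3 := [])) ((exec_word w ^^ ?n) blank_memory))
      (map (\<lambda>i. accumulator ((exec_word w ^^ Suc i) blank_memory)) [0..<?n])"
    using run_rounds[of ?s2 w ?n blank_memory] unfolding blank by (simp add: with_stacks_def)
  have "run (For 3 (\<lambda>_. round_prog) ;; Emit True) ?s2 (?n * (32 * ?n + 10) + 1 + 1)
      (with_memory (?s2(3 := [])) ((exec_word w ^^ ?n) blank_memory)) (gen_out w)"
    by (rule run_SeqI[OF rounds run.Emit[OF order.refl]]) (simp_all add: gen_out_def)
  then show ?thesis
    unfolding gen_prog_def gen_time_def
    using run_SeqI_silent[OF copy run_SeqI_silent[OF restore]] by blast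
qed

lemma computes_gen_out: "\<exists>g. computes 1 (\<lambda>_. True) g (\<lambda>ws. gen_out (hd ws))"
proof (rule computes_prog)
  show "\<forall>\<^sub>F N in sequentially. wf_prog 1 N gen_prog"
    by (intro eventually_sequentiallyI[of 7])
      (simp add: gen_prog_def round_prog_def wf_For wf_copy_prog wf_move_prog
        wf_instr_prog[simplified])
  show "poly_bounded gen_time"
    unfolding gen_time_def by (intro poly_bounded_intros)
  show "\<exists>s'. run gen_prog (input_stacks ws) (gen_time (sum_list (map length ws))) s'
      (gen_out (hd ws))"
    if "length ws = 1" for ws
    using run_gen_prog[of "hd ws"] that by (cases ws) simp_all
qed simp

theorem generator_gen_out:
  obtains g where "generator g" "\<And>x. fun_of g [x] = num_of (gen_out (bits_of x))"
proof -
  obtain g where g: "computes 1 (\<lambda>_. True) g (\<lambda>ws. gen_out (hd ws))"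
    using computes_gen_out by blast
  then have fun_of: "fun_of g [x] = num_of (gen_out (bits_of x))" for x
    by (auto simp: computes_def fun_of_def)
  have "canonical (gen_out w)" and "length (gen_out w) = Suc (length w)" for w
    by (simp_all add: gen_out_def canonical_def)
  then have "len (fun_of g [x]) = Suc (len x)" for x
    by (simp add: fun_of len_num_of)
  then have "generator g"
    using g unfolding generator_def computes_def by (auto intro!: exI[of _ Suc])
  with fun_of show ?thesis by (intro that)
qed


section \<open>Circuits as input of the generator\<close>

primrec encode :: "oper \<Rightarrow> bool list"
  where
    "encode OpLeft = [False, False, False]"
  | "encode OpRight = [False, False, True]"
  | "encode OpLoad = [False, True, False]"
  | "encode OpAnd = [False, True, True]"
  | "encode OpOr = [True, False, False]"
  | "encode OpNot = [True, False, True]"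
  | "encode OpStore = [True, True, False]"
  | "encode OpNone = [True, True, True]"

definition encode_all :: "oper list \<Rightarrow> bool list"
  where "encode_all xs = concat (map encode xs)"

lemma exec_word_encode_all: "exec_word (encode_all xs @ w) \<mu> = exec_word w (fold apply_op xs \<mu>)"
proof (induction xs arbitrary: \<mu>)
  case (Cons x xs)
  then show ?case by (cases x) (auto simp: encode_all_def)
qed (simp add: encode_all_def)

lemma length_encode_all: "length (encode_all xs) = 3 * length xs"
proof (induction xs)
  case (Cons x xs)
  then show ?case by (cases x) (auto simp: encode_all_def)
qed (simp add: encode_all_def)

lemma exec_word_padding: "exec_word (replicate m True) \<mu> = \<mu>"
proof (induction m rule: less_induct)
  case (less m)
  have noop: "apply_op OpNone \<mu> = \<mu>"
    by (cases \<mu>) simp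
  consider "m = 0" | "m = 1" | "m = 2" | (instruction) k where "m = Suc (Suc (Suc k))"
    by (metis One_nat_def Suc_1 old.nat.exhaust)
  then show ?case
  proof cases
    case instruction
    then show ?thesis using less.IH[of k] noop by simp
  qed (simp_all add: numeral_2_eq_2)
qed


subsection \<open>Random access to the memory\<close>

datatype macro = Load nat | And nat | Or nat | Not | Store nat

fun exec_macro :: "macro \<Rightarrow> (nat \<Rightarrow> bool) \<times> bool \<Rightarrow> (nat \<Rightarrow> bool) \<times> bool"
  where
    "exec_macro (Load i) (f, a) = (f, f i)"
  | "exec_macro (And i) (f, a) = (f, a \<and> f i)"
  | "exec_macro (Or i) (f, a) = (f, a \<or> f i)"
  | "exec_macro Not (f, a) = (f, \<not> a)"
  | "exec_macro (Store i) (f, a) = (f(i := a), a)"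

definition at_cell :: "nat \<Rightarrow> oper \<Rightarrow> oper list"
  where "at_cell i x = replicate i OpRight @ [x] @ replicate i OpLeft"

fun assemble :: "macro \<Rightarrow> oper list"
  where
    "assemble (Load i) = at_cell i OpLoad"
  | "assemble (And i) = at_cell i OpAnd"
  | "assemble (Or i) = at_cell i OpOr"
  | "assemble Not = [OpNot]"
  | "assemble (Store i) = at_cell i OpStore"

definition assemble_all :: "macro list \<Rightarrow> oper list"
  where "assemble_all P = concat (map assemble P)"

definition mem :: "bool list \<Rightarrow> nat \<Rightarrow> bool"
  where "mem R i \<longleftrightarrow> i < length R \<and> R ! i"

definition padded :: "nat \<Rightarrow> bool list \<Rightarrow> bool list"
  where "padded i R = map (mem R) [0..<i]"

lemma length_padded [simp]: "length (padded i R) = i"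
  by (simp add: padded_def)

lemma head_bit_drop: "head_bit (drop i R) = mem R i"
  by (cases "i < length R") (auto simp: head_bit_def mem_def hd_drop_conv_nth)

lemma fold_OpRight:
  "fold apply_op (replicate i OpRight) (L, R, a) = (rev (padded i R) @ L, drop i R, a)"
proof (induction i)
  case (Suc i)
  have "fold apply_op (replicate (Suc i) OpRight) (L, R, a) =
      apply_op OpRight (fold apply_op (replicate i OpRight) (L, R, a))"
    by (simp add: replicate_append_same[symmetric] del: replicate.simps(2) fold_simps)
  then show ?case
    unfolding Suc by (simp add: padded_def head_bit_drop tl_drop drop_Suc)
qed (simp add: padded_def)

lemma fold_OpLeft:
  "fold apply_op (replicate (length P) OpLeft) (rev P @ L, R, a) = (L, P @ R, a)"
proof (induction P arbitrary: R rule: rev_induct)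
  case (snoc x P)
  then show ?case by (simp add: head_bit_def)
qed simp

lemma fold_at_cell:
  assumes "apply_op x (rev (padded i R), drop i R, a) = (rev (padded i R), R', a')"
  shows "fold apply_op (at_cell i x) ([], R, a) = ([], padded i R @ R', a')"
  using fold_OpRight[of i "[]" R a] fold_OpLeft[of "padded i R" "[]" R' a'] assms
  by (simp add: at_cell_def)

lemma mem_padded: "mem (padded i R @ drop i R) = mem R"
  by (auto simp: fun_eq_iff mem_def padded_def nth_append)

lemma mem_store: "mem (padded i R @ a # tl (drop i R)) = (mem R)(i := a)"
proof
  fix j
  consider "j < i" | "j = i" | k where "j = Suc (i + k)"
    by (metis less_imp_Suc_add linorder_cases)
  then show "mem (padded i R @ a # tl (drop i R)) j = ((mem R)(i := a)) j"
    by cases (auto simp: mem_def padded_def nth_append tl_drop[symmetric] nth_tl)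
qed

lemma fold_assemble:
  "\<exists>R'. fold apply_op (assemble x) ([], R, a) = ([], R', snd (exec_macro x (mem R, a))) \<and>
    mem R' = fst (exec_macro x (mem R, a))"
  by (cases x) (auto simp: fold_at_cell head_bit_drop mem_padded mem_store)

lemma fold_assemble_all:
  "\<exists>R'. fold apply_op (assemble_all P) ([], R, a) = ([], R', snd (fold exec_macro P (mem R, a))) \<and>
    mem R' = fst (fold exec_macro P (mem R, a))"
proof (induction P arbitrary: R a)
  case (Cons x P)
  obtain R' where "fold apply_op (assemble x) ([], R, a) = ([], R', snd (exec_macro x (mem R, a)))"
    and "mem R' = fst (exec_macro x (mem R, a))"
    using fold_assemble by blast
  with Cons.IH[of R' "snd (exec_macro x (mem R, a))"] show ?case
    by (simp add: assemble_all_def del: fun_upd_apply)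
qed (simp add: assemble_all_def)

lemma length_assemble_all:
  "(\<And>x. x \<in> set P \<Longrightarrow> length (assemble x) \<le> B) \<Longrightarrow> length (assemble_all P) \<le> length P * B"
  by (induction P) (auto simp: assemble_all_def add_mono)


subsection \<open>Evaluating a circuit at a counter\<close>

text \<open>
  Memory layout: the counter in cells \<open>0, \<dots>, n - 1\<close>, the carry in cell \<open>n\<close>, scratch in cells \<open>n + 1\<close>
  and \<open>n + 2\<close>, the value of gate \<open>j\<close> in cell \<open>n + 3 + j\<close>.
\<close>

fun gate_macros :: "nat \<Rightarrow> nat \<Rightarrow> gate \<Rightarrow> macro list"
  where
    "gate_macros n j (In_gate a) = [Load a, Store (n + 3 + j)]"
  | "gate_macros n j (Const_gate b) =
      [Load n, Not, Or n] @ (if b then [] else [Not]) @ [Store (n + 3 + j)]"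
  | "gate_macros n j (Not_gate a) = [Load (n + 3 + a), Not, Store (n + 3 + j)]"
  | "gate_macros n j (And_gate a b) = [Load (n + 3 + a), And (n + 3 + b), Store (n + 3 + j)]"
  | "gate_macros n j (Or_gate a b) = [Load (n + 3 + a), Or (n + 3 + b), Store (n + 3 + j)]"

definition gate_vals :: "circuit \<Rightarrow> bool list \<Rightarrow> bool list"
  where "gate_vals C w = foldl (\<lambda>vs g. vs @ [gate_val w vs g]) [] C"

lemma gate_vals_snoc: "gate_vals (C @ [g]) w = gate_vals C w @ [gate_val w (gate_vals C w) g]"
  by (simp add: gate_vals_def)

lemma length_gate_vals: "length (gate_vals C w) = length C"
  by (induction C rule: rev_induct) (auto simp: gate_vals_def)

lemma circuit_val_nth:
  assumes "C \<noteq> []"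
  shows "circuit_val C w = gate_vals C w ! (length C - 1)"
proof -
  have "gate_vals C w \<noteq> []"
    using assms length_gate_vals[of C w] by auto
  then show ?thesis
    by (simp add: circuit_val_def last_conv_nth length_gate_vals flip: gate_vals_def)
qed

definition circuit_macros :: "nat \<Rightarrow> circuit \<Rightarrow> macro list"
  where "circuit_macros n C = concat (map (\<lambda>j. gate_macros n j (C ! j)) [0..<length C])"

lemma circuit_macros_snoc:
  "circuit_macros n (C @ [g]) = circuit_macros n C @ gate_macros n (length C) g"
  by (auto simp: circuit_macros_def nth_append intro!: arg_cong[where f = concat])

lemma fold_gate_macros:
  assumes "gate_ok n j g" and "\<And>i. i < j \<Longrightarrow> f (n + 3 + i) = vs ! i" and "w = map f [0..<n]"
  shows "\<exists>a'. fold exec_macro (gate_macros n j g) (f, a) = (f(n + 3 + j := gate_val w vs g), a')"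
  using assms by (cases g) auto

lemma fold_circuit_macros:
  assumes "\<forall>i<length C. gate_ok n i (C ! i)" and "w = map f [0..<n]"
  shows "\<exists>f' a'. fold exec_macro (circuit_macros n C) (f, a) = (f', a') \<and>
    (\<forall>i<n. f' i = f i) \<and> (\<forall>j<length C. f' (n + 3 + j) = gate_vals C w ! j)"
  using assms(1)
proof (induction C rule: rev_induct)
  case Nil
  then show ?case by (simp add: circuit_macros_def)
next
  case (snoc g C)
  have "gate_ok n i (C ! i)" if "i < length C" for i
    using snoc.prems[rule_format, of i] that by (simp add: nth_append)
  with snoc.IH obtain f' a' where prefix: "fold exec_macro (circuit_macros n C) (f, a) = (f', a')"
    and inputs: "\<forall>i<n. f' i = f i" and gates: "\<forall>j<length C. f' (n + 3 + j) = gate_vals C w ! j"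
    by blast
  have "gate_ok n (length C) g"
    using snoc.prems[rule_format, of "length C"] by simp
  moreover have "w = map f' [0..<n]"
    using inputs assms(2) by simp
  ultimately obtain a'' where last: "fold exec_macro (circuit_macros n (C @ [g])) (f, a) =
      (f'(n + 3 + length C := gate_val w (gate_vals C w) g), a'')"
    using fold_gate_macros[of n "length C" g f' "gate_vals C w" w a'] prefix gates
    by (auto simp: circuit_macros_snoc)
  show ?case
    by (intro exI conjI, rule last)
      (use inputs gates in \<open>auto simp: gate_vals_snoc nth_append length_gate_vals less_Suc_eq\<close>)
qed

definition inc_step :: "nat \<Rightarrow> nat \<Rightarrow> macro list"
  where "inc_step n i = [Load i, And n, Store (n + 1), Not, Store (n + 2),
    Load i, Or n, And (n + 2), Store i, Load (n + 1), Store n]"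

definition inc_macros :: "nat \<Rightarrow> nat \<Rightarrow> macro list"
  where "inc_macros n m = [Load n, Not, Or n, Store n] @ concat (map (inc_step n) [0..<m])"

lemma fold_inc_step:
  assumes "i < n"
  shows "fold exec_macro (inc_step n i) (f, a) =
    (f(n + 1 := f i \<and> f n, n + 2 := \<not> (f i \<and> f n), i := f i \<noteq> f n, n := f i \<and> f n), f i \<and> f n)"
  using assms by (auto simp: inc_step_def fun_eq_iff)

lemma fold_inc_macros:
  assumes "m \<le> n"
  shows "\<exists>f' a'. fold exec_macro (inc_macros n m) (f, a) = (f', a') \<and>
    f' n = (\<forall>k<m. f k) \<and> (\<forall>j<n. f' j = (if j < m then f j \<noteq> (\<forall>k<j. f k) else f j)) \<and>
    (\<forall>j>n + 2. f' j = f j)"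
  using assms
proof (induction m)
  case 0
  then show ?case by (auto simp: inc_macros_def)
next
  case (Suc m)
  then obtain f' a' where prefix: "fold exec_macro (inc_macros n m) (f, a) = (f', a')"
    and carry: "f' n = (\<forall>k<m. f k)"
    and counter: "\<And>j. j < n \<Longrightarrow> f' j = (if j < m then f j \<noteq> (\<forall>k<j. f k) else f j)"
    and above: "\<And>j. n + 2 < j \<Longrightarrow> f' j = f j"
    by auto
  have m: "m < n" using Suc.prems by simp
  have "inc_macros n (Suc m) = inc_macros n m @ inc_step n m"
    by (simp add: inc_macros_def)
  then have step: "fold exec_macro (inc_macros n (Suc m)) (f, a) =
      fold exec_macro (inc_step n m) (f', a')"
    using prefix by simp
  show ?case
    unfolding step fold_inc_step[OF m]
    using carry counter above m by (auto simp: less_Suc_eq)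
qed

lemma bit_increment: "bit (v + 1) j \<longleftrightarrow> bit v j \<noteq> (\<forall>k<j. bit v k)" for v :: nat
proof (induction j arbitrary: v)
  case 0
  then show ?case by (simp add: bit_0)
next
  case (Suc j)
  have all: "(\<forall>k<Suc j. bit v k) \<longleftrightarrow> odd v \<and> (\<forall>k<j. bit (v div 2) k)"
    by (auto simp: bit_0 bit_Suc less_Suc_eq_0_disj all_simps)
  have "(v + 1) div 2 = (if odd v then v div 2 + 1 else v div 2)"
    by presburger
  then show ?case
    using Suc[of "v div 2"] all by (cases "odd v") (simp_all only: bit_Suc, auto)
qed

definition round_macros :: "nat \<Rightarrow> circuit \<Rightarrow> macro list"
  where "round_macros n C = circuit_macros n C @ inc_macros n n @ [Load (n + 3 + (length C - 1))]"

lemma fold_round_macros: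
  fixes v :: nat
  assumes C: "circuit n C" and f: "\<And>i. i < n \<Longrightarrow> f i = bit v i"
  shows "\<exists>f'. fold exec_macro (round_macros n C) (f, a) =
      (f', circuit_val C (map (bit v) [0..<n])) \<and> (\<forall>i<n. f' i = bit (v + 1) i)"
proof -
  let ?w = "map (bit v) [0..<n]"
  have ok: "\<forall>i<length C. gate_ok n i (C ! i)" "C \<noteq> []"
    using C by (auto simp: circuit_def)
  have "?w = map f [0..<n]"
    using f by auto
  then obtain f1 a1 where eval: "fold exec_macro (circuit_macros n C) (f, a) = (f1, a1)"
    and f1: "\<forall>i<n. f1 i = f i" "\<forall>j<length C. f1 (n + 3 + j) = gate_vals C ?w ! j"
    using fold_circuit_macros[OF ok(1)] by blast
  obtain f2 a2 where inc: "fold exec_macro (inc_macros n n) (f1, a1) = (f2, a2)"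
    and f2: "\<forall>j<n. f2 j = (f1 j \<noteq> (\<forall>k<j. f1 k))" "\<forall>j>n + 2. f2 j = f1 j"
    using fold_inc_macros[of n n f1 a1] by auto
  have "f2 (n + 3 + (length C - 1)) = circuit_val C ?w"
    using f1(2) f2(2) ok(2) by (simp add: circuit_val_nth)
  moreover have "\<forall>i<n. f2 i = bit (v + 1) i"
    unfolding bit_increment using f1(1) f2(1) f by auto
  ultimately show ?thesis
    using eval inc by (intro exI[of _ f2]) (simp add: round_macros_def)
qed

definition circuit_code :: "nat \<Rightarrow> circuit \<Rightarrow> bool list"
  where "circuit_code n C = encode_all (assemble_all (round_macros n C))"

lemma exec_circuit_code:
  fixes v :: nat
  assumes "circuit n C" and "\<And>i. i < n \<Longrightarrow> mem R i = bit v i"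
  shows "\<exists>R'. exec_word (circuit_code n C @ replicate m True) ([], R, a) =
      ([], R', circuit_val C (map (bit v) [0..<n])) \<and> (\<forall>i<n. mem R' i = bit (v + 1) i)"
proof -
  have "exec_word (circuit_code n C @ replicate m True) ([], R, a) =
      fold apply_op (assemble_all (round_macros n C)) ([], R, a)"
    by (simp add: circuit_code_def exec_word_encode_all exec_word_padding)
  with fold_assemble_all[of "round_macros n C" R a] fold_round_macros[OF assms(1), of "mem R" v a]
    assms(2)
  show ?thesis by auto
qed

lemma accumulator_circuit_code:
  assumes "circuit n C"
  defines "w \<equiv> \<lambda>m. circuit_code n C @ replicate m True"
  shows "accumulator ((exec_word (w m) ^^ Suc i) blank_memory) =
    circuit_val C (map (bit i) [0..<n])"
proof -
  have counter: "\<exists>R a. (exec_word (w m) ^^ i) blank_memory = ([], R, a) \<and> (\<forall>j<n. mem R j = bit i j)"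
    for i
  proof (induction i)
    case 0
    then show ?case by (auto simp: mem_def blank_memory_def)
  next
    case (Suc i)
    then obtain R a where
      "(exec_word (w m) ^^ i) blank_memory = ([], R, a)" "\<forall>j<n. mem R j = bit i j"
      by blast
    with exec_circuit_code[OF assms(1), of R i m a] show ?case
      by (auto simp: w_def)
  qed
  obtain R a where "(exec_word (w m) ^^ i) blank_memory = ([], R, a)" "\<forall>j<n. mem R j = bit i j"
    using counter by blast
  with exec_circuit_code[OF assms(1), of R i m a] show ?thesis
    by (auto simp: w_def)
qed

lemma gen_out_circuit_code:
  assumes "circuit n C" and "length (circuit_code n C) \<le> N"
  shows "gen_out (circuit_code n C @ replicate (N - length (circuit_code n C)) True) =
    map (\<lambda>i. circuit_val C (map (bit i) [0..<n])) [0..<N] @ [True]"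
  using assms(2) by (simp add: gen_out_def accumulator_circuit_code[OF assms(1)] del: funpow.simps)

lemma gen_out_surj:
  assumes C: "circuit n C" and len: "len y = Suc N" and short: "length (circuit_code n C) < N"
    and val: "\<And>i. i < N \<Longrightarrow> circuit_val C (map (bit i) [0..<n]) = bits_of y ! i"
  shows "\<exists>x. num_of (gen_out (bits_of x)) = y"
proof -
  define w where "w = circuit_code n C @ replicate (N - length (circuit_code n C)) True"
  have "canonical w"
    using short by (simp add: w_def canonical_def)
  have "bits_of y \<noteq> []"
    using len length_bits_of[of y] by (metis list.size(3) nat.distinct(1))
  then have "bits_of y = butlast (bits_of y) @ [True]"
    using canonical_bits_of[of y] append_butlast_last_id by (fastforce simp: canonical_def)
  moreover have "butlast (bits_of y) = map (\<lambda>i. circuit_val C (map (bit i) [0..<n])) [0..<N]"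
    by (rule nth_equalityI) (simp_all add: nth_butlast len val)
  ultimately have "gen_out w = bits_of y"
    using gen_out_circuit_code[OF C less_imp_le[OF short]] by (simp add: w_def)
  then have "num_of (gen_out (bits_of (num_of w))) = y"
    using \<open>canonical w\<close> by (simp add: bits_of_num_of)
  then show ?thesis ..
qed


subsection \<open>The length of the code\<close>

lemma length_assemble_round_macros:
  assumes "circuit n C" and "x \<in> set (round_macros n C)"
  shows "length (assemble x) \<le> 2 * (n + length C) + 7"
proof -
  have at_cell: "length (at_cell i x) = 2 * i + 1" for i x
    by (simp add: at_cell_def)
  have "length (assemble x) \<le> 2 * (n + length C) + 7"
    if "x \<in> set (gate_macros n j (C ! j))" "j < length C" for x j
  proof -
    have "gate_ok n j (C ! j)"
      using assms(1) that(2) by (simp add: circuit_def)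
    with that show ?thesis
      by (cases "C ! j") (auto simp: at_cell split: if_splits)
  qed
  then show ?thesis
    using assms
    by (auto simp: circuit_def round_macros_def circuit_macros_def inc_macros_def inc_step_def
        at_cell)
qed

lemma length_round_macros: "length (round_macros n C) \<le> 5 * length C + 11 * n + 5"
proof -
  have "length (gate_macros n j g) \<le> 5" for j g
    by (cases g) auto
  then have "length (concat (map (\<lambda>j. gate_macros n j (C ! j)) [0..<m])) \<le> 5 * m" for m
    by (induction m) (auto intro: add_mono simp: add.commute)
  moreover have "length (concat (map (inc_step n) [0..<m])) = 11 * m" for m
    by (induction m) (auto simp: inc_step_def)
  ultimately show ?thesis
    by (simp add: round_macros_def circuit_macros_def inc_macros_def)
qed

lemma length_circuit_code:
  assumes "circuit n C"
  shows "length (circuit_code n C) \<le> 3 * ((5 * length C + 11 * n + 5) * (2 * (n + length C) + 7))"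
proof -
  have "length (assemble_all (round_macros n C)) \<le>
      length (round_macros n C) * (2 * (n + length C) + 7)"
    by (intro length_assemble_all length_assemble_round_macros[OF assms])
  also have "\<dots> \<le> (5 * length C + 11 * n + 5) * (2 * (n + length C) + 7)"
    by (intro mult_le_mono1 length_round_macros)
  finally show ?thesis
    by (simp add: circuit_code_def length_encode_all)
qed

lemma eventually_circuit_code_short:
  assumes C: "\<And>n. circuit n (C n)" and size: "\<forall>\<^sub>F n in sequentially. length (C n) \<le> c * n ^ d"
    and "1 \<le> d"
  shows "\<forall>\<^sub>F n in sequentially. length (circuit_code n (C n)) < n ^ (2 * d + 1)"
proof -
  define K where "K = 3 * ((5 * c + 16) * (2 * c + 9))"
  from size eventually_gt_at_top[of K] show ?thesis
  proof eventually_elim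
    case (elim n)
    have pow: "1 \<le> n ^ d" "n \<le> n ^ d"
      using elim(2) \<open>1 \<le> d\<close> by (auto simp: self_le_power)
    have "5 * length (C n) + 11 * n + 5 \<le> (5 * c + 16) * n ^ d"
      and "2 * (n + length (C n)) + 7 \<le> (2 * c + 9) * n ^ d"
      using elim(1) pow unfolding add_mult_distrib add_mult_distrib2 mult.assoc by linarith+
    then have "3 * ((5 * length (C n) + 11 * n + 5) * (2 * (n + length (C n)) + 7)) \<le>
        3 * (((5 * c + 16) * n ^ d) * ((2 * c + 9) * n ^ d))"
      by (intro mult_le_mono order.refl)
    also have "\<dots> = K * n ^ (2 * d)"
      unfolding K_def mult_2[of d] power_add by (simp only: mult_ac)
    also have "\<dots> < n ^ (2 * d + 1)"
      using elim(2) pow by simp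
    finally show ?case
      using length_circuit_code[OF C[of n]] by linarith
  qed
qed

lemma SIZE_O_circuits:
  assumes "L \<in> SIZE_O d"
  obtains C c where "\<And>n. circuit n (C n)" "\<And>w. circuit_val (C (length w)) w \<longleftrightarrow> w \<in> L"
    "\<forall>\<^sub>F n in sequentially. length (C n) \<le> c * n ^ d"
proof -
  obtain C where C: "\<And>n. circuit n (C n)" "\<And>w. circuit_val (C (length w)) w \<longleftrightarrow> w \<in> L"
    and O: "(\<lambda>n. real (length (C n))) \<in> O(\<lambda>n. real n ^ d)"
    using assms unfolding SIZE_O_def by blast
  from O obtain c where "\<forall>\<^sub>F n in sequentially. norm (real (length (C n))) \<le> c * norm (real n ^ d)"
    by (elim landau_o.bigE)
  then have "\<forall>\<^sub>F n in sequentially. length (C n) \<le> nat \<lceil>c\<rceil> * n ^ d"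
  proof eventually_elim
    case (elim n)
    have "real (length (C n)) \<le> c * real (n ^ d)"
      using elim by simp
    also have "\<dots> \<le> real (nat \<lceil>c\<rceil>) * real (n ^ d)"
      by (intro mult_right_mono) linarith+
    finally have "real (length (C n)) \<le> real (nat \<lceil>c\<rceil> * n ^ d)"
      by simp
    then show ?case by linarith
  qed
  with C show ?thesis by (rule that)
qed

theorem gen_out_hits_long_values:
  assumes H: "class_P \<subseteq> SIZE_O d" and "1 \<le> d" and t: "PV_trm t"
  shows "\<forall>\<^sub>F n in sequentially. n ^ (2 * d + 1) < len (term_at t n) \<longrightarrow>
    (\<exists>x. num_of (gen_out (bits_of x)) = term_at t n)"
proof -
  have "bit_language t \<in> SIZE_O d"
    using H bit_language_in_P[OF t] by blast
  then obtain C c where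
    C: "\<And>n. circuit n (C n)" "\<And>w. circuit_val (C (length w)) w \<longleftrightarrow> w \<in> bit_language t"
    and size: "\<forall>\<^sub>F n in sequentially. length (C n) \<le> c * n ^ d"
    by (rule SIZE_O_circuits) (rule that)
  have "poly_bounded (\<lambda>n. eval_time t (Suc n))"
    by (intro poly_bounded_compose[OF poly_bounded_eval_time] poly_bounded_intros)
  from poly_bounded_eventually_less_two_power[OF this]
    eventually_circuit_code_short[OF C(1) size \<open>1 \<le> d\<close>]
  show ?thesis
  proof eventually_elim
    case (elim n)
    show ?case
    proof
      let ?y = "term_at t n"
      assume long: "n ^ (2 * d + 1) < len ?y"
      then have N: "len ?y = Suc (len ?y - 1)"
        and short: "length (circuit_code n (C n)) < len ?y - 1"
        using elim(2) by linarith+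
      have "circuit_val (C n) (map (bit i) [0..<n]) = bits_of ?y ! i" if "i < len ?y - 1" for i
      proof -
        have "i < 2 ^ n" "i < len ?y"
          using that len_term_at_le[OF t, of n] elim(1) by linarith+
        then show ?thesis
          using C(2)[of "map (bit i) [0..<n]"] by (simp add: bit_language_def num_of_map_bit)
      qed
      then show "\<exists>x. num_of (gen_out (bits_of x)) = ?y"
        by (rule gen_out_surj[OF C(1) N short])
    qed
  qed
qed


section \<open>Formulas in the standard model\<close>

definition decides :: "nat \<Rightarrow> machine \<Rightarrow> (nat list \<Rightarrow> bool) \<Rightarrow> bool"
  where "decides k M R \<longleftrightarrow> computes_num k M (\<lambda>xs. of_bool (R xs))"

lemma decides_char_sym: "\<exists>M. decides k M R \<Longrightarrow> decides k (char_sym k R) R"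
  using someI_ex[of "\<lambda>M. clocked_machine M \<and> inputs M = k \<and>
    (\<forall>xs. length xs = k \<longrightarrow> fun_of M xs = of_bool (R xs))"]
  by (simp add: decides_def computes_num_def char_sym_def)

lemma decides_True: "1 \<le> k \<Longrightarrow> decides k (char_sym k (\<lambda>_. True)) (\<lambda>_. True)"
  using computes_const[of k 1] by (intro decides_char_sym) (simp add: decides_def)

lemma decides_less: "decides 2 (char_sym 2 (\<lambda>xs. xs ! 0 < xs ! 1)) (\<lambda>xs. xs ! 0 < xs ! 1)"
  using computes_less by (intro decides_char_sym) (simp add: decides_def)

text \<open>The value of \<open>pow_trm m x c\<close> has length \<open>|x| ^ (c + 1)\<close> if \<open>m\<close> multiplies lengths.\<close>

primrec pow_trm :: "machine \<Rightarrow> nat \<Rightarrow> nat \<Rightarrow> machine trm"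
  where
    "pow_trm m x 0 = Var x"
  | "pow_trm m x (Suc c) = Fn m [Var x, pow_trm m x c]"

lemma pow_trm:
  assumes "computes_num 2 m (\<lambda>xs. num_of (replicate (len (xs ! 0) * len (xs ! 1)) True))"
  shows "PV_trm (pow_trm m x c)" and "tvars (pow_trm m x c) = {x}"
    and "len (std_val e (pow_trm m x c)) = len (e x) ^ Suc c"
  using assms by (induction c) (auto simp: computes_num_def standard_model_def len_ones)

lemma decides_len_le_pow:
  assumes "1 \<le> c"
  defines "R \<equiv> \<lambda>xs. len (xs ! 0) \<le> len (xs ! 1) ^ c"
  shows "decides 2 (char_sym 2 R) R"
proof (rule decides_char_sym)
  obtain l where l: "computes_num 2 l (\<lambda>xs. of_bool (len (xs ! 0) \<le> len (xs ! 1)))"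
    using computes_len_le by blast
  obtain m where m: "computes_num 2 m (\<lambda>xs. num_of (replicate (len (xs ! 0) * len (xs ! 1)) True))"
    using computes_len_mult by blast
  let ?t = "Fn l [Var 0, pow_trm m 1 (c - 1)]"
  have "PV_trm ?t" "tvars ?t \<subseteq> {..<2}"
    using l pow_trm[OF m] by (auto simp: computes_num_def)
  then obtain M where M: "computes_num 2 M (\<lambda>xs. std_val (\<lambda>i. xs ! i) ?t)"
    using computes_term[of ?t 2] by auto
  have "std_val e ?t = of_bool (len (e 0) \<le> len (e 1) ^ c)" for e
  proof -
    have "std_val e ?t = fun_of l [e 0, std_val e (pow_trm m 1 (c - 1))]"
      by (simp add: standard_model_def)
    also have "\<dots> = of_bool (len (e 0) \<le> len (e 1) ^ Suc (c - 1))"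
      using l pow_trm(3)[OF m, of e 1 "c - 1"] by (simp add: computes_num_def)
    finally show ?thesis using assms(1) by simp
  qed
  with M show "\<exists>M. decides 2 M R"
    by (auto simp: decides_def R_def)
qed

lemma open_Rel [simp]: "open_fm (Rel R ts)"
  by (simp add: Rel_def)

lemma fvars_Rel [simp]: "fvars (Rel R ts) = (\<Union>t\<in>set ts. tvars t)"
  by (simp add: Rel_def)

lemma Rel_standard:
  assumes "decides (length ts) (char_sym (length ts) R) R" and "\<forall>t\<in>set ts. PV_trm t" and "ts \<noteq> []"
  shows "PV_fm (Rel R ts)" and "sat standard_model e (Rel R ts) \<longleftrightarrow> R (map (std_val e) ts)"
proof -
  have "1 \<le> length ts" using assms(3) by (simp add: Suc_leI)
  from decides_True[OF this] assms(1,2)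
  show "PV_fm (Rel R ts)" and "sat standard_model e (Rel R ts) \<longleftrightarrow> R (map (std_val e) ts)"
    by (auto simp: Rel_def decides_def computes_num_def standard_model_def)
qed

lemma open_Less [simp]: "open_fm (Less t u)"
  and fvars_Less [simp]: "fvars (Less t u) = tvars t \<union> tvars u"
  by (simp_all add: Less_def)

lemma Less_standard:
  assumes "PV_trm t" and "PV_trm u"
  shows "PV_fm (Less t u)" and "sat standard_model e (Less t u) \<longleftrightarrow> std_val e t < std_val e u"
  unfolding Less_def using Rel_standard[of "[t, u]"] decides_less assms
  by (simp_all add: numeral_2_eq_2)

lemma open_Len_le_pow [simp]: "open_fm (Len_le_pow c t u)"
  and fvars_Len_le_pow [simp]: "fvars (Len_le_pow c t u) = tvars t \<union> tvars u"
  by (simp_all add: Len_le_pow_def)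

lemma Len_le_pow_standard:
  assumes "1 \<le> c" and "PV_trm t" and "PV_trm u"
  shows "PV_fm (Len_le_pow c t u)"
    and "sat standard_model e (Len_le_pow c t u) \<longleftrightarrow> len (std_val e t) \<le> len (std_val e u) ^ c"
  unfolding Len_le_pow_def
  using Rel_standard[of "[t, u]"] decides_len_le_pow[OF assms(1)] assms(2,3)
  by (simp_all add: numeral_2_eq_2)


subsection \<open>Substitution, free variables and truth\<close>

lemma tval_tsubst: "tval S e (tsubst \<sigma> t) = tval S (\<lambda>x. tval S e (\<sigma> x)) t"
proof (induction t)
  case (Fn f ts)
  then have "map (tval S e \<circ> tsubst \<sigma>) ts = map (tval S (\<lambda>x. tval S e (\<sigma> x))) ts" by auto
  then show ?case by (simp only: tsubst.simps tval.simps map_map)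
qed simp

lemma sat_subst: "open_fm \<phi> \<Longrightarrow> sat S e (subst \<sigma> \<phi>) \<longleftrightarrow> sat S (\<lambda>x. tval S e (\<sigma> x)) \<phi>"
  by (induction \<phi>) (auto simp: tval_tsubst)

lemma open_subst: "open_fm \<phi> \<Longrightarrow> open_fm (subst \<sigma> \<phi>)"
  by (induction \<phi>) auto

lemma tvars_tsubst: "tvars (tsubst \<sigma> t) = (\<Union>x\<in>tvars t. tvars (\<sigma> x))"
  by (induction t) auto

lemma fvars_subst: "open_fm \<phi> \<Longrightarrow> fvars (subst \<sigma> \<phi>) = (\<Union>x\<in>fvars \<phi>. tvars (\<sigma> x))"
  by (induction \<phi>) (auto simp: tvars_tsubst)

lemma PV_tsubst: "PV_trm t \<Longrightarrow> (\<And>x. PV_trm (\<sigma> x)) \<Longrightarrow> PV_trm (tsubst \<sigma> t)"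
  by (induction t) auto

lemma PV_subst: "open_fm \<phi> \<Longrightarrow> PV_fm \<phi> \<Longrightarrow> (\<And>x. PV_trm (\<sigma> x)) \<Longrightarrow> PV_fm (subst \<sigma> \<phi>)"
  by (induction \<phi>) (auto simp: PV_tsubst)

lemma finite_tvars: "finite (tvars t)"
  by (induction t) auto

lemma finite_fvars: "finite (fvars \<phi>)"
  by (induction \<phi>) (auto simp: finite_tvars)

lemma sat_cong: "(\<And>x. x \<in> fvars \<phi> \<Longrightarrow> e x = e' x) \<Longrightarrow> sat S e \<phi> \<longleftrightarrow> sat S e' \<phi>"
proof (induction \<phi> arbitrary: e e')
  case (Eq t u)
  then have "tval S e t = tval S e' t" "tval S e u = tval S e' u"
    by (auto intro!: tval_cong)
  then show ?case by simp
next
  case (Neg \<phi>)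
  show ?case using Neg.IH[of e e'] Neg.prems by simp
next
  case (Conj \<phi> \<psi>)
  show ?case using Conj.IH[of e e'] Conj.prems by simp
next
  case (Disj \<phi> \<psi>)
  show ?case using Disj.IH[of e e'] Disj.prems by simp
next
  case (Imp \<phi> \<psi>)
  show ?case using Imp.IH[of e e'] Imp.prems by simp
next
  case (All x \<phi>)
  have "sat S (e(x := a)) \<phi> \<longleftrightarrow> sat S (e'(x := a)) \<phi>" for a
    using All.prems by (intro All.IH) simp
  then show ?case by simp
next
  case (Ex x \<phi>)
  have "sat S (e(x := a)) \<phi> \<longleftrightarrow> sat S (e'(x := a)) \<phi>" for a
    using Ex.prems by (intro Ex.IH) simp
  then show ?case by simp
qed

lemma tval_in_univ:
  assumes "PV_structure S" and "range e \<subseteq> univ S" and "PV_trm t"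
  shows "tval S e t \<in> univ S"
  using assms(3)
proof (induction t)
  case (Fn M ts)
  then have "set (map (tval S e) ts) \<subseteq> univ S" by auto
  with Fn.prems assms(1) show ?case by (simp add: PV_structure_def)
qed (use assms(2) in auto)

lemma models_sentence:
  assumes "fvars \<phi> = {}" and "range e \<subseteq> univ S"
  shows "S \<Turnstile> \<phi> \<longleftrightarrow> sat S e \<phi>"
  using assms sat_cong[of \<phi> _ _ S] unfolding models_def by blast

lemma models_Imp_NegI:
  fixes S :: "('f, 'u) struct"
  assumes "fvars \<phi> = {}" and "fvars \<psi> = {}" and "S \<Turnstile> \<phi> \<Longrightarrow> \<not> S \<Turnstile> \<psi>"
  shows "S \<Turnstile> Imp \<phi> (Neg \<psi>)"
  unfolding models_def
proof (intro allI impI)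
  fix e :: "nat \<Rightarrow> 'u" assume "range e \<subseteq> univ S"
  then show "sat S e (Imp \<phi> (Neg \<psi>))"
    using assms by (simp add: models_sentence)
qed

lemma models_All:
  fixes S :: "('f, 'u) struct"
  shows "S \<Turnstile> All x \<phi> \<longleftrightarrow> S \<Turnstile> \<phi>"
proof
  assume all: "S \<Turnstile> All x \<phi>"
  show "S \<Turnstile> \<phi>"
    unfolding models_def
  proof (intro allI impI)
    fix e :: "nat \<Rightarrow> 'u" assume e: "range e \<subseteq> univ S"
    then have "sat S (e(x := e x)) \<phi>"
      using all unfolding models_def sat.simps by blast
    then show "sat S e \<phi>" by simp
  qed
next
  assume "S \<Turnstile> \<phi>"
  then show "S \<Turnstile> All x \<phi>"
    unfolding models_def by (auto simp: image_subset_iff)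
qed

lemma models_foldr_All: "S \<Turnstile> foldr All xs \<phi> \<longleftrightarrow> S \<Turnstile> \<phi>"
  by (induction xs) (simp_all add: models_All)


subsection \<open>Membership in an NP set\<close>

definition np_mem :: "np_set \<Rightarrow> nat \<Rightarrow> bool"
  where "np_mem A y \<longleftrightarrow> sat standard_model (\<lambda>_. y) (Mem A)"

lemma np_memI:
  assumes A: "NP_set (c, A0)" and "sat standard_model e (Len_le_pow c (Var 2) (Var 1))"
    and "sat standard_model e A0"
  shows "np_mem (c, A0) (e 1)"
proof -
  let ?\<phi> = "Conj (Len_le_pow c (Var 2) (Var 1)) A0"
  have "fvars ?\<phi> \<subseteq> {1, 2}"
    using A by auto
  then have "sat standard_model ((\<lambda>_. e 1)(2 := e 2)) ?\<phi> \<longleftrightarrow> sat standard_model e ?\<phi>"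
    by (intro sat_cong) auto
  then show ?thesis
    using assms(2,3) by (auto simp: np_mem_def standard_model_def)
qed

definition disjoint_matrix :: "machine \<Rightarrow> np_set \<Rightarrow> machine fm"
  where "disjoint_matrix g = (\<lambda>(c, A0). Neg (subst (Var(1 := Fn g [Var 0]))
    (Conj (Len_le_pow c (Var 2) (Var 1)) A0)))"

lemma Rng_disjoint_eq: "Rng_disjoint g A = foldr All [0, 2] (disjoint_matrix g A)"
  by (cases A) (simp add: disjoint_matrix_def Let_def Len_le_pow_def Rel_def)

lemma disjoint_matrix:
  assumes "NP_set A" and "clocked_machine g" and "inputs g = 1"
  shows "open_fm (disjoint_matrix g A)" and "PV_fm (disjoint_matrix g A)"
    and "fvars (disjoint_matrix g A) \<subseteq> {0, 2}"
proof -
  obtain c A0 where A: "A = (c, A0)" by (cases A)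
  let ?\<phi> = "Conj (Len_le_pow c (Var 2) (Var 1)) A0"
  have \<phi>: "open_fm ?\<phi>" "PV_fm ?\<phi>" "fvars ?\<phi> \<subseteq> {1, 2}"
    using assms(1) by (auto simp: A Len_le_pow_standard)
  have matrix: "disjoint_matrix g A = Neg (subst (Var(1 := Fn g [Var 0])) ?\<phi>)"
    by (simp add: disjoint_matrix_def A)
  show "open_fm (disjoint_matrix g A)"
    using open_subst[OF \<phi>(1)] unfolding matrix open_fm.simps .
  show "PV_fm (disjoint_matrix g A)"
    using PV_subst[OF \<phi>(1,2)] assms(2,3) unfolding matrix by simp
  show "fvars (disjoint_matrix g A) \<subseteq> {0, 2}"
    using \<phi>(3) unfolding matrix fvars.simps fvars_subst[OF \<phi>(1)] by (auto split: if_splits)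
qed

lemma fvars_Rng_disjoint:
  assumes "NP_set A" and "clocked_machine g" and "inputs g = 1"
  shows "fvars (Rng_disjoint g A) = {}"
  using disjoint_matrix(3)[OF assms] by (auto simp: Rng_disjoint_eq)

lemma disjoint_matrix_standard:
  assumes A: "NP_set A" and disjoint: "standard_model \<Turnstile> disjoint_matrix g A"
  shows "\<not> np_mem A (fun_of g [x])"
proof
  obtain c A0 where Ac: "A = (c, A0)" by (cases A)
  let ?\<phi> = "Conj (Len_le_pow c (Var 2) (Var 1)) A0" and ?\<sigma> = "Var(1 := Fn g [Var 0])"
  assume "np_mem A (fun_of g [x])"
  then obtain z where z: "sat standard_model ((\<lambda>_. fun_of g [x])(2 := z)) ?\<phi>"
    by (auto simp: np_mem_def Ac)
  let ?e = "(\<lambda>_. x)(2 := z)"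
  have "sat standard_model (\<lambda>i. std_val ?e (?\<sigma> i)) ?\<phi> \<longleftrightarrow>
      sat standard_model ((\<lambda>_. fun_of g [x])(2 := z)) ?\<phi>"
    using A by (intro sat_cong) (auto simp: Ac standard_model_def)
  with z have "sat standard_model ?e (subst ?\<sigma> ?\<phi>)"
    using A by (subst sat_subst) (simp_all add: Ac)
  moreover have "sat standard_model ?e (disjoint_matrix g A)"
    using disjoint by (simp add: models_def standard_model_def)
  ultimately show False
    by (simp add: disjoint_matrix_def Ac)
qed

lemma fvars_Inf_fm: "NP_set A \<Longrightarrow> fvars (Inf_fm A) = {}"
  by (cases A) (auto simp: Inf_fm_def)


section \<open>The model\<close>

subsection \<open>Subsequences that decide countably many properties\<close>

lemma subseq_decides_one:
  obtains r :: "nat \<Rightarrow> nat" where "strict_mono r" "(\<forall>n. P (r n)) \<or> (\<forall>n. \<not> P (r n))"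
proof -
  have "{n. P n} \<union> {n. \<not> P n} = (UNIV :: nat set)" by auto
  then have "infinite {n. P n} \<or> infinite {n. \<not> P n}"
    by (metis finite_UnI infinite_UNIV_nat)
  then obtain r :: "nat \<Rightarrow> nat" where "strict_mono r" "(\<forall>n. r n \<in> {n. P n}) \<or> (\<forall>n. r n \<in> {n. \<not> P n})"
    using infinite_enumerate by metis
  then show ?thesis by (intro that) auto
qed

lemma subseq_decides:
  fixes P :: "'i::countable \<Rightarrow> nat \<Rightarrow> bool"
  obtains r :: "nat \<Rightarrow> nat" where "strict_mono r"
    "\<And>i. (\<forall>\<^sub>F n in sequentially. P i (r n)) \<or> (\<forall>\<^sub>F n in sequentially. \<not> P i (r n))"
proof -
  define Q where "Q k s \<longleftrightarrow> (\<forall>n. P (from_nat k) (s n)) \<or> (\<forall>n. \<not> P (from_nat k) (s n))"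
    for k and s :: "nat \<Rightarrow> nat"
  interpret subseqs Q
  proof
    fix k and s :: "nat \<Rightarrow> nat"
    show "\<exists>r. strict_mono r \<and> Q k (s \<circ> r)"
      by (rule subseq_decides_one[of "\<lambda>n. P (from_nat k) (s n)"]) (auto simp: Q_def)
  qed
  have tail: "\<forall>\<^sub>F n in sequentially. R (diagseq n)" if "\<forall>n. R (diagseq (Suc k + n))" for R k
    using that by (metis eventually_sequentiallyI le_add_diff_inverse)
  have "Q k (diagseq \<circ> (+) (Suc k))" for k
    by (rule diagseq_holds) (auto simp: Q_def)
  then have "Q (to_nat i) (diagseq \<circ> (+) (Suc (to_nat i)))" for i :: 'i
    by blast
  then have "(\<forall>\<^sub>F n in sequentially. P i (diagseq n)) \<or> (\<forall>\<^sub>F n in sequentially. \<not> P i (diagseq n))"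
    for i
    using tail[of "P i" "to_nat i"] tail[of "\<lambda>n. \<not> P i n" "to_nat i"] by (auto simp: Q_def)
  with subseq_diagseq show ?thesis by (rule that)
qed


subsection \<open>Terms modulo eventual equality along a subsequence\<close>

instance move :: countable
  by countable_datatype

instance machine_ext :: (countable) countable
  by (rule countable_classI[of
        "\<lambda>m. to_nat (inputs m, tapes m, table m, clock_exp m, machine.more m)"]) auto

instance trm :: (countable) countable
  by countable_datatype

abbreviation (input) term_of :: "nat \<Rightarrow> machine trm"
  where "term_of \<equiv> from_nat"

locale decided_subsequence =
  fixes r :: "nat \<Rightarrow> nat"
  assumes strict_mono: "strict_mono r"
    and decided: "(\<forall>\<^sub>F n in sequentially. term_at t (r n) = term_at u (r n)) \<or>
      (\<forall>\<^sub>F n in sequentially. term_at t (r n) \<noteq> term_at u (r n))"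
begin

definition eqv :: "machine trm \<Rightarrow> machine trm \<Rightarrow> bool"
  where "eqv t u \<longleftrightarrow> (\<forall>\<^sub>F n in sequentially. term_at t (r n) = term_at u (r n))"

lemma eqv_sym: "eqv t u \<Longrightarrow> eqv u t"
  by (simp add: eqv_def eq_commute)

lemma eqv_trans: "eqv t u \<Longrightarrow> eqv u v \<Longrightarrow> eqv t v"
  unfolding eqv_def by (auto elim: eventually_elim2)

definition code :: "machine trm \<Rightarrow> nat"
  where "code t = to_nat (SOME u. PV_trm u \<and> eqv u t)"

lemma term_of_code:
  assumes "PV_trm t"
  shows "PV_trm (term_of (code t))" and "eqv (term_of (code t)) t"
proof -
  have "\<exists>u. PV_trm u \<and> eqv u t"
    using assms by (intro exI[of _ t]) (simp add: eqv_def)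
  from someI_ex[OF this] show "PV_trm (term_of (code t))" and "eqv (term_of (code t)) t"
    by (simp_all add: code_def)
qed

lemma code_eqI: "eqv t u \<Longrightarrow> code t = code u"
  unfolding code_def by (metis eqv_sym eqv_trans)

definition model :: "(machine, nat) struct"
  where "model = \<lparr>univ = code ` {t. PV_trm t}, interp = (\<lambda>M ks. code (Fn M (map term_of ks)))\<rparr>"

lemma code_in_univ: "PV_trm t \<Longrightarrow> code t \<in> univ model"
  by (simp add: model_def)

lemma PV_term_of: "k \<in> univ model \<Longrightarrow> PV_trm (term_of k)"
  by (auto simp: model_def term_of_code)

lemma univ_eqI: "k \<in> univ model \<Longrightarrow> l \<in> univ model \<Longrightarrow> eqv (term_of k) (term_of l) \<Longrightarrow> k = l"
  by (auto simp: model_def intro!: code_eqI) (metis eqv_sym eqv_trans term_of_code(2))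

lemma PV_structure_model: "PV_structure model"
proof -
  have "univ model \<noteq> {}"
    using code_in_univ[of "Var 0"] by auto
  moreover have "interp model M ks \<in> univ model"
    if "clocked_machine M" "length ks = inputs M" "set ks \<subseteq> univ model" for M ks
  proof -
    have "PV_trm (Fn M (map term_of ks))"
      using that PV_term_of by auto
    then show ?thesis by (simp add: model_def)
  qed
  ultimately show ?thesis
    by (simp add: PV_structure_def)
qed

definition value_at :: "(nat \<Rightarrow> nat) \<Rightarrow> nat \<Rightarrow> nat \<Rightarrow> nat"
  where "value_at e n x = term_at (term_of (e x)) (r n)"

lemma tval_model:
  assumes "PV_trm t" and e: "range e \<subseteq> univ model"
  shows "\<forall>\<^sub>F n in sequentially. term_at (term_of (tval model e t)) (r n) = std_val (value_at e n) t"
  using assms(1)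
proof (induction t)
  case (Fn M ts)
  let ?us = "map (\<lambda>t. term_of (tval model e t)) ts"
  let ?vals = "\<lambda>n. map (\<lambda>t. term_at (term_of (tval model e t)) (r n)) ts"
  have "PV_trm (Fn M ?us)"
    using Fn.prems PV_term_of tval_in_univ[OF PV_structure_model e] by auto
  then have "eqv (term_of (tval model e (Fn M ts))) (Fn M ?us)"
    using term_of_code(2) by (simp add: model_def comp_def)
  moreover have "\<forall>\<^sub>F n in sequentially. \<forall>t\<in>set ts.
      term_at (term_of (tval model e t)) (r n) = std_val (value_at e n) t"
    using Fn by (intro eventually_ball_finite) auto
  ultimately show ?case
    unfolding eqv_def
  proof eventually_elim
    case (elim n)
    from elim(2) have "?vals n = map (std_val (value_at e n)) ts"
      by simp
    moreover have "term_at (Fn M ?us) (r n) = fun_of M (?vals n)"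
      by (simp add: term_at_def comp_def standard_model_def)
    ultimately have "term_at (Fn M ?us) (r n) = std_val (value_at e n) (Fn M ts)"
      by (simp only: tval.simps) (simp add: standard_model_def)
    with elim(1) show ?case by simp
  qed
qed (simp add: value_at_def)

lemma sat_model:
  assumes "open_fm \<phi>" and "PV_fm \<phi>" and e: "range e \<subseteq> univ model"
  shows "\<forall>\<^sub>F n in sequentially. sat model e \<phi> \<longleftrightarrow> sat standard_model (value_at e n) \<phi>"
  using assms(1,2)
proof (induction \<phi>)
  case (Eq t u)
  let ?k = "tval model e t" and ?l = "tval model e u"
  have "\<forall>\<^sub>F n in sequentially. ?k = ?l \<longleftrightarrow> term_at (term_of ?k) (r n) = term_at (term_of ?l) (r n)"
  proof (cases "?k = ?l")
    case False
    then have "\<not> eqv (term_of ?k) (term_of ?l)"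
      using Eq.prems univ_eqI tval_in_univ[OF PV_structure_model e] by auto
    then have "\<forall>\<^sub>F n in sequentially. term_at (term_of ?k) (r n) \<noteq> term_at (term_of ?l) (r n)"
      using decided unfolding eqv_def by blast
    then show ?thesis by eventually_elim (use False in simp)
  qed simp
  moreover have "\<forall>\<^sub>F n in sequentially. term_at (term_of ?k) (r n) = std_val (value_at e n) t"
    "\<forall>\<^sub>F n in sequentially. term_at (term_of ?l) (r n) = std_val (value_at e n) u"
    using Eq.prems e by (auto intro: tval_model)
  ultimately show ?case by eventually_elim simp
next
  case (Neg \<phi>)
  then have "\<forall>\<^sub>F n in sequentially. sat model e \<phi> \<longleftrightarrow> sat standard_model (value_at e n) \<phi>" by simp
  then show ?case by eventually_elim simp
qed (auto elim: eventually_elim2)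

lemma numeral_in_model:
  obtains k where "k \<in> univ model" "\<forall>\<^sub>F n in sequentially. term_at (term_of k) (r n) = c"
proof -
  obtain m where m: "computes_num 1 m (\<lambda>_. c)"
    using computes_const[of 1 c] by auto
  then have PV: "PV_trm (Fn m [Var 0])"
    by (simp add: computes_num_def)
  have "\<forall>\<^sub>F n in sequentially. term_at (term_of (code (Fn m [Var 0]))) (r n) = c"
    using term_of_code(2)[OF PV] m
    by (simp add: eqv_def term_at_def standard_model_def computes_num_def)
  with code_in_univ[OF PV] show ?thesis by (rule that)
qed

lemma models_open_iff_standard:
  assumes \<phi>: "open_fm \<phi>" "PV_fm \<phi>"
  shows "model \<Turnstile> \<phi> \<longleftrightarrow> standard_model \<Turnstile> \<phi>"
proof
  assume model: "model \<Turnstile> \<phi>"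
  have "sat standard_model e \<phi>" for e
  proof -
    from numeral_in_model
    have "\<exists>k. k \<in> univ model \<and> (\<forall>\<^sub>F n in sequentially. term_at (term_of k) (r n) = e x)" for x
      by metis
    then obtain e' where e': "\<And>x. e' x \<in> univ model"
      "\<And>x. \<forall>\<^sub>F n in sequentially. term_at (term_of (e' x)) (r n) = e x" by metis
    have range: "range e' \<subseteq> univ model" using e'(1) by auto
    have "\<forall>\<^sub>F n in sequentially. \<forall>x\<in>fvars \<phi>. value_at e' n x = e x"
      unfolding value_at_def by (intro eventually_ball_finite ballI e'(2) finite_fvars)
    with sat_model[OF \<phi> range] have "\<forall>\<^sub>F n in sequentially. sat standard_model e \<phi>"
    proof eventually_elim
      case (elim n)
      then show ?case
        using model range sat_cong[of \<phi> "value_at e' n" e standard_model] by (auto simp: models_def)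
    qed
    then show ?thesis by simp
  qed
  then show "standard_model \<Turnstile> \<phi>" by (simp add: models_def)
next
  assume std: "standard_model \<Turnstile> \<phi>"
  show "model \<Turnstile> \<phi>"
    unfolding models_def
  proof (intro allI impI)
    fix e :: "nat \<Rightarrow> nat" assume "range e \<subseteq> univ model"
    from sat_model[OF \<phi> this] have "\<forall>\<^sub>F n in sequentially. sat model e \<phi>"
      by eventually_elim (use std in \<open>simp add: models_def standard_model_def\<close>)
    then show "sat model e \<phi>" by simp
  qed
qed

lemma T_PV_model_model: "T_PV_model model"
  unfolding T_PV_model_def
proof (intro conjI ballI PV_structure_model)
  fix \<phi> assume "\<phi> \<in> T_PV"
  then obtain xs \<psi> where \<psi>: "open_fm \<psi>" "\<phi> = foldr All xs \<psi>" and \<phi>: "PV_fm \<phi>" "standard_model \<Turnstile> \<phi>"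
    by (auto simp: T_PV_def universal_sentence_def)
  have "PV_fm \<psi>"
    using \<phi>(1) unfolding \<psi>(2) by (induction xs) auto
  with \<psi> \<phi>(2) show "model \<Turnstile> \<phi>"
    by (simp add: models_foldr_All models_open_iff_standard)
qed

lemma Inf_witness:
  assumes A: "NP_set A" and Inf: "model \<Turnstile> Inf_fm A" and u: "PV_trm u"
  obtains t where "PV_trm t"
    "\<forall>\<^sub>F n in sequentially. term_at u (r n) < term_at t (r n) \<and> np_mem A (term_at t (r n))"
proof -
  obtain c A0 where Ac: "A = (c, A0)" by (cases A)
  let ?\<phi> = "Conj (Less (Var 0) (Var 1)) (Conj (Len_le_pow c (Var 2) (Var 1)) A0)"
  let ?e = "\<lambda>y z. (\<lambda>_. code u)(1 := y, 2 := z) :: nat \<Rightarrow> nat"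
  have \<phi>: "open_fm ?\<phi>" "PV_fm ?\<phi>"
    using A by (simp_all add: Ac Less_standard Len_le_pow_standard)
  have "sat model (\<lambda>_. code u) (Inf_fm A)"
    using Inf code_in_univ[OF u] by (auto simp: models_def)
  then obtain y z where yz: "y \<in> univ model" "z \<in> univ model"
    and less: "sat model (?e y (code u)) (Less (Var 0) (Var 1))"
    and mem: "sat model (?e y z) (Conj (Len_le_pow c (Var 2) (Var 1)) A0)"
    using code_in_univ[OF u] by (auto simp: Inf_fm_def Ac fun_upd_idem)
  have "sat model (?e y z) (Less (Var 0) (Var 1))"
    using less by (subst sat_cong) auto
  with mem have "sat model (?e y z) ?\<phi>" by simp
  moreover have "range (?e y z) \<subseteq> univ model"
    using yz code_in_univ[OF u] by auto
  ultimately have "\<forall>\<^sub>F n in sequentially. sat standard_model (value_at (?e y z) n) ?\<phi>"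
    using sat_model[OF \<phi>, of "?e y z"] by simp
  moreover have "eqv (term_of (code u)) u" by (rule term_of_code(2)[OF u])
  ultimately have "\<forall>\<^sub>F n in sequentially. term_at u (r n) < term_at (term_of y) (r n) \<and>
      np_mem A (term_at (term_of y) (r n))"
    unfolding eqv_def
  proof eventually_elim
    case (elim n)
    then have "np_mem A (value_at (?e y z) n 1)"
      using A np_memI[where e = "value_at (?e y z) n"] by (simp add: Ac)
    with elim show ?case by (simp add: Less_standard value_at_def)
  qed
  with PV_term_of[OF yz(1)] show ?thesis by (rule that)
qed

lemma not_Inf_if_Rng_disjoint:
  assumes g: "clocked_machine g" "inputs g = 1" and "0 < q"
    and hits: "\<And>t. PV_trm t \<Longrightarrow>
      \<forall>\<^sub>F n in sequentially. n ^ q < len (term_at t n) \<longrightarrow> (\<exists>x. fun_of g [x] = term_at t n)"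
    and A: "NP_set A" and disjoint: "model \<Turnstile> Rng_disjoint g A"
  shows "\<not> model \<Turnstile> Inf_fm A"
proof
  assume Inf: "model \<Turnstile> Inf_fm A"
  obtain m where m: "computes_num 2 m (\<lambda>xs. num_of (replicate (len (xs ! 0) * len (xs ! 1)) True))"
    using computes_len_mult by blast
  define u where "u = pow_trm m 0 q"
  have "n ^ q < Suc n ^ q" for n
    using \<open>0 < q\<close> by (simp add: power_strict_mono)
  then have long: "n ^ q < len (term_at u n)" for n
    using pow_trm(3)[OF m, of "\<lambda>_. 2 ^ n" 0 q]
    by (simp add: u_def term_at_def len_two_power trans_less_add1)
  obtain t where t: "PV_trm t"
    and mem: "\<forall>\<^sub>F n in sequentially. term_at u (r n) < term_at t (r n) \<and> np_mem A (term_at t (r n))"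
    using Inf_witness[OF A Inf pow_trm(1)[OF m]] unfolding u_def by blast
  have "standard_model \<Turnstile> disjoint_matrix g A"
    using disjoint disjoint_matrix[OF A g]
    unfolding Rng_disjoint_eq models_foldr_All by (simp add: models_open_iff_standard)
  then have not_mem: "\<not> np_mem A (fun_of g [x])" for x
    by (rule disjoint_matrix_standard[OF A])
  from eventually_compose_filterlim[OF hits[OF t] filterlim_subseq[OF strict_mono]] mem
  have "\<forall>\<^sub>F n in sequentially. False"
  proof eventually_elim
    case (elim n)
    have "len (term_at u (r n)) \<le> len (term_at t (r n))"
      using elim(2) by (intro len_mono) simp
    with long[of "r n"] elim(1) obtain x where "fun_of g [x] = term_at t (r n)" by auto
    with elim(2) not_mem[of x] show ?case by simp
  qed
  then show False by simp
qed

end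

theorem mainTheorem9:
  assumes "hypothesis_H"
  shows "\<exists>g (M :: (machine, nat) struct).
    generator g \<and> T_PV_model M \<and>
    (\<forall>A. NP_set A \<longrightarrow> M \<Turnstile> Imp (Rng_disjoint g A) (Neg (Inf_fm A)))"
proof -
  obtain d where d: "1 \<le> d" "class_P \<subseteq> SIZE_O d"
    using assms by (auto simp: hypothesis_H_def)
  obtain g where g: "generator g" "\<And>x. fun_of g [x] = num_of (gen_out (bits_of x))"
    by (rule generator_gen_out) (rule that)
  obtain r where r: "strict_mono (r :: nat \<Rightarrow> nat)"
    "\<And>p. (\<forall>\<^sub>F n in sequentially. term_at (fst p) (r n) = term_at (snd p) (r n)) \<or>
      (\<forall>\<^sub>F n in sequentially. term_at (fst p) (r n) \<noteq> term_at (snd p) (r n))"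
    by (rule subseq_decides[of "\<lambda>p n. term_at (fst p) n = term_at (snd p) n"]) (rule that)
  interpret decided_subsequence r
    using r(1) r(2)[of "(t, u)" for t u] by unfold_locales simp_all
  have machine: "clocked_machine g" "inputs g = 1"
    using g(1) by (auto simp: generator_def)
  have "model \<Turnstile> Imp (Rng_disjoint g A) (Neg (Inf_fm A))" if A: "NP_set A" for A
  proof (intro models_Imp_NegI fvars_Rng_disjoint[OF A machine] fvars_Inf_fm[OF A])
    assume "model \<Turnstile> Rng_disjoint g A"
    then show "\<not> model \<Turnstile> Inf_fm A"
      using gen_out_hits_long_values[OF d(2,1)]
      by (intro not_Inf_if_Rng_disjoint[OF machine _ _ A, of "2 * d + 1"]) (simp_all add: g(2))
  qed
  with g(1) T_PV_model_model show ?thesis by blast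
qed

end
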